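(* Let $A$ be a separable and $B$ a $\sigma$-unital $C^*$-algebra, and let $\varphi=(\varphi_t)_{t\in\mathbb R}: SA\to B$ be an asymptotically translation invariant asymptotic homomorphism with $\varphi_t(0)=0$ for all $t\in\mathbb R$. Let $\{\alpha_i\}_{i\in\mathbb Z}\subseteq C_0(\mathbb R)$ be the functions described in the context, define $\Phi_0: A\to M(B\otimes\mathbb K)$ by the strictly convergent sum $$\Phi_0(a)=\sum_{i,j\in\mathbb Z}\varphi_i\left(\tau_i(\alpha_i\alpha_j)\otimes a\right)\otimes e_{ij},$$ and let $\Phi=q_{B\otimes\mathbb K}\circ\Phi_0: A\to Q(B\otimes\mathbb K)$. Then $\Phi$ is an extension of $A$ by $B\otimes\mathbb K$, i.e. $\Phi$ is a $*$-homomorphism $A\to Q(B\otimes\mathbb K)$.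
   Context: Notation: $SA=C_0(\mathbb R,A)$; $\tau_s(f)(t)=f(t-s)$ denotes translation, both on $SA$ and on $C_0(\mathbb R)$; for $h\in C_0(\mathbb R)$, $a\in A$, $h\otimes a\in SA$ is $t\mapsto h(t)a$. $M(\cdot)$ is the multiplier algebra, $Q(D)=M(D)/D$ and $q_D: M(D)\to Q(D)$ the quotient map. $\mathbb K$ is the $C^*$-algebra of compact operators on $l^2(\mathbb Z)$ with standard matrix units $e_{ij}$, $i,j\in\mathbb Z$. A family of maps $\psi=(\psi_t)_{t\in\mathbb R}: SA\to B$ is an asymptotic homomorphism when $(\psi_t)_{t\in[1,\infty)}$ is one in the usual sense of Connes and Higson ($t\mapsto\psi_t(f)$ norm-continuous for every $f$; asymptotically linear, multiplicative and self-adjoint, pointwise in norm, as $t\to\infty$), and $\lim_{t\to-\infty}\psi_t(f)=0$ for all $f$. It is asymptotically translation invariant when $\lim_{t\to\infty}\left(\psi_{t-s}(f)-\psi_t(\tau_s(f))\right)=0$ for all $s\in\mathbb R$, $f\in SA$. The functions $\alpha_i$: let $\beta_0\in C_0(\mathbb R)$ be a function supported in $[-1,1]$ with $\beta_0(t)>0$ for $t\in(-1,1)$, $\tau_1(\beta_0)\tau_{-1}(\beta_0)=0$ and $\tau_{-1}(\beta_0)\beta_0+\beta_0^2+\tau_1(\beta_0)\beta_0=\beta_0$ (for example $\beta_0(t)=\max(0,1-|t|)$). Put $\beta_i=\tau_{-i}(\beta_0)$ for $i\in\mathbb Z$, and $\alpha_i=\sqrt{\beta_i}$. Then $\{\beta_i\}$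 is a partition of unity, $\beta_i$ is supported in $[-i-1,-i+1]$, and $\alpha_i\alpha_j=0$ when $|i-j|\ge2$. *)

theory Defs
  imports "HOL-Analysis.Analysis"
begin

section \<open>Complex star-algebras and C*-algebras\<close>

class scaleC =
  fixes scaleC :: "complex \<Rightarrow> 'a \<Rightarrow> 'a"  (infixr \<open>*\<^sub>C\<close> 75)

class complex_vector = real_vector + scaleC +
  assumes scaleC_add_right: "c *\<^sub>C (x + y) = c *\<^sub>C x + c *\<^sub>C y"
    and scaleC_add_left: "(c + d) *\<^sub>C x = c *\<^sub>C x + d *\<^sub>C x"
    and scaleC_scaleC: "c *\<^sub>C d *\<^sub>C x = (c * d) *\<^sub>C x"
    and scaleC_one: "1 *\<^sub>C x = x"
    and scaleR_scaleC: "r *\<^sub>R x = complex_of_real r *\<^sub>C x"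

class complex_normed_vector = complex_vector + real_normed_vector +
  assumes norm_scaleC: "norm (c *\<^sub>C x) = cmod c * norm x"

class star_algebra = complex_vector + real_algebra +
  fixes star :: "'a \<Rightarrow> 'a"
  assumes mult_scaleC_left: "(c *\<^sub>C x) * y = c *\<^sub>C (x * y)"
    and mult_scaleC_right: "x * (c *\<^sub>C y) = c *\<^sub>C (x * y)"
    and star_add: "star (x + y) = star x + star y"
    and star_scaleC: "star (c *\<^sub>C x) = cnj c *\<^sub>C star x"
    and star_mult: "star (x * y) = star y * star x"
    and star_star: "star (star x) = x"

text \<open>Not necessarily unital.\<close>
class cstar_algebra = star_algebra + complex_normed_vector + real_normed_algebra + banach +
  assumes cstar_identity: "norm (star x * x) = (norm x)\<^sup>2"

definition clinear_map :: "('a::complex_vector \<Rightarrow> 'b::complex_vector) \<Rightarrow> bool" where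
  "clinear_map f \<longleftrightarrow>
     (\<forall>x y. f (x + y) = f x + f y) \<and> (\<forall>c x. f (c *\<^sub>C x) = c *\<^sub>C f x)"

definition star_hom :: "('a::star_algebra \<Rightarrow> 'b::star_algebra) \<Rightarrow> bool" where
  "star_hom f \<longleftrightarrow>
     clinear_map f \<and> (\<forall>x y. f (x * y) = f x * f y) \<and> (\<forall>x. f (star x) = star (f x))"

definition pos_elem :: "'a::star_algebra \<Rightarrow> bool" where
  "pos_elem x \<longleftrightarrow> (\<exists>y. x = star y * y)"

definition sigma_unital :: "'b::cstar_algebra itself \<Rightarrow> bool" where
  "sigma_unital _ \<longleftrightarrow> (\<exists>u :: nat \<Rightarrow> 'b.
     (\<forall>n. pos_elem (u n) \<and> norm (u n) \<le> 1 \<and> pos_elem (u (Suc n) - u n)) \<and>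
     (\<forall>b. (\<lambda>n. u n * b) \<longlonglongrightarrow> b \<and> (\<lambda>n. b * u n) \<longlonglongrightarrow> b))"

lemma scaleC_zero_left: "0 *\<^sub>C (x::'a::complex_vector) = 0"
  using scaleC_add_left[of 0 0 x] by simp

lemma scaleC_zero_right: "c *\<^sub>C (0::'a::complex_vector) = 0"
  using scaleC_add_right[of c 0 "0::'a"] by simp

lemma scaleC_minus_right: "c *\<^sub>C (- x) = - (c *\<^sub>C (x::'a::complex_vector))"
  using scaleC_add_right[of c x "- x"] scaleC_zero_right[of c]
  by (metis add.right_inverse eq_neg_iff_add_eq_0 neg_eq_iff_add_eq_0)

lemma scaleC_diff_right: "c *\<^sub>C (x - y) = c *\<^sub>C x - c *\<^sub>C (y::'a::complex_vector)"
  using scaleC_add_right[of c x "- y"] by (simp add: scaleC_minus_right)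

lemma star_zero: "star (0::'a::star_algebra) = 0"
  using star_add[of 0 "0::'a"] by simp

lemma star_minus: "star (- x) = - star (x::'a::star_algebra)"
  using star_add[of x "- x"] by (simp add: star_zero eq_neg_iff_add_eq_0 add.commute)

lemma star_diff: "star (x - y) = star x - star (y::'a::star_algebra)"
  using star_add[of x "- y"] by (simp add: star_minus)

lemma norm_star: "norm (star x) = norm (x::'a::cstar_algebra)"
proof -
  have le: "norm y \<le> norm (star y)" for y :: 'a
  proof (cases "norm y = 0")
    case False
    have "norm y * norm y \<le> norm (star y) * norm y"
      using norm_mult_ineq[of "star y" y] by (simp add: cstar_identity power2_eq_square)
    then show ?thesis using False by simp
  qed auto
  show ?thesis using le[of x] le[of "star x"] by (simp add: star_star)
qed

section \<open>Multiplier algebra and corona algebra\<close>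

text \<open>The multiplier algebra \<open>M(D)\<close> as the algebra of double centralizers of \<open>D\<close>.\<close>

typedef (overloaded) ('d::cstar_algebra) multiplier =
  "{(L :: 'd \<Rightarrow> 'd, R :: 'd \<Rightarrow> 'd).
     bounded_linear L \<and> clinear_map L \<and> bounded_linear R \<and> clinear_map R \<and>
     (\<forall>x y. L (x * y) = L x * y) \<and> (\<forall>x y. R (x * y) = x * R y) \<and>
     (\<forall>x y. x * L y = R x * y)}"
  by (rule exI[of _ "(\<lambda>x. 0, \<lambda>x. 0)"]) (auto simp: clinear_map_def scaleC_zero_right)

setup_lifting type_definition_multiplier

lift_definition mult_L :: "'d::cstar_algebra multiplier \<Rightarrow> 'd \<Rightarrow> 'd" is fst .
lift_definition mult_R :: "'d::cstar_algebra multiplier \<Rightarrow> 'd \<Rightarrow> 'd" is snd .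

lemma multiplier_eqI:
  assumes "\<And>x. mult_L m x = mult_L n x" "\<And>x. mult_R m x = mult_R n x"
  shows "m = n"
  using assms by transfer (auto simp: prod_eq_iff)

lemma bounded_linear_star_conj:
  fixes f :: "'d::cstar_algebra \<Rightarrow> 'd"
  assumes "bounded_linear f"
  shows "bounded_linear (\<lambda>x. star (f (star x)))"
proof -
  interpret f: bounded_linear f by fact
  obtain K where K: "\<And>x. norm (f x) \<le> norm x * K" using f.bounded by blast
  have sR: "star (r *\<^sub>R x) = r *\<^sub>R star x" for r and x :: 'd
    by (simp add: scaleR_scaleC star_scaleC)
  show ?thesis
  proof (rule bounded_linear_intro[where K = K])
    show "norm (star (f (star x))) \<le> norm x * K" for x
      using K[of "star x"] by (simp add: norm_star)
  qed (simp_all add: star_add f.add sR f.scaleR)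
qed

lemma bounded_linear_scaleC: "bounded_linear (\<lambda>x::'a::complex_normed_vector. c *\<^sub>C x)"
proof (rule bounded_linear_intro[where K = "cmod c"])
  show "c *\<^sub>C (r *\<^sub>R x) = r *\<^sub>R c *\<^sub>C x" for r and x :: 'a
    by (simp add: scaleR_scaleC scaleC_scaleC mult.commute)
qed (simp_all add: scaleC_add_right norm_scaleC mult.commute)

instantiation multiplier :: (cstar_algebra) star_algebra
begin

lift_definition zero_multiplier :: "'a multiplier" is "(\<lambda>x. 0, \<lambda>x. 0)"
  by (auto simp: clinear_map_def scaleC_zero_right)

lift_definition plus_multiplier :: "'a multiplier \<Rightarrow> 'a multiplier \<Rightarrow> 'a multiplier"
  is "\<lambda>(L, R) (L', R'). (\<lambda>x. L x + L' x, \<lambda>x. R x + R' x)"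
  by (auto simp: clinear_map_def scaleC_add_right algebra_simps intro: bounded_linear_add)

lift_definition uminus_multiplier :: "'a multiplier \<Rightarrow> 'a multiplier"
  is "\<lambda>(L, R). (\<lambda>x. - L x, \<lambda>x. - R x)"
  by (auto simp: clinear_map_def scaleC_minus_right intro: bounded_linear_minus)

lift_definition minus_multiplier :: "'a multiplier \<Rightarrow> 'a multiplier \<Rightarrow> 'a multiplier"
  is "\<lambda>(L, R) (L', R'). (\<lambda>x. L x - L' x, \<lambda>x. R x - R' x)"
  by (auto simp: clinear_map_def scaleC_diff_right algebra_simps intro: bounded_linear_sub)

lift_definition scaleC_multiplier :: "complex \<Rightarrow> 'a multiplier \<Rightarrow> 'a multiplier"
  is "\<lambda>c (L, R). (\<lambda>x. c *\<^sub>C L x, \<lambda>x. c *\<^sub>C R x)"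
  by (auto simp: clinear_map_def scaleC_add_right scaleC_scaleC mult.commute
      mult_scaleC_left mult_scaleC_right
      intro: bounded_linear_compose[OF bounded_linear_scaleC])

definition scaleR_multiplier :: "real \<Rightarrow> 'a multiplier \<Rightarrow> 'a multiplier" where
  "scaleR_multiplier r m = complex_of_real r *\<^sub>C m"

lift_definition times_multiplier :: "'a multiplier \<Rightarrow> 'a multiplier \<Rightarrow> 'a multiplier"
  is "\<lambda>(L, R) (L', R'). (\<lambda>x. L (L' x), \<lambda>x. R' (R x))"
  by (auto simp: clinear_map_def intro: bounded_linear_compose)

lift_definition star_multiplier :: "'a multiplier \<Rightarrow> 'a multiplier"
  is "\<lambda>(L, R). (\<lambda>x. star (R (star x)), \<lambda>x. star (L (star x)))"
proof safe
  fix L R :: "'a \<Rightarrow> 'a" and x y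
  assume "\<forall>x y. x * L y = R x * y"
  then have "star (star y * L (star x)) = star (R (star y) * star x)" by simp
  then show "x * star (R (star y)) = star (L (star x)) * y"
    by (simp add: star_mult star_star)
qed (auto simp: clinear_map_def star_add star_scaleC star_mult star_star
    intro: bounded_linear_star_conj)

lemma mult_LR_simps:
  "mult_L 0 x = 0" "mult_R 0 x = (0::'a)"
  "mult_L (m + n) x = mult_L m x + mult_L n x" "mult_R (m + n) x = mult_R m x + mult_R n x"
  "mult_L (- m) x = - mult_L m x" "mult_R (- m) x = - mult_R m x"
  "mult_L (m - n) x = mult_L m x - mult_L n x" "mult_R (m - n) x = mult_R m x - mult_R n x"
  "mult_L (c *\<^sub>C m) x = c *\<^sub>C mult_L m x" "mult_R (c *\<^sub>C m) x = c *\<^sub>C mult_R m x"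
  "mult_L (m * n) x = mult_L m (mult_L n x)" "mult_R (m * n) x = mult_R n (mult_R m x)"
  "mult_L (star m) x = star (mult_R m (star x))" "mult_R (star m) x = star (mult_L m (star x))"
  for m n :: "'a multiplier"
  by (transfer, auto split: prod.splits)+

lemma mult_LR_linear:
  "mult_L m (x + y) = mult_L m x + mult_L m y" "mult_R m (x + y) = mult_R m x + mult_R m y"
  "mult_L m (c *\<^sub>C x) = c *\<^sub>C mult_L m x" "mult_R m (c *\<^sub>C x) = c *\<^sub>C mult_R m x"
  "mult_L m (x * y) = mult_L m x * y" "mult_R m (x * y) = x * mult_R m y"
  "x * mult_L m y = mult_R m x * y"
  for m :: "'a multiplier"
  by (transfer, auto simp: clinear_map_def)+

instance
  by standard
    (rule multiplier_eqI; simp add: scaleR_multiplier_def mult_LR_simps mult_LR_linear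
      scaleC_add_right scaleC_add_left scaleC_scaleC scaleC_one scaleR_scaleC
      star_add star_scaleC star_mult star_star algebra_simps)+

end

text \<open>The canonical embedding of \<open>D\<close> into \<open>M(D)\<close>.\<close>
lift_definition of_algebra :: "'d::cstar_algebra \<Rightarrow> 'd multiplier"
  is "\<lambda>d. (\<lambda>x. d * x, \<lambda>x. x * d)"
  by (auto simp: clinear_map_def algebra_simps mult_scaleC_left mult_scaleC_right
      bounded_linear_mult_right bounded_linear_mult_left)

lemma mult_LR_of_algebra: "mult_L (of_algebra d) x = d * x" "mult_R (of_algebra d) x = x * d"
  by (transfer, simp)+

lemma of_algebra_simps:
  fixes d e :: "'d::cstar_algebra"
  shows "of_algebra 0 = (0 :: 'd multiplier)"
    "of_algebra (d + e) = of_algebra d + of_algebra e"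
    "of_algebra (- d) = - of_algebra d"
    "of_algebra (c *\<^sub>C d) = c *\<^sub>C of_algebra d"
    "of_algebra (star d) = star (of_algebra d)"
    "of_algebra (mult_L m d) = m * of_algebra d"
    "of_algebra (mult_R m d) = of_algebra d * m"
  by (rule multiplier_eqI; simp add: mult_LR_simps mult_LR_of_algebra mult_LR_linear
      star_mult star_star mult_scaleC_left mult_scaleC_right algebra_simps;
      simp add: mult_LR_linear(7)[symmetric] mult_LR_linear(5,6))+

text \<open>The corona algebra \<open>Q(D) = M(D)/D\<close>. Only its structure as a complex star-algebra is set up,
  which is all that the notion of a star-homomorphism into it refers to.\<close>

definition corona_rel :: "'d::cstar_algebra multiplier \<Rightarrow> 'd multiplier \<Rightarrow> bool" where
  "corona_rel m n \<longleftrightarrow> m - n \<in> range of_algebra"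

lemma corona_relI: "m - n = of_algebra d \<Longrightarrow> corona_rel m n"
  by (auto simp: corona_rel_def)

quotient_type (overloaded) 'd corona = "'d::cstar_algebra multiplier" / corona_rel
proof (rule equivpI)
  show "reflp (corona_rel :: 'd multiplier \<Rightarrow> _)"
    by (auto intro!: reflpI corona_relI[of _ _ 0] simp: of_algebra_simps)
  show "symp (corona_rel :: 'd multiplier \<Rightarrow> _)"
  proof (rule sympI)
    fix m n :: "'d multiplier"
    assume "corona_rel m n"
    then obtain d where "m - n = of_algebra d" by (auto simp: corona_rel_def)
    then have "n - m = of_algebra (- d)" by (simp add: of_algebra_simps flip: minus_diff_eq[of m n])
    then show "corona_rel n m" by (rule corona_relI)
  qed
  show "transp (corona_rel :: 'd multiplier \<Rightarrow> _)"
  proof (rule transpI)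
    fix m n k :: "'d multiplier"
    assume "corona_rel m n" "corona_rel n k"
    then obtain d e where "m - n = of_algebra d" "n - k = of_algebra e"
      by (auto simp: corona_rel_def)
    then have "m - k = of_algebra (d + e)"
      by (simp add: of_algebra_simps flip: diff_add_eq_diff_diff_swap) (metis diff_add_cancel add_diff_eq)
    then show "corona_rel m k" by (rule corona_relI)
  qed
qed

text \<open>The quotient map \<open>M(D) \<rightarrow> Q(D)\<close>.\<close>
definition corona_map :: "'d::cstar_algebra multiplier \<Rightarrow> 'd corona" where
  "corona_map = abs_corona"

instantiation corona :: (cstar_algebra) star_algebra
begin

lift_definition zero_corona :: "'a corona" is 0 .

lift_definition plus_corona :: "'a corona \<Rightarrow> 'a corona \<Rightarrow> 'a corona" is "(+)"
proof -
  fix m m' n n' :: "'a multiplier"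
  assume "corona_rel m m'" "corona_rel n n'"
  then obtain d e where "m - m' = of_algebra d" "n - n' = of_algebra e"
    by (auto simp: corona_rel_def)
  then have "(m + n) - (m' + n') = of_algebra (d + e)"
    by (simp add: of_algebra_simps add_diff_add)
  then show "corona_rel (m + n) (m' + n')" by (rule corona_relI)
qed

lift_definition uminus_corona :: "'a corona \<Rightarrow> 'a corona" is uminus
proof -
  fix m m' :: "'a multiplier"
  assume "corona_rel m m'"
  then obtain d where "m - m' = of_algebra d" by (auto simp: corona_rel_def)
  then have "(- m) - (- m') = of_algebra (- d)"
    by (simp add: of_algebra_simps) (metis minus_diff_eq minus_diff_commute)
  then show "corona_rel (- m) (- m')" by (rule corona_relI)
qed

definition minus_corona :: "'a corona \<Rightarrow> 'a corona \<Rightarrow> 'a corona" where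
  "minus_corona x y = x + - y"

lift_definition scaleC_corona :: "complex \<Rightarrow> 'a corona \<Rightarrow> 'a corona" is scaleC
proof -
  fix c and m m' :: "'a multiplier"
  assume "corona_rel m m'"
  then obtain d where "m - m' = of_algebra d" by (auto simp: corona_rel_def)
  then have "c *\<^sub>C m - c *\<^sub>C m' = of_algebra (c *\<^sub>C d)"
    by (simp add: of_algebra_simps flip: scaleC_diff_right)
  then show "corona_rel (c *\<^sub>C m) (c *\<^sub>C m')" by (rule corona_relI)
qed

definition scaleR_corona :: "real \<Rightarrow> 'a corona \<Rightarrow> 'a corona" where
  "scaleR_corona r x = complex_of_real r *\<^sub>C x"

lift_definition times_corona :: "'a corona \<Rightarrow> 'a corona \<Rightarrow> 'a corona" is "(*)"
proof -
  fix m m' n n' :: "'a multiplier"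
  assume "corona_rel m m'" "corona_rel n n'"
  then obtain d e where de: "m - m' = of_algebra d" "n - n' = of_algebra e"
    by (auto simp: corona_rel_def)
  have "m * n - m' * n' = (m - m') * n + m' * (n - n')" by (simp add: algebra_simps)
  also have "\<dots> = of_algebra (mult_R n d + mult_L m' e)"
    by (simp add: de of_algebra_simps)
  finally show "corona_rel (m * n) (m' * n')" by (rule corona_relI)
qed

lift_definition star_corona :: "'a corona \<Rightarrow> 'a corona" is star
proof -
  fix m m' :: "'a multiplier"
  assume "corona_rel m m'"
  then obtain d where "m - m' = of_algebra d" by (auto simp: corona_rel_def)
  then have "star m - star m' = of_algebra (star d)"
    by (simp add: of_algebra_simps flip: star_diff)
  then show "corona_rel (star m) (star m')" by (rule corona_relI)
qed

lemma corona_rel_refl: "corona_rel m (m :: 'a multiplier)"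
  by (auto intro!: corona_relI[of _ _ 0] simp: of_algebra_simps)

lemma corona_rel_eq: "m = n \<Longrightarrow> corona_rel m (n :: 'a multiplier)"
  using corona_rel_refl by simp

instance
proof
  fix x y z :: "'a corona" and r s :: real and c d :: complex
  show "x + y + z = x + (y + z)" by transfer (rule corona_rel_eq, simp add: algebra_simps)
  show "x + y = y + x" by transfer (rule corona_rel_eq, simp add: algebra_simps)
  show "0 + x = x" by transfer (rule corona_rel_eq, simp)
  show "- x + x = 0" by transfer (rule corona_rel_eq, simp)
  show "x - y = x + - y" by (simp add: minus_corona_def)
  show C: "c *\<^sub>C (x + y) = c *\<^sub>C x + c *\<^sub>C y" for c and x y :: "'a corona"
    by transfer (rule corona_rel_eq, simp add: scaleC_add_right)
  show C2: "(c + d) *\<^sub>C x = c *\<^sub>C x + d *\<^sub>C x" for c d and x :: "'a corona"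
    by transfer (rule corona_rel_eq, simp add: scaleC_add_left)
  show C3: "c *\<^sub>C d *\<^sub>C x = (c * d) *\<^sub>C x" for c d and x :: "'a corona"
    by transfer (rule corona_rel_eq, simp add: scaleC_scaleC)
  show C4: "1 *\<^sub>C x = x" for x :: "'a corona"
    by transfer (rule corona_rel_eq, simp add: scaleC_one)
  show "r *\<^sub>R x = complex_of_real r *\<^sub>C x" by (simp add: scaleR_corona_def)
  show "r *\<^sub>R (x + y) = r *\<^sub>R x + r *\<^sub>R y" "(r + s) *\<^sub>R x = r *\<^sub>R x + s *\<^sub>R x"
    "r *\<^sub>R s *\<^sub>R x = (r * s) *\<^sub>R x" "1 *\<^sub>R x = x"
    by (simp_all add: scaleR_corona_def C C2 C3 C4)
  show "x * y * z = x * (y * z)" by transfer (rule corona_rel_eq, simp add: mult.assoc)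
  show "(x + y) * z = x * z + y * z" by transfer (rule corona_rel_eq, simp add: algebra_simps)
  show "x * (y + z) = x * y + x * z" by transfer (rule corona_rel_eq, simp add: algebra_simps)
  show M1: "(c *\<^sub>C x) * y = c *\<^sub>C (x * y)" for c and x y :: "'a corona"
    by transfer (rule corona_rel_eq, simp add: mult_scaleC_left)
  show M2: "x * (c *\<^sub>C y) = c *\<^sub>C (x * y)" for c and x y :: "'a corona"
    by transfer (rule corona_rel_eq, simp add: mult_scaleC_right)
  show "r *\<^sub>R x * y = r *\<^sub>R (x * y)" "x * r *\<^sub>R y = r *\<^sub>R (x * y)"
    by (simp_all add: scaleR_corona_def M1 M2)
  show "star (x + y) = star x + star y" by transfer (rule corona_rel_eq, simp add: star_add)
  show "star (c *\<^sub>C x) = cnj c *\<^sub>C star x" by transfer (rule corona_rel_eq, simp add: star_scaleC)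
  show "star (x * y) = star y * star x" by transfer (rule corona_rel_eq, simp add: star_mult)
  show "star (star x) = x" by transfer (rule corona_rel_eq, simp add: star_star)
qed

end

text \<open>Convergence in the strict topology of \<open>M(D)\<close>, and strictly convergent (unordered) sums.\<close>

definition strict_tendsto ::
    "('i \<Rightarrow> 'd::cstar_algebra multiplier) \<Rightarrow> 'd multiplier \<Rightarrow> 'i filter \<Rightarrow> bool" where
  "strict_tendsto f m F \<longleftrightarrow>
     (\<forall>d. ((\<lambda>i. mult_L (f i) d) \<longlongrightarrow> mult_L m d) F \<and> ((\<lambda>i. mult_R (f i) d) \<longlongrightarrow> mult_R m d) F)"

definition strict_has_sum ::
    "('i \<Rightarrow> 'd::cstar_algebra multiplier) \<Rightarrow> 'd multiplier \<Rightarrow> bool" where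
  "strict_has_sum f m \<longleftrightarrow> strict_tendsto (sum f) m (finite_subsets_at_top UNIV)"

section \<open>Compact operators on the Hilbert space \<open>l\<^sup>2(Z)\<close>\<close>

typedef l2Z = "{x :: int \<Rightarrow> complex. (\<lambda>i. (cmod (x i))\<^sup>2) summable_on UNIV}"
  morphisms l2_coord Abs_l2Z
  by (rule exI[of _ "\<lambda>_. 0"]) simp

setup_lifting type_definition_l2Z

lemma l2Z_eqI: "(\<And>i. l2_coord x i = l2_coord y i) \<Longrightarrow> x = y"
  by (simp add: l2_coord_inject[symmetric] fun_eq_iff)

lemma l2_summable: "(\<lambda>i. (cmod (l2_coord x i))\<^sup>2) summable_on UNIV"
  using l2_coord[of x] by simp

lemma cmod_add_square_le: "(cmod (a + b))\<^sup>2 \<le> 2 * (cmod a)\<^sup>2 + 2 * (cmod b)\<^sup>2"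
proof -
  have "(cmod (a + b))\<^sup>2 \<le> (cmod a + cmod b)\<^sup>2"
    by (intro power_mono norm_triangle_ineq norm_ge_zero)
  also have "\<dots> \<le> 2 * (cmod a)\<^sup>2 + 2 * (cmod b)\<^sup>2"
    using sum_squares_bound[of "cmod a" "cmod b"] by (simp add: power2_sum)
  finally show ?thesis .
qed

lemma square_summable_add:
  fixes f g :: "int \<Rightarrow> complex"
  assumes "(\<lambda>i. (cmod (f i))\<^sup>2) summable_on UNIV" "(\<lambda>i. (cmod (g i))\<^sup>2) summable_on UNIV"
  shows "(\<lambda>i. (cmod (f i + g i))\<^sup>2) summable_on UNIV"
proof (rule summable_on_comparison_test)
  show "(\<lambda>i. 2 * (cmod (f i))\<^sup>2 + 2 * (cmod (g i))\<^sup>2) summable_on UNIV"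
    by (intro summable_on_add summable_on_cmult_right assms)
qed (auto simp: cmod_add_square_le)

lemma square_summable_cmult:
  fixes f :: "int \<Rightarrow> complex"
  assumes "(\<lambda>i. (cmod (f i))\<^sup>2) summable_on UNIV"
  shows "(\<lambda>i. (cmod (c * f i))\<^sup>2) summable_on UNIV"
  using summable_on_cmult_right[OF assms, of "(cmod c)\<^sup>2"] by (simp add: norm_mult power_mult_distrib)

lemma inner_summable: "(\<lambda>i. l2_coord x i * cnj (l2_coord y i)) summable_on UNIV"
proof (rule abs_summable_summable, rule summable_on_comparison_test)
  show "(\<lambda>i. (cmod (l2_coord x i))\<^sup>2 + (cmod (l2_coord y i))\<^sup>2) summable_on UNIV"
    by (intro summable_on_add l2_summable)
  show "norm (l2_coord x i * cnj (l2_coord y i)) \<le> (cmod (l2_coord x i))\<^sup>2 + (cmod (l2_coord y i))\<^sup>2" for i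
  proof -
    have "0 \<le> cmod (l2_coord x i) * cmod (l2_coord y i)" by simp
    then show ?thesis
      using sum_squares_bound[of "cmod (l2_coord x i)" "cmod (l2_coord y i)"]
      unfolding norm_mult complex_mod_cnj by linarith
  qed
qed auto

text \<open>The inner product of \<open>l\<^sup>2(Z)\<close>, linear in the first argument.\<close>
definition cinner :: "l2Z \<Rightarrow> l2Z \<Rightarrow> complex" where
  "cinner x y = (\<Sum>\<^sub>\<infinity>i. l2_coord x i * cnj (l2_coord y i))"

instantiation l2Z :: complex_vector
begin

lift_definition zero_l2Z :: l2Z is "\<lambda>_. 0" by simp

lift_definition plus_l2Z :: "l2Z \<Rightarrow> l2Z \<Rightarrow> l2Z" is "\<lambda>x y i. x i + y i"
  by (rule square_summable_add)

lift_definition uminus_l2Z :: "l2Z \<Rightarrow> l2Z" is "\<lambda>x i. - x i"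
  by simp

definition minus_l2Z :: "l2Z \<Rightarrow> l2Z \<Rightarrow> l2Z" where "minus_l2Z x y = x + - y"

lift_definition scaleC_l2Z :: "complex \<Rightarrow> l2Z \<Rightarrow> l2Z" is "\<lambda>c x i. c * x i"
  by (rule square_summable_cmult)

definition scaleR_l2Z :: "real \<Rightarrow> l2Z \<Rightarrow> l2Z" where
  "scaleR_l2Z r x = complex_of_real r *\<^sub>C x"

lemma l2_coord_simps [simp]:
  "l2_coord 0 i = 0" "l2_coord (x + y) i = l2_coord x i + l2_coord y i"
  "l2_coord (- x) i = - l2_coord x i" "l2_coord (x - y) i = l2_coord x i - l2_coord y i"
  "l2_coord (c *\<^sub>C x) i = c * l2_coord x i"
  "l2_coord (r *\<^sub>R x) i = complex_of_real r * l2_coord x i"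
  unfolding minus_l2Z_def scaleR_l2Z_def by (transfer, simp)+

instance
  by standard (rule l2Z_eqI; simp add: algebra_simps)+

end

lemma cinner_add_left: "cinner (x + y) z = cinner x z + cinner y z"
  unfolding cinner_def by (simp add: distrib_right infsum_add inner_summable)

lemma cinner_scaleC_left: "cinner (c *\<^sub>C x) y = c * cinner x y"
  unfolding cinner_def by (simp add: mult.assoc infsum_cmult_right')

lemma cinner_commute: "cinner x y = cnj (cinner y x)"
  unfolding cinner_def by (simp add: mult.commute flip: infsum_cnj)

lemma cinner_self: "cinner x x = complex_of_real (\<Sum>\<^sub>\<infinity>i. (cmod (l2_coord x i))\<^sup>2)"
proof -
  have "((\<lambda>i. complex_of_real ((cmod (l2_coord x i))\<^sup>2)) has_sum
      complex_of_real (\<Sum>\<^sub>\<infinity>i. (cmod (l2_coord x i))\<^sup>2)) UNIV"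
    by (intro has_sum_of_real has_sum_infsum l2_summable)
  then show ?thesis
    unfolding cinner_def complex_norm_square[symmetric] by (rule infsumI)
qed

instantiation l2Z :: real_inner
begin

definition inner_l2Z :: "l2Z \<Rightarrow> l2Z \<Rightarrow> real" where "inner_l2Z x y = Re (cinner x y)"
definition norm_l2Z :: "l2Z \<Rightarrow> real" where "norm_l2Z x = sqrt (inner x x)"
definition dist_l2Z :: "l2Z \<Rightarrow> l2Z \<Rightarrow> real" where "dist_l2Z x y = norm (x - y)"
definition sgn_l2Z :: "l2Z \<Rightarrow> l2Z" where "sgn_l2Z x = x /\<^sub>R norm x"
definition uniformity_l2Z :: "(l2Z \<times> l2Z) filter" where
  "uniformity_l2Z = (INF e\<in>{0<..}. principal {(x, y). dist x y < e})"
definition open_l2Z :: "l2Z set \<Rightarrow> bool" where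
  "open_l2Z U \<longleftrightarrow> (\<forall>x\<in>U. \<forall>\<^sub>F (x', y) in uniformity. x' = x \<longrightarrow> y \<in> U)"

instance
proof
  fix x y z :: l2Z and r :: real
  show "inner x y = inner y x"
    unfolding inner_l2Z_def by (subst cinner_commute) simp
  show "inner (x + y) z = inner x z + inner y z"
    by (simp add: inner_l2Z_def cinner_add_left)
  show "inner (r *\<^sub>R x) y = r * inner x y"
    by (simp add: inner_l2Z_def scaleR_scaleC cinner_scaleC_left)
  show "0 \<le> inner x x"
    by (simp add: inner_l2Z_def cinner_self infsum_nonneg)
  show "inner x x = 0 \<longleftrightarrow> x = 0"
  proof
    assume "inner x x = 0"
    then have "(\<Sum>\<^sub>\<infinity>i. (cmod (l2_coord x i))\<^sup>2) = 0" by (simp add: inner_l2Z_def cinner_self)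
    then have "(cmod (l2_coord x i))\<^sup>2 = 0" for i
      by (intro nonneg_infsum_le_0D[where A = UNIV]) (auto simp: l2_summable)
    then show "x = 0" by (intro l2Z_eqI) simp
  qed (simp add: inner_l2Z_def cinner_self)
qed (simp_all add: norm_l2Z_def dist_l2Z_def sgn_l2Z_def uniformity_l2Z_def open_l2Z_def)

end

lemma norm_l2Z_square: "(norm x)\<^sup>2 = (\<Sum>\<^sub>\<infinity>i. (cmod (l2_coord x i))\<^sup>2)"
  by (simp add: norm_l2Z_def inner_l2Z_def cinner_self infsum_nonneg)

lemma cinner_self_norm: "cinner x x = complex_of_real ((norm x)\<^sup>2)"
  by (simp add: cinner_self norm_l2Z_square)

instance l2Z :: complex_normed_vector
proof
  fix c and x :: l2Z
  have "(norm (c *\<^sub>C x))\<^sup>2 = (cmod c * norm x)\<^sup>2"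
    by (simp add: norm_l2Z_square norm_mult power_mult_distrib infsum_cmult_right')
  then show "norm (c *\<^sub>C x) = cmod c * norm x"
    by (rule power2_eq_imp_eq) auto
qed

lemma cinner_zero_left [simp]: "cinner 0 y = 0"
  by (simp add: cinner_def)

lemma cinner_add_right: "cinner x (y + z) = cinner x y + cinner x z"
  by (metis cinner_add_left cinner_commute complex_cnj_add)

lemma cinner_scaleC_right: "cinner x (c *\<^sub>C y) = cnj c * cinner x y"
  by (metis cinner_scaleC_left cinner_commute complex_cnj_mult complex_cnj_cnj)

lemma cinner_diff_left: "cinner (x - y) z = cinner x z - cinner y z"
  using cinner_add_left[of "x - y" y z] by simp

lemma cinner_diff_right: "cinner x (y - z) = cinner x y - cinner x z"
  using cinner_add_right[of x "y - z" z] by simp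

lemma cinner_sum_left: "cinner (sum f F) y = (\<Sum>i\<in>F. cinner (f i) y)"
  by (induction F rule: infinite_finite_induct) (auto simp: cinner_add_left)

lemma cinner_zero_right [simp]: "cinner y 0 = 0"
  by (simp add: cinner_def)

lemma cinner_sum_right: "cinner y (sum f F) = (\<Sum>i\<in>F. cinner y (f i))"
  by (induction F rule: infinite_finite_induct) (auto simp: cinner_add_right)

lemma cinner_bound: "cmod (cinner x y) \<le> norm x * norm y"
proof (cases "cinner x y = 0")
  case False
  define u where "u = cnj (cinner x y) / cmod (cinner x y)"
  have "cmod u = 1" using False by (simp add: u_def norm_divide)
  have "u * cinner x y = complex_of_real (cmod (cinner x y))"
    using False
    by (simp add: u_def mult.commute[of "cnj _"] complex_norm_square[symmetric] power2_eq_square)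
  then have "cmod (cinner x y) = inner (u *\<^sub>C x) y"
    by (simp add: inner_l2Z_def cinner_scaleC_left)
  also have "\<dots> \<le> norm (u *\<^sub>C x) * norm y" by (rule norm_cauchy_schwarz)
  finally show ?thesis using \<open>cmod u = 1\<close> by (simp add: norm_scaleC)
qed simp

lemma l2Z_of_bounded:
  assumes "\<And>F. finite F \<Longrightarrow> (\<Sum>i\<in>F. (cmod (f i))\<^sup>2) \<le> K"
  obtains x where "l2_coord x = f" "(norm x)\<^sup>2 \<le> K"
proof -
  have s: "(\<lambda>i. (cmod (f i))\<^sup>2) summable_on UNIV"
    by (rule nonneg_bdd_above_summable_on) (auto intro!: bdd_aboveI assms)
  then have "l2_coord (Abs_l2Z f) = f" by (simp add: Abs_l2Z_inverse)
  moreover have "(\<Sum>\<^sub>\<infinity>i. (cmod (f i))\<^sup>2) \<le> K"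
    by (rule infsum_le_finite_sums[OF s]) (use assms in auto)
  ultimately show ?thesis using that[of "Abs_l2Z f"] by (simp add: norm_l2Z_square)
qed

lemma sum_coord_le_norm: "finite F \<Longrightarrow> (\<Sum>i\<in>F. (cmod (l2_coord x i))\<^sup>2) \<le> (norm x)\<^sup>2"
  unfolding norm_l2Z_square
  by (rule finite_sum_le_infsum[OF l2_summable]) auto

lemma coord_le_norm: "cmod (l2_coord x i) \<le> norm x"
  using sum_coord_le_norm[of "{i}" x] by (auto intro: power2_le_imp_le)

instance l2Z :: banach
proof
  fix X :: "nat \<Rightarrow> l2Z"
  assume X: "Cauchy X"
  have "Cauchy (\<lambda>n. l2_coord (X n) i)" for i
  proof (rule metric_CauchyI)
    fix e :: real assume "e > 0"
    then obtain M where M: "\<And>m n. m \<ge> M \<Longrightarrow> n \<ge> M \<Longrightarrow> dist (X m) (X n) < e"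
      using metric_CauchyD[OF X \<open>e > 0\<close>] by blast
    have "dist (l2_coord (X m) i) (l2_coord (X n) i) < e" if "m \<ge> M" "n \<ge> M" for m n
      using M[OF that] coord_le_norm[of "X m - X n" i] by (simp add: dist_norm)
    then show "\<exists>M. \<forall>m\<ge>M. \<forall>n\<ge>M. dist (l2_coord (X m) i) (l2_coord (X n) i) < e" by blast
  qed
  then have "\<forall>i. \<exists>l. (\<lambda>n. l2_coord (X n) i) \<longlonglongrightarrow> l"
    by (simp add: Cauchy_convergent_iff convergent_def)
  then obtain l where l: "\<And>i. (\<lambda>n. l2_coord (X n) i) \<longlonglongrightarrow> l i"
    by metis
  have tail: "\<exists>M. \<forall>n\<ge>M. \<forall>F. finite F \<longrightarrow> (\<Sum>i\<in>F. (cmod (l2_coord (X n) i - l i))\<^sup>2) \<le> e\<^sup>2"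
    if e: "e > 0" for e :: real
  proof -
    obtain M where M: "\<And>m n. m \<ge> M \<Longrightarrow> n \<ge> M \<Longrightarrow> dist (X m) (X n) < e"
      using metric_CauchyD[OF X e] by blast
    have "(\<Sum>i\<in>F. (cmod (l2_coord (X n) i - l i))\<^sup>2) \<le> e\<^sup>2" if "n \<ge> M" "finite F" for n F
    proof (rule LIMSEQ_le_const2)
      show "(\<lambda>m. \<Sum>i\<in>F. (cmod (l2_coord (X n) i - l2_coord (X m) i))\<^sup>2)
              \<longlonglongrightarrow> (\<Sum>i\<in>F. (cmod (l2_coord (X n) i - l i))\<^sup>2)"
        by (intro tendsto_sum tendsto_power tendsto_norm tendsto_diff tendsto_const l)
      have "(\<Sum>i\<in>F. (cmod (l2_coord (X n) i - l2_coord (X m) i))\<^sup>2) \<le> e\<^sup>2" if "m \<ge> M" for m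
      proof -
        have "(\<Sum>i\<in>F. (cmod (l2_coord (X n - X m) i))\<^sup>2) \<le> (norm (X n - X m))\<^sup>2"
          by (rule sum_coord_le_norm) fact
        also have "\<dots> \<le> e\<^sup>2"
          using M[OF \<open>n \<ge> M\<close> \<open>m \<ge> M\<close>] by (intro power_mono) (auto simp: dist_norm)
        finally show ?thesis by simp
      qed
      then show "\<exists>N. \<forall>m\<ge>N. (\<Sum>i\<in>F. (cmod (l2_coord (X n) i - l2_coord (X m) i))\<^sup>2) \<le> e\<^sup>2"
        by blast
    qed
    then show ?thesis by blast
  qed
  obtain M where "\<And>F. finite F \<Longrightarrow> (\<Sum>i\<in>F. (cmod (l2_coord (X M) i - l i))\<^sup>2) \<le> 1"
    using tail[OF zero_less_one] by (metis order_refl power_one)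
  then obtain z where z: "l2_coord z = (\<lambda>i. l2_coord (X M) i - l i)" by (rule l2Z_of_bounded)
  define x where "x = X M - z"
  have x: "l2_coord x i = l i" for i by (simp add: x_def z)
  have "X \<longlonglongrightarrow> x"
  proof (rule metric_LIMSEQ_I)
    fix e :: real assume "e > 0"
    then have "e/2 > 0" by simp
    obtain M where M: "\<And>n F. n \<ge> M \<Longrightarrow> finite F \<Longrightarrow>
        (\<Sum>i\<in>F. (cmod (l2_coord (X n) i - l i))\<^sup>2) \<le> (e/2)\<^sup>2"
      using tail[OF \<open>e/2 > 0\<close>] by blast
    have "dist (X n) x < e" if n: "n \<ge> M" for n
    proof -
      obtain w where w: "l2_coord w = (\<lambda>i. l2_coord (X n) i - l i)" "(norm w)\<^sup>2 \<le> (e/2)\<^sup>2"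
        by (rule l2Z_of_bounded[OF M[OF n]])
      have "w = X n - x" by (rule l2Z_eqI) (simp add: w x)
      moreover have "norm w \<le> e/2" using w(2) \<open>e > 0\<close> by - (rule power2_le_imp_le, auto)
      ultimately show ?thesis using \<open>e > 0\<close> by (simp add: dist_norm)
    qed
    then show "\<exists>no. \<forall>n\<ge>no. dist (X n) x < e" by blast
  qed
  then show "convergent X" by (auto simp: convergent_def)
qed

lift_definition l2_basis :: "int \<Rightarrow> l2Z" is "\<lambda>i k. if k = i then 1 else 0"
proof -
  fix i :: int
  have "(\<lambda>k. (cmod (if k = i then 1 else 0))\<^sup>2) summable_on {i}" by simp
  then show "(\<lambda>k. (cmod (if k = i then 1 else 0))\<^sup>2) summable_on UNIV"
    by (rule summable_on_cong_neutral[THEN iffD1, rotated -1]) auto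
qed

lemma l2_coord_basis [simp]: "l2_coord (l2_basis i) k = (if k = i then 1 else 0)"
  by transfer simp

lemma l2_coord_sum: "l2_coord (sum f F) i = (\<Sum>k\<in>F. l2_coord (f k) i)"
  by (induction F rule: infinite_finite_induct) auto

lemma infsum_single_int: "(\<And>k. k \<noteq> i \<Longrightarrow> f k = 0) \<Longrightarrow> (\<Sum>\<^sub>\<infinity>k. f k) = (f (i::int) :: complex)"
  by (subst infsum_cong_neutral[of "{i}" _ f f]) auto

lemma cinner_basis_right: "cinner x (l2_basis i) = l2_coord x i"
  unfolding cinner_def by (subst infsum_single_int[of i]) auto

lemma l2Z_dense:
  assumes "e > 0"
  shows "\<exists>F. finite F \<and> norm (x - (\<Sum>i\<in>F. l2_coord x i *\<^sub>C l2_basis i)) < e"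
proof -
  let ?f = "\<lambda>i. (cmod (l2_coord x i))\<^sup>2"
  have "(sum ?f \<longlongrightarrow> (\<Sum>\<^sub>\<infinity>i. ?f i)) (finite_subsets_at_top UNIV)"
    using has_sum_infsum[OF l2_summable[of x]] by (simp add: has_sum_def)
  then have "\<forall>\<^sub>F F in finite_subsets_at_top UNIV. dist (sum ?f F) (\<Sum>\<^sub>\<infinity>i. ?f i) < e\<^sup>2/2"
    using assms by (intro tendstoD) auto
  then obtain F where F: "finite F" "\<And>G. finite G \<Longrightarrow> F \<subseteq> G \<Longrightarrow> dist (sum ?f G) (\<Sum>\<^sub>\<infinity>i. ?f i) < e\<^sup>2/2"
    unfolding eventually_finite_subsets_at_top by auto
  define y where "y = x - (\<Sum>i\<in>F. l2_coord x i *\<^sub>C l2_basis i)"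
  have y: "l2_coord y k = (if k \<in> F then 0 else l2_coord x k)" for k
    using F(1) by (simp add: y_def l2_coord_sum if_distrib[of "\<lambda>t. _ * t"] sum.delta' cong: if_cong)
  have "(\<Sum>i\<in>G. (cmod (l2_coord y i))\<^sup>2) \<le> e\<^sup>2/2" if "finite G" for G
  proof -
    have "(\<Sum>i\<in>G. (cmod (l2_coord y i))\<^sup>2) = (\<Sum>i\<in>G - F. ?f i)"
      by (rule sum.mono_neutral_cong_right) (use that in \<open>auto simp: y\<close>)
    also have "\<dots> = sum ?f (G \<union> F) - sum ?f F"
      by (subst sum_diff[symmetric]) (use that F in \<open>auto intro: sum.cong\<close>)
    also have "sum ?f (G \<union> F) \<le> (\<Sum>\<^sub>\<infinity>i. ?f i)"
      by (rule finite_sum_le_infsum[OF l2_summable]) (use that F in auto)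
    also have "(\<Sum>\<^sub>\<infinity>i. ?f i) - sum ?f F \<le> e\<^sup>2/2"
      using F(2)[OF F(1) subset_refl] unfolding dist_real_def by linarith
    finally show ?thesis by simp
  qed
  then obtain z where z: "l2_coord z = l2_coord y" "(norm z)\<^sup>2 \<le> e\<^sup>2/2" by (rule l2Z_of_bounded)
  have "z = y" using z(1) by (simp add: l2_coord_inject)
  then have "(norm y)\<^sup>2 \<le> e\<^sup>2 / 2" using z(2) by simp
  also have "\<dots> < e\<^sup>2" using assms by simp
  finally have "(norm y)\<^sup>2 < e\<^sup>2" .
  then have "norm y < e" using assms by - (rule power2_less_imp_less, auto)
  then show ?thesis using F(1) unfolding y_def by blast
qed

lifting_forget l2Z.lifting

definition is_compact_op :: "(l2Z \<Rightarrow>\<^sub>L l2Z) \<Rightarrow> bool" where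
  "is_compact_op T \<longleftrightarrow> clinear_map (blinfun_apply T) \<and> compact (closure (blinfun_apply T ` cball 0 1))"

lemma compact_closure_subset:
  fixes S :: "'a::metric_space set"
  assumes "S \<subseteq> K" "compact K"
  shows "compact (closure S)"
proof -
  have "closure S \<subseteq> K" using assms by (simp add: closure_minimal compact_imp_closed)
  then show ?thesis using assms(2) by (metis closed_closure compact_Int_closed inf.absorb_iff2)
qed

lemma is_compact_opI:
  assumes "clinear_map (blinfun_apply T)" "blinfun_apply T ` cball 0 1 \<subseteq> K" "compact K"
  shows "is_compact_op T"
  using assms by (auto simp: is_compact_op_def intro: compact_closure_subset)

lemma in_closure_ball:
  "norm x \<le> 1 \<Longrightarrow> blinfun_apply T x \<in> closure (blinfun_apply T ` cball 0 1)"
  by (rule subsetD[OF closure_subset]) simp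

lemma is_compact_op_zero: "is_compact_op 0"
  by (rule is_compact_opI[where K = "{0}"]) (auto simp: clinear_map_def scaleC_zero_right)

lemma is_compact_op_add:
  assumes "is_compact_op S" "is_compact_op T"
  shows "is_compact_op (S + T)"
proof (rule is_compact_opI)
  let ?A = "closure (blinfun_apply S ` cball 0 1)" and ?B = "closure (blinfun_apply T ` cball 0 1)"
  show "compact {x + y | x y. x \<in> ?A \<and> y \<in> ?B}"
    using assms by (intro compact_sums) (auto simp: is_compact_op_def)
  show "blinfun_apply (S + T) ` cball 0 1 \<subseteq> {x + y | x y. x \<in> ?A \<and> y \<in> ?B}"
    by (auto simp: blinfun.add_left) (metis in_closure_ball)
qed (use assms in \<open>auto simp: is_compact_op_def clinear_map_def blinfun.add_left scaleC_add_right\<close>)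

lift_definition scaleC_op :: "complex \<Rightarrow> (l2Z \<Rightarrow>\<^sub>L l2Z) \<Rightarrow> (l2Z \<Rightarrow>\<^sub>L l2Z)" is "\<lambda>c f x. c *\<^sub>C f x"
  by (rule bounded_linear_compose[OF bounded_linear_scaleC])

lemma is_compact_op_scaleC:
  assumes "is_compact_op T"
  shows "is_compact_op (scaleC_op c T)"
proof (rule is_compact_opI)
  let ?A = "closure (blinfun_apply T ` cball 0 1)"
  show "compact ((\<lambda>x. c *\<^sub>C x) ` ?A)"
    using assms by (intro compact_continuous_image linear_continuous_on bounded_linear_scaleC)
      (auto simp: is_compact_op_def)
  show "blinfun_apply (scaleC_op c T) ` cball 0 1 \<subseteq> (\<lambda>x. c *\<^sub>C x) ` ?A"
    by (auto simp: scaleC_op.rep_eq intro!: imageI in_closure_ball)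
qed (use assms in \<open>auto simp: is_compact_op_def clinear_map_def scaleC_op.rep_eq
       scaleC_add_right scaleC_scaleC mult.commute\<close>)

lemma is_compact_op_compose:
  assumes "clinear_map (blinfun_apply S)" "is_compact_op T"
  shows "is_compact_op (S o\<^sub>L T)"
proof (rule is_compact_opI)
  let ?A = "closure (blinfun_apply T ` cball 0 1)"
  show "compact (blinfun_apply S ` ?A)"
    using assms by (intro compact_continuous_image linear_continuous_on blinfun.bounded_linear_right)
      (auto simp: is_compact_op_def)
  show "blinfun_apply (S o\<^sub>L T) ` cball 0 1 \<subseteq> blinfun_apply S ` ?A"
    by (auto intro!: imageI in_closure_ball)
qed (use assms in \<open>auto simp: is_compact_op_def clinear_map_def\<close>)

lemma compact_closure_iff_totally_bounded:
  fixes S :: "l2Z set"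
  shows "compact (closure S) \<longleftrightarrow> (\<forall>e>0. \<exists>k. finite k \<and> S \<subseteq> (\<Union>x\<in>k. ball x e))"
proof
  assume "compact (closure S)"
  then show "\<forall>e>0. \<exists>k. finite k \<and> S \<subseteq> (\<Union>x\<in>k. ball x e)"
    unfolding compact_eq_totally_bounded using closure_subset[of S] by (meson subset_trans)
next
  assume *: "\<forall>e>0. \<exists>k. finite k \<and> S \<subseteq> (\<Union>x\<in>k. ball x e)"
  have "\<exists>k. finite k \<and> closure S \<subseteq> (\<Union>x\<in>k. ball x e)" if e: "e > 0" for e
  proof -
    obtain k where k: "finite k" "S \<subseteq> (\<Union>x\<in>k. ball x (e/2))"
      using * e by (meson half_gt_zero)
    have "closure S \<subseteq> (\<Union>x\<in>k. cball x (e/2))"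
    proof (rule closure_minimal)
      show "S \<subseteq> (\<Union>x\<in>k. cball x (e/2))"
        using k(2) UN_mono[OF subset_refl ball_subset_cball] by (rule order_trans)
      show "closed (\<Union>x\<in>k. cball x (e/2))" using k(1) by (intro closed_UN) auto
    qed
    also have "\<dots> \<subseteq> (\<Union>x\<in>k. ball x e)"
      by (rule UN_mono) (use e in \<open>auto simp: mem_ball mem_cball\<close>)
    finally show ?thesis using k by blast
  qed
  then show "compact (closure S)"
    unfolding compact_eq_totally_bounded by (auto simp: complete_eq_closed)
qed

lemma is_compact_op_limit:
  assumes X: "\<And>n. is_compact_op (X n)" and lim: "X \<longlonglongrightarrow> T"
  shows "is_compact_op T"
proof -
  have lim': "(\<lambda>n. blinfun_apply (X n) x) \<longlonglongrightarrow> blinfun_apply T x" for x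
    using lim by (rule blinfun.tendsto[OF _ tendsto_const])
  have add: "blinfun_apply T (c *\<^sub>C x) = c *\<^sub>C blinfun_apply T x" for c x
  proof (rule LIMSEQ_unique[OF lim'])
    have "(\<lambda>n. c *\<^sub>C blinfun_apply (X n) x) \<longlonglongrightarrow> c *\<^sub>C blinfun_apply T x"
      by (rule bounded_linear.tendsto[OF bounded_linear_scaleC lim'])
    then show "(\<lambda>n. blinfun_apply (X n) (c *\<^sub>C x)) \<longlonglongrightarrow> c *\<^sub>C blinfun_apply T x"
      using X by (simp add: is_compact_op_def clinear_map_def)
  qed
  have "\<exists>k. finite k \<and> blinfun_apply T ` cball 0 1 \<subseteq> (\<Union>x\<in>k. ball x e)" if "e > 0" for e
  proof -
    obtain n where n: "dist (X n) T < e/2"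
      using lim \<open>e > 0\<close> by (metis half_gt_zero lim_sequentially order_refl)
    obtain k where k: "finite k" "blinfun_apply (X n) ` cball 0 1 \<subseteq> (\<Union>x\<in>k. ball x (e/2))"
      using X[of n] \<open>e > 0\<close> unfolding is_compact_op_def compact_closure_iff_totally_bounded
      by (meson half_gt_zero)
    have "blinfun_apply T x \<in> (\<Union>x\<in>k. ball x e)" if x: "x \<in> cball 0 1" for x
    proof -
      obtain c where c: "c \<in> k" "dist c (blinfun_apply (X n) x) < e/2" using subsetD[OF k(2) imageI[OF x]] by auto
      have "dist (blinfun_apply (X n) x) (blinfun_apply T x) \<le> norm (X n - T) * norm x"
        by (metis dist_norm blinfun.diff_left norm_blinfun)
      also have "\<dots> \<le> norm (X n - T)" using that by (intro mult_left_le) auto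
      also have "\<dots> < e/2" using n by (simp add: dist_norm)
      finally have "dist c (blinfun_apply T x) < e"
        using c dist_triangle[of c "blinfun_apply T x" "blinfun_apply (X n) x"] by linarith
      then show ?thesis using c by auto
    qed
    then show ?thesis using k by blast
  qed
  then show ?thesis
    by (auto simp: is_compact_op_def compact_closure_iff_totally_bounded clinear_map_def add
        blinfun.add_right)
qed

lemma adjoint_exists:
  assumes T: "clinear_map (blinfun_apply T)"
  shows "\<exists>S. clinear_map (blinfun_apply S) \<and> (\<forall>x y. cinner (blinfun_apply T x) y = cinner x (blinfun_apply S y))"
proof -
  define c where "c y i = cinner y (blinfun_apply T (l2_basis i))" for y i
  have T_sum: "blinfun_apply T (\<Sum>i\<in>F. a i *\<^sub>C l2_basis i) = (\<Sum>i\<in>F. a i *\<^sub>C blinfun_apply T (l2_basis i))"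
    for F and a :: "int \<Rightarrow> complex"
    using T by (simp add: blinfun.sum_right clinear_map_def)
  have "(\<Sum>i\<in>F. (cmod (c y i))\<^sup>2) \<le> (norm T * norm y)\<^sup>2" if "finite F" for F y
  proof -
    let ?s = "\<Sum>i\<in>F. (cmod (c y i))\<^sup>2"
    define v where "v = (\<Sum>i\<in>F. c y i *\<^sub>C l2_basis i)"
    have s: "?s \<ge> 0" by (intro sum_nonneg) auto
    have vc: "l2_coord v k = (if k \<in> F then c y k else 0)" for k
      using that by (simp add: v_def l2_coord_sum if_distrib[of "\<lambda>t. _ * t"] sum.delta' cong: if_cong)
    have "cinner v v = (\<Sum>i\<in>F. c y i * cnj (c y i))"
      unfolding v_def
      by (subst cinner_sum_right, rule sum.cong)
         (use vc in \<open>simp_all add: cinner_scaleC_right cinner_basis_right flip: v_def\<close>)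
    then have "complex_of_real ((norm v)\<^sup>2) = complex_of_real ?s"
      by (simp only: cinner_self_norm of_real_sum complex_norm_square)
    then have nv: "(norm v)\<^sup>2 = ?s" by (simp only: of_real_eq_iff)
    have "cinner y (blinfun_apply T v) = (\<Sum>i\<in>F. c y i * cnj (c y i))"
      unfolding v_def T_sum by (simp add: cinner_sum_right cinner_scaleC_right c_def mult.commute)
    also have "\<dots> = complex_of_real ?s" by (simp only: of_real_sum complex_norm_square)
    finally have "?s = cmod (cinner y (blinfun_apply T v))"
      using s by (metis norm_of_real abs_of_nonneg)
    also have "\<dots> \<le> norm y * (norm T * norm v)"
      by (rule order_trans[OF cinner_bound]) (intro mult_left_mono norm_blinfun norm_ge_zero)
    finally have "norm v * norm v \<le> (norm T * norm y) * norm v"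
      using nv by (simp add: power2_eq_square ac_simps)
    then have "norm v \<le> norm T * norm y"
      by (cases "norm v = 0") (auto simp: mult_nonneg_nonneg)
    then show ?thesis unfolding nv[symmetric] by (intro power_mono) auto
  qed
  then have "\<exists>x. l2_coord x = c y \<and> (norm x)\<^sup>2 \<le> (norm T * norm y)\<^sup>2" for y
    by (metis l2Z_of_bounded)
  then obtain S where S: "\<And>y. l2_coord (S y) = c y" "\<And>y. (norm (S y))\<^sup>2 \<le> (norm T * norm y)\<^sup>2"
    by metis
  have S_lin: "S (x + y) = S x + S y" "S (a *\<^sub>C x) = a *\<^sub>C S x" for x y a
    by (rule l2Z_eqI; simp add: S c_def cinner_add_left cinner_scaleC_left)+
  have bl: "bounded_linear S"
  proof (rule bounded_linear_intro[where K = "norm T"])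
    show "norm (S x) \<le> norm x * norm T" for x
      using S(2)[of x] by - (rule power2_le_imp_le, auto simp: mult.commute)
  qed (simp_all add: S_lin scaleR_scaleC)
  have basis: "cinner (blinfun_apply T (l2_basis i)) y = cinner (l2_basis i) (S y)" for i y
    by (subst (1 2) cinner_commute) (simp add: cinner_basis_right S c_def)
  have "cinner (blinfun_apply T x) y = cinner x (S y)" for x y
  proof -
    have "cmod (cinner (blinfun_apply T x) y - cinner x (S y)) \<le> 0 + e" if "e > 0" for e
    proof -
      define K where "K = norm T * norm y + norm (S y) + 1"
      have "K > 0" by (auto simp: K_def add_nonneg_pos)
      then obtain F where F: "finite F" "norm (x - (\<Sum>i\<in>F. l2_coord x i *\<^sub>C l2_basis i)) < e / K"
        using l2Z_dense[of "e / K" x] \<open>e > 0\<close> by auto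
      define z where "z = (\<Sum>i\<in>F. l2_coord x i *\<^sub>C l2_basis i)"
      have "cinner (blinfun_apply T z) y = cinner z (S y)"
        unfolding z_def T_sum by (simp add: cinner_sum_left cinner_scaleC_left basis)
      then have "cinner (blinfun_apply T x) y - cinner x (S y) =
          cinner (blinfun_apply T (x - z)) y - cinner (x - z) (S y)"
        by (simp add: blinfun.diff_right cinner_diff_left)
      also have "cmod \<dots> \<le> norm (blinfun_apply T (x - z)) * norm y + norm (x - z) * norm (S y)"
        by (rule order_trans[OF norm_triangle_ineq4]) (intro add_mono cinner_bound)
      also have "\<dots> \<le> (norm T * norm (x - z)) * norm y + norm (x - z) * norm (S y)"
        by (intro add_mono mult_right_mono norm_blinfun) auto
      also have "\<dots> \<le> norm (x - z) * K"
        by (simp add: K_def algebra_simps)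
      also have "\<dots> \<le> e" using F(2) \<open>K > 0\<close> by (simp add: z_def pos_less_divide_eq)
      finally show ?thesis by simp
    qed
    then have "cmod (cinner (blinfun_apply T x) y - cinner x (S y)) \<le> 0" by (rule field_le_epsilon)
    then show ?thesis by simp
  qed
  then show ?thesis
    using S_lin bl by (intro exI[of _ "Blinfun S"]) (simp add: bounded_linear_Blinfun_apply clinear_map_def)
qed

definition op_adjoint :: "(l2Z \<Rightarrow>\<^sub>L l2Z) \<Rightarrow> (l2Z \<Rightarrow>\<^sub>L l2Z)" where
  "op_adjoint T = (THE S. \<forall>x y. cinner (blinfun_apply T x) y = cinner x (blinfun_apply S y))"

lemma cinner_ext: "(\<And>x. cinner x y = cinner x z) \<Longrightarrow> y = z"
  using cinner_self_norm[of "y - z"] by (simp add: cinner_diff_right)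

lemma op_adjoint_unique:
  assumes "\<And>x y. cinner (blinfun_apply T x) y = cinner x (blinfun_apply S y)"
  shows "op_adjoint T = S"
  unfolding op_adjoint_def
proof (rule the_equality)
  fix S' assume "\<forall>x y. cinner (blinfun_apply T x) y = cinner x (blinfun_apply S' y)"
  then show "S' = S" using assms by (intro blinfun_eqI cinner_ext) metis
qed (use assms in blast)

lemma op_adjoint:
  assumes "clinear_map (blinfun_apply T)"
  shows "clinear_map (blinfun_apply (op_adjoint T))"
    "cinner (blinfun_apply T x) y = cinner x (blinfun_apply (op_adjoint T) y)"
    "cinner (blinfun_apply (op_adjoint T) x) y = cinner x (blinfun_apply T y)"
proof -
  obtain S where S: "clinear_map (blinfun_apply S)"
    "\<And>x y. cinner (blinfun_apply T x) y = cinner x (blinfun_apply S y)"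
    using adjoint_exists[OF assms] by blast
  have eq: "op_adjoint T = S" by (rule op_adjoint_unique) (rule S)
  show "clinear_map (blinfun_apply (op_adjoint T))"
    "cinner (blinfun_apply T x) y = cinner x (blinfun_apply (op_adjoint T) y)"
    "cinner (blinfun_apply (op_adjoint T) x) y = cinner x (blinfun_apply T y)" for x y
    using S by (simp_all add: eq) (metis cinner_commute)
qed

lemma norm_op_adjoint_square:
  assumes "clinear_map (blinfun_apply T)"
  shows "(norm (blinfun_apply T x))\<^sup>2 \<le> norm (blinfun_apply (op_adjoint T) (blinfun_apply T x)) * norm x"
proof -
  have "complex_of_real ((norm (blinfun_apply T x))\<^sup>2) =
      cinner (blinfun_apply (op_adjoint T) (blinfun_apply T x)) x"
    by (simp add: cinner_self_norm op_adjoint(3)[OF assms] del: of_real_power)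
  then have "(norm (blinfun_apply T x))\<^sup>2 = cmod (cinner (blinfun_apply (op_adjoint T) (blinfun_apply T x)) x)"
    by (metis abs_power2 norm_of_real power2_abs)
  then show ?thesis using cinner_bound by metis
qed

lemma op_adjoint_adjoint: "clinear_map (blinfun_apply T) \<Longrightarrow> op_adjoint (op_adjoint T) = T"
  by (rule op_adjoint_unique) (simp add: op_adjoint(3))

lemma is_compact_op_adjoint:
  assumes "is_compact_op T"
  shows "is_compact_op (op_adjoint T)"
proof -
  let ?S = "op_adjoint T"
  have T: "clinear_map (blinfun_apply T)" using assms by (simp add: is_compact_op_def)
  note S = op_adjoint(1)[OF T]
  have tb: "\<exists>k. finite k \<and> blinfun_apply ?S ` cball 0 1 \<subseteq> (\<Union>x\<in>k. ball x e)" if e: "e > 0" for e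
  proof -
    define d where "d = e\<^sup>2 / 8"
    have d: "d > 0" using e by (simp add: d_def)
    define r where "r = norm ?S + 1"
    have r: "r > 0" by (simp add: r_def add_nonneg_pos)
    obtain k where k: "finite k" "blinfun_apply T ` cball 0 1 \<subseteq> (\<Union>x\<in>k. ball x (d / r))"
      using assms d r unfolding is_compact_op_def compact_closure_iff_totally_bounded
      by (meson divide_pos_pos)
    text \<open>\<open>T\<close> maps the ball of radius \<open>r\<close>, which contains the range of \<open>?S\<close> on the unit ball, to a
      set covered by finitely many balls of radius \<open>d\<close>.\<close>
    define P where "P c y \<longleftrightarrow> y \<in> cball 0 1 \<and>
        dist (r *\<^sub>R c) (blinfun_apply T (blinfun_apply ?S y)) < d" for c y
    define g where "g c = blinfun_apply ?S (SOME y. P c y)" for c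
    have "blinfun_apply ?S y \<in> (\<Union>x\<in>g ` k. ball x e)" if y: "y \<in> cball 0 1" for y
    proof -
      let ?w = "inverse r *\<^sub>R blinfun_apply ?S y"
      have "norm (blinfun_apply ?S y) \<le> norm ?S * norm y" by (rule norm_blinfun)
      also have "\<dots> \<le> norm ?S" using y by (intro mult_left_le) auto
      also have "\<dots> \<le> r" by (simp add: r_def)
      finally have "?w \<in> cball 0 1" using r by (simp add: field_simps)
      then obtain c where c: "c \<in> k" "dist c (blinfun_apply T ?w) < d / r" using k by fastforce
      have "r *\<^sub>R c - blinfun_apply T (blinfun_apply ?S y) = r *\<^sub>R (c - blinfun_apply T ?w)"
        using r by (simp add: blinfun.scaleR_right scaleR_diff_right)
      then have "P c y" using c(2) r y by (simp add: P_def dist_norm pos_less_divide_eq mult.commute)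
      define z where "z = (SOME y. P c y)"
      have z: "P c z" unfolding z_def by (rule someI) fact
      have "dist (blinfun_apply T (blinfun_apply ?S z)) (blinfun_apply T (blinfun_apply ?S y)) < 2 * d"
        using z \<open>P c y\<close> dist_triangle3[of "blinfun_apply T (blinfun_apply ?S z)"
            "blinfun_apply T (blinfun_apply ?S y)" "r *\<^sub>R c"]
        unfolding P_def by linarith
      then have 1: "norm (blinfun_apply T (blinfun_apply ?S (z - y))) < 2 * d"
        by (simp add: dist_norm blinfun.diff_right)
      have 2: "norm (z - y) \<le> 2"
        using z y norm_triangle_ineq4[of z y] by (simp add: P_def)
      have "(norm (blinfun_apply ?S (z - y)))\<^sup>2 \<le> norm (blinfun_apply T (blinfun_apply ?S (z - y))) * norm (z - y)"
        using norm_op_adjoint_square[OF S] by (simp add: op_adjoint_adjoint[OF T])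
      also have "\<dots> \<le> 2 * d * 2" using 1 2 d by (intro mult_mono) auto
      also have "\<dots> < e\<^sup>2" using e by (simp add: d_def)
      finally have "norm (blinfun_apply ?S (z - y)) < e" using e by - (rule power2_less_imp_less, auto)
      then have "dist (g c) (blinfun_apply ?S y) < e"
        by (simp add: g_def dist_norm blinfun.diff_right flip: z_def)
      then show ?thesis using c(1) by auto
    qed
    then show ?thesis using k(1) by (intro exI[of _ "g ` k"]) auto
  qed
  then show ?thesis using S by (simp add: is_compact_op_def compact_closure_iff_totally_bounded)
qed

text \<open>The C*-algebra of compact operators on \<open>l\<^sup>2(Z)\<close>.\<close>

typedef compact_op = "{T. is_compact_op T}"
  morphisms op_of Abs_compact_op
  using is_compact_op_zero by blast

lifting_forget blinfun.lifting
setup_lifting type_definition_compact_op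

lemma op_of_clinear: "clinear_map (blinfun_apply (op_of T))"
  using op_of[of T] by (simp add: is_compact_op_def)

instantiation compact_op :: star_algebra
begin

lift_definition zero_compact_op :: compact_op is 0 by (rule is_compact_op_zero)
lift_definition plus_compact_op :: "compact_op \<Rightarrow> compact_op \<Rightarrow> compact_op" is "(+)"
  by (rule is_compact_op_add)
lift_definition scaleC_compact_op :: "complex \<Rightarrow> compact_op \<Rightarrow> compact_op" is scaleC_op
  by (rule is_compact_op_scaleC)
definition uminus_compact_op :: "compact_op \<Rightarrow> compact_op" where
  "uminus_compact_op T = (-1) *\<^sub>C T"
definition minus_compact_op :: "compact_op \<Rightarrow> compact_op \<Rightarrow> compact_op" where
  "minus_compact_op S T = S + - T"
definition scaleR_compact_op :: "real \<Rightarrow> compact_op \<Rightarrow> compact_op" where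
  "scaleR_compact_op r T = complex_of_real r *\<^sub>C T"
lift_definition times_compact_op :: "compact_op \<Rightarrow> compact_op \<Rightarrow> compact_op" is "(o\<^sub>L)"
  by (rule is_compact_op_compose) (auto simp: is_compact_op_def)
lift_definition star_compact_op :: "compact_op \<Rightarrow> compact_op" is op_adjoint
  by (rule is_compact_op_adjoint)

lemma op_of_apply:
  "blinfun_apply (op_of 0) x = 0"
  "blinfun_apply (op_of (S + T)) x = blinfun_apply (op_of S) x + blinfun_apply (op_of T) x"
  "blinfun_apply (op_of (- T)) x = - blinfun_apply (op_of T) x"
  "blinfun_apply (op_of (S - T)) x = blinfun_apply (op_of S) x - blinfun_apply (op_of T) x"
  "blinfun_apply (op_of (c *\<^sub>C T)) x = c *\<^sub>C blinfun_apply (op_of T) x"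
  "blinfun_apply (op_of (r *\<^sub>R T)) x = r *\<^sub>R blinfun_apply (op_of T) x"
  "blinfun_apply (op_of (S * T)) x = blinfun_apply (op_of S) (blinfun_apply (op_of T) x)"
proof -
  have m: "(-1) *\<^sub>C y = - y" for y :: l2Z by (rule l2Z_eqI) simp
  show "blinfun_apply (op_of 0) x = 0"
    "blinfun_apply (op_of (S + T)) x = blinfun_apply (op_of S) x + blinfun_apply (op_of T) x"
    "blinfun_apply (op_of (- T)) x = - blinfun_apply (op_of T) x"
    "blinfun_apply (op_of (S - T)) x = blinfun_apply (op_of S) x - blinfun_apply (op_of T) x"
    "blinfun_apply (op_of (c *\<^sub>C T)) x = c *\<^sub>C blinfun_apply (op_of T) x"
    "blinfun_apply (op_of (r *\<^sub>R T)) x = r *\<^sub>R blinfun_apply (op_of T) x"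
    "blinfun_apply (op_of (S * T)) x = blinfun_apply (op_of S) (blinfun_apply (op_of T) x)"
    by (simp_all add: uminus_compact_op_def minus_compact_op_def scaleR_compact_op_def
        zero_compact_op.rep_eq plus_compact_op.rep_eq scaleC_compact_op.rep_eq times_compact_op.rep_eq
        scaleC_op.rep_eq blinfun.add_left m scaleR_scaleC)
qed

lemma op_of_star:
  "cinner (blinfun_apply (op_of T) x) y = cinner x (blinfun_apply (op_of (star T)) y)"
  "cinner (blinfun_apply (op_of (star T)) x) y = cinner x (blinfun_apply (op_of T) y)"
  by (simp_all add: star_compact_op.rep_eq op_adjoint[OF op_of_clinear])

lemma compact_op_eqI: "(\<And>x. blinfun_apply (op_of S) x = blinfun_apply (op_of T) x) \<Longrightarrow> S = T"
  by (metis blinfun_eqI op_of_inject)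

lemma op_of_linear:
  "blinfun_apply (op_of T) (x + y) = blinfun_apply (op_of T) x + blinfun_apply (op_of T) y"
  "blinfun_apply (op_of T) (c *\<^sub>C x) = c *\<^sub>C blinfun_apply (op_of T) x"
  using op_of_clinear[of T] by (auto simp: clinear_map_def)

lemma star_compact_op_unique:
  assumes "\<And>x y. cinner x (blinfun_apply (op_of S) y) = cinner x (blinfun_apply (op_of T) y)"
  shows "S = T"
  using assms by (intro compact_op_eqI cinner_ext)

instance
proof
  fix S T U :: compact_op and c :: complex
  show "star (S + T) = star S + star T"
    by (rule star_compact_op_unique)
       (simp add: op_of_apply cinner_add_left cinner_add_right flip: op_of_star(1))
  show "star (c *\<^sub>C T) = cnj c *\<^sub>C star T"
    by (rule star_compact_op_unique)
       (simp add: op_of_apply cinner_scaleC_left cinner_scaleC_right flip: op_of_star(1))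
  show "star (S * T) = star T * star S"
    by (rule star_compact_op_unique) (simp add: op_of_apply flip: op_of_star(1))
  show "star (star T) = T"
    by (rule star_compact_op_unique) (simp flip: op_of_star(1)[of "star T"] add: op_of_star(2))
qed (rule compact_op_eqI; simp add: op_of_apply op_of_linear scaleC_add_right scaleC_add_left
      scaleC_scaleC scaleC_one scaleR_scaleC algebra_simps)+

end

instantiation compact_op :: complex_normed_vector
begin

lift_definition norm_compact_op :: "compact_op \<Rightarrow> real" is norm .
definition dist_compact_op :: "compact_op \<Rightarrow> compact_op \<Rightarrow> real" where
  "dist_compact_op x y = norm (x - y)"
definition sgn_compact_op :: "compact_op \<Rightarrow> compact_op" where "sgn_compact_op x = x /\<^sub>R norm x"
definition uniformity_compact_op :: "(compact_op \<times> compact_op) filter" where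
  "uniformity_compact_op = (INF e\<in>{0<..}. principal {(x, y). dist x y < e})"
definition open_compact_op :: "compact_op set \<Rightarrow> bool" where
  "open_compact_op U \<longleftrightarrow> (\<forall>x\<in>U. \<forall>\<^sub>F (x', y) in uniformity. x' = x \<longrightarrow> y \<in> U)"

lemma op_of_diff: "op_of (S - T) = op_of S - op_of T"
  by (rule blinfun_eqI) (simp add: op_of_apply blinfun.diff_left)

instance
proof
  fix S T :: compact_op and c :: complex and r :: real
  show "norm T = 0 \<longleftrightarrow> T = 0" by transfer simp
  show "norm (S + T) \<le> norm S + norm T" by transfer (rule norm_triangle_ineq)
  show C: "norm (c *\<^sub>C T) = cmod c * norm T" for c and T :: compact_op
  proof -
    have le: "norm (c *\<^sub>C T) \<le> cmod c * norm T" for c and T :: compact_op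
      unfolding norm_compact_op.rep_eq
    proof (rule norm_blinfun_bound)
      fix x
      show "norm (blinfun_apply (op_of (c *\<^sub>C T)) x) \<le> cmod c * norm (op_of T) * norm x"
        using norm_blinfun[of "op_of T" x]
        by (simp add: op_of_apply norm_scaleC mult.assoc mult_left_mono)
    qed simp
    show ?thesis
    proof (cases "c = 0")
      case True
      then show ?thesis by (simp add: scaleC_zero_left norm_compact_op.rep_eq zero_compact_op.rep_eq)
    next
      case False
      have "norm T \<le> cmod (inverse c) * norm (c *\<^sub>C T)"
        using le[of "inverse c" "c *\<^sub>C T"] False by (simp add: scaleC_scaleC scaleC_one)
      then have "cmod c * norm T \<le> cmod c * (cmod (inverse c) * norm (c *\<^sub>C T))"
        by (intro mult_left_mono) auto
      also have "\<dots> = norm (c *\<^sub>C T)"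
        using False by (simp flip: mult.assoc norm_mult)
      finally show ?thesis using le[of c T] by simp
    qed
  qed
  show "norm (r *\<^sub>R T) = \<bar>r\<bar> * norm T" by (simp add: scaleR_scaleC C)
  show "sgn T = T /\<^sub>R norm T" by (simp add: sgn_compact_op_def)
  show "dist S T = norm (S - T)" by (simp add: dist_compact_op_def)
qed (simp_all add: uniformity_compact_op_def open_compact_op_def)

end

instance compact_op :: cstar_algebra
proof
  fix S T :: compact_op
  show "norm (S * T) \<le> norm S * norm T" by transfer (rule norm_blinfun_compose)
  show "norm (star T * T) = (norm T)\<^sup>2"
  proof (rule antisym)
    have sq: "(norm U)\<^sup>2 \<le> norm (star U * U)" for U :: compact_op
    proof -
      have "norm (blinfun_apply (op_of U) x) \<le> sqrt (norm (star U * U)) * norm x" for x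
      proof (rule power2_le_imp_le)
        have "(norm (blinfun_apply (op_of U) x))\<^sup>2 \<le>
            norm (blinfun_apply (op_of (star U * U)) x) * norm x"
          using norm_op_adjoint_square[OF op_of_clinear, of U x]
          by (simp add: op_of_apply star_compact_op.rep_eq)
        also have "\<dots> \<le> (norm (star U * U) * norm x) * norm x"
          unfolding norm_compact_op.rep_eq by (intro mult_right_mono norm_blinfun) auto
        also have "\<dots> = (sqrt (norm (star U * U)) * norm x)\<^sup>2"
          by (simp add: power_mult_distrib norm_compact_op.rep_eq) (simp add: power2_eq_square)
        finally show "(norm (blinfun_apply (op_of U) x))\<^sup>2 \<le> (sqrt (norm (star U * U)) * norm x)\<^sup>2" .
      qed (simp add: norm_compact_op.rep_eq)
      then have "norm U \<le> sqrt (norm (star U * U))"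
        unfolding norm_compact_op.rep_eq[of U] by (intro norm_blinfun_bound) (auto simp: norm_compact_op.rep_eq)
      then show ?thesis
        using power_mono[of "norm U" "sqrt (norm (star U * U))" 2] by (simp add: norm_compact_op.rep_eq)
    qed
    show "(norm T)\<^sup>2 \<le> norm (star T * T)" by (rule sq)
    have mult: "norm (S * U) \<le> norm S * norm U" for S U :: compact_op
      by transfer (rule norm_blinfun_compose)
    have nn: "norm U \<ge> 0" for U :: compact_op by transfer simp
    have le: "norm U \<le> norm (star U)" for U :: compact_op
    proof (cases "norm U = 0")
      case False
      have "norm U * norm U \<le> norm (star U) * norm U"
        using sq[of U] mult[of "star U" U] by (simp add: power2_eq_square)
      then show ?thesis using False nn[of U] by simp
    qed (simp add: nn)
    have "norm (star T) \<le> norm T" using le[of "star T"] by (simp add: star_star)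
    then show "norm (star T * T) \<le> (norm T)\<^sup>2"
      using mult[of "star T" T] nn[of T] mult_right_mono[of "norm (star T)" "norm T" "norm T"]
      by (simp add: power2_eq_square)
  qed
next
  fix X :: "nat \<Rightarrow> compact_op"
  assume X: "Cauchy X"
  have d: "dist S T = dist (op_of S) (op_of T)" for S T
    by (simp add: dist_compact_op_def dist_norm norm_compact_op.rep_eq op_of_diff)
  have "Cauchy (\<lambda>n. op_of (X n))" using X by (simp add: Cauchy_def d)
  then obtain L where L: "(\<lambda>n. op_of (X n)) \<longlonglongrightarrow> L"
    by (auto simp: Cauchy_convergent_iff convergent_def)
  have "is_compact_op L" using op_of by (intro is_compact_op_limit[OF _ L]) auto
  then have "op_of (Abs_compact_op L) = L" by (simp add: Abs_compact_op_inverse)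
  then have "X \<longlonglongrightarrow> Abs_compact_op L" using L by (simp add: lim_sequentially d)
  then show "convergent X" by (auto simp: convergent_def)
qed

text \<open>The matrix unit \<open>e\<^sub>i\<^sub>j\<close>, which maps the \<open>j\<close>-th standard basis vector to the \<open>i\<close>-th one.\<close>

lemma bounded_linear_matrix_unit: "bounded_linear (\<lambda>x. l2_coord x j *\<^sub>C l2_basis i)"
proof (rule bounded_linear_intro[where K = "norm (l2_basis i)"])
  show "norm (l2_coord x j *\<^sub>C l2_basis i) \<le> norm x * norm (l2_basis i)" for x
    by (simp add: norm_scaleC coord_le_norm mult_right_mono)
qed (auto simp: scaleC_add_left scaleR_scaleC scaleC_scaleC)

lift_definition matrix_unit :: "int \<Rightarrow> int \<Rightarrow> compact_op"
  is "\<lambda>i j. Blinfun (\<lambda>x. l2_coord x j *\<^sub>C l2_basis i)"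
proof (rule is_compact_opI)
  fix i j
  have "bounded_linear (\<lambda>c. c *\<^sub>C l2_basis i)"
    by (rule bounded_linear_intro[where K = "norm (l2_basis i)"])
       (auto simp: scaleC_add_left scaleR_scaleC scaleC_scaleC norm_scaleC scaleR_conv_of_real)
  then show "compact ((\<lambda>c. c *\<^sub>C l2_basis i) ` cball 0 1)"
    by (intro compact_continuous_image linear_continuous_on) auto
  show "blinfun_apply (Blinfun (\<lambda>x. l2_coord x j *\<^sub>C l2_basis i)) ` cball 0 1 \<subseteq>
      (\<lambda>c. c *\<^sub>C l2_basis i) ` cball 0 1"
    using order_trans[OF coord_le_norm]
    by (auto simp: bounded_linear_Blinfun_apply bounded_linear_matrix_unit intro!: imageI)
qed (auto simp: clinear_map_def bounded_linear_Blinfun_apply bounded_linear_matrix_unit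
      scaleC_add_left scaleC_scaleC)

lemma matrix_unit_basis:
  "blinfun_apply (op_of (matrix_unit i j)) (l2_basis k) = (if k = j then l2_basis i else 0)"
  by (simp add: matrix_unit.rep_eq bounded_linear_Blinfun_apply bounded_linear_matrix_unit
      scaleC_one scaleC_zero_left)

section \<open>Tensor products of C*-algebras\<close>

lemma vector_space_scaleC: "vector_space (scaleC :: complex \<Rightarrow> 'a \<Rightarrow> 'a::complex_vector)"
  by (simp add: vector_space_def scaleC_add_right scaleC_add_left scaleC_scaleC scaleC_one)

text \<open>\<open>cstar_tensor_product T\<close> says that the C*-algebra \<open>'c\<close>, with \<open>T a b\<close> in the role of
  \<open>a \<otimes> b\<close>, is a C*-tensor product of \<open>'a\<close> and \<open>'b\<close>, i.e. a completion of the algebraic tensor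
  product in a C*-norm. The fifth clause is the injectivity of the map from the algebraic
  tensor product to \<open>'c\<close>; the sixth one (cross norm) holds automatically for a C*-norm.
  If \<open>'b\<close> is nuclear, e.g. \<open>compact_op\<close>, there is exactly one such completion.\<close>
definition cstar_tensor_product ::
    "('a::cstar_algebra \<Rightarrow> 'b::cstar_algebra \<Rightarrow> 'c::cstar_algebra) \<Rightarrow> bool" where
  "cstar_tensor_product T \<longleftrightarrow>
     (\<forall>b. clinear_map (\<lambda>a. T a b)) \<and>
     (\<forall>a. clinear_map (\<lambda>b. T a b)) \<and>
     (\<forall>a b a' b'. T a b * T a' b' = T (a * a') (b * b')) \<and>
     (\<forall>a b. star (T a b) = T (star a) (star b)) \<and>
     (\<forall>S f. finite S \<longrightarrow> \<not> module.dependent scaleC S \<longrightarrow>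
        (\<Sum>b\<in>S. T (f b) b) = 0 \<longrightarrow> (\<forall>b\<in>S. f b = 0)) \<and>
     (\<forall>a b. norm (T a b) = norm a * norm b) \<and>
     closure (module.span scaleC {T a b | a b. True}) = UNIV"

section \<open>Asymptotic homomorphisms on the suspension\<close>

text \<open>\<open>C\<^sub>0(R, A)\<close>; the suspension \<open>SA\<close> for \<open>A = 'a\<close>.\<close>
definition C0 :: "(real \<Rightarrow> 'a::real_normed_vector) set" where
  "C0 = {f. continuous_on UNIV f \<and> (f \<longlongrightarrow> 0) at_infinity}"

definition translate :: "real \<Rightarrow> (real \<Rightarrow> 'a) \<Rightarrow> real \<Rightarrow> 'a" where
  "translate s f = (\<lambda>t. f (t - s))"

text \<open>The element \<open>h \<otimes> a\<close> of \<open>SA\<close>.\<close>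
definition elem_tensor :: "(real \<Rightarrow> real) \<Rightarrow> 'a::real_vector \<Rightarrow> real \<Rightarrow> 'a" where
  "elem_tensor h a = (\<lambda>t. h t *\<^sub>R a)"

text \<open>Only the values of \<open>\<psi> t\<close> on \<open>C0\<close> are relevant.\<close>
definition asymptotic_hom :: "(real \<Rightarrow> (real \<Rightarrow> 'a::cstar_algebra) \<Rightarrow> 'b::cstar_algebra) \<Rightarrow> bool" where
  "asymptotic_hom \<psi> \<longleftrightarrow>
     (\<forall>f\<in>C0. continuous_on {1..} (\<lambda>t. \<psi> t f)) \<and>
     (\<forall>f\<in>C0. \<forall>g\<in>C0. ((\<lambda>t. \<psi> t (\<lambda>x. f x + g x) - (\<psi> t f + \<psi> t g)) \<longlongrightarrow> 0) at_top) \<and>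
     (\<forall>c. \<forall>f\<in>C0. ((\<lambda>t. \<psi> t (\<lambda>x. c *\<^sub>C f x) - c *\<^sub>C \<psi> t f) \<longlongrightarrow> 0) at_top) \<and>
     (\<forall>f\<in>C0. \<forall>g\<in>C0. ((\<lambda>t. \<psi> t (\<lambda>x. f x * g x) - \<psi> t f * \<psi> t g) \<longlongrightarrow> 0) at_top) \<and>
     (\<forall>f\<in>C0. ((\<lambda>t. \<psi> t (\<lambda>x. star (f x)) - star (\<psi> t f)) \<longlongrightarrow> 0) at_top) \<and>
     (\<forall>f\<in>C0. ((\<lambda>t. \<psi> t f) \<longlongrightarrow> 0) at_bot)"

definition asymptotically_translation_invariant ::
    "(real \<Rightarrow> (real \<Rightarrow> 'a::cstar_algebra) \<Rightarrow> 'b::cstar_algebra) \<Rightarrow> bool" where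
  "asymptotically_translation_invariant \<psi> \<longleftrightarrow>
     (\<forall>s. \<forall>f\<in>C0. ((\<lambda>t. \<psi> (t - s) f - \<psi> t (translate s f)) \<longlongrightarrow> 0) at_top)"

section \<open>The map \<open>\<Phi>\<^sub>0\<close>\<close>

text \<open>The conditions on \<open>\<beta>\<^sub>0\<close>, which force it to be real-valued.\<close>
definition partition_generator :: "(real \<Rightarrow> real) \<Rightarrow> bool" where
  "partition_generator \<beta> \<longleftrightarrow>
     \<beta> \<in> C0 \<and> (\<forall>t. t \<notin> {-1..1} \<longrightarrow> \<beta> t = 0) \<and> (\<forall>t\<in>{-1<..<1}. \<beta> t > 0) \<and>
     (\<forall>t. translate 1 \<beta> t * translate (-1) \<beta> t = 0) \<and>
     (\<forall>t. translate (-1) \<beta> t * \<beta> t + (\<beta> t)\<^sup>2 + translate 1 \<beta> t * \<beta> t = \<beta> t)"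

text \<open>\<open>alpha \<beta> i\<close> is \<open>\<alpha>\<^sub>i = sqrt \<beta>\<^sub>i\<close>, where \<open>\<beta>\<^sub>i\<close> is the translate of \<open>\<beta>\<^sub>0 = \<beta>\<close> by \<open>-i\<close>.\<close>
definition alpha :: "(real \<Rightarrow> real) \<Rightarrow> int \<Rightarrow> real \<Rightarrow> real" where
  "alpha \<beta> i = (\<lambda>t. sqrt (translate (- real_of_int i) \<beta> t))"

definition Phi0_summand ::
    "('b::cstar_algebra \<Rightarrow> compact_op \<Rightarrow> 'd::cstar_algebra) \<Rightarrow> (real \<Rightarrow> real) \<Rightarrow>
     (real \<Rightarrow> (real \<Rightarrow> 'a::cstar_algebra) \<Rightarrow> 'b) \<Rightarrow> 'a \<Rightarrow> int \<times> int \<Rightarrow> 'd multiplier" where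
  "Phi0_summand T \<beta> \<phi> a = (\<lambda>(i, j). of_algebra
     (T (\<phi> (real_of_int i)
           (elem_tensor (translate (real_of_int i) (\<lambda>t. alpha \<beta> i t * alpha \<beta> j t)) a))
        (matrix_unit i j)))"

text \<open>A strict sum is unique if it exists, since an element of \<open>M(D)\<close> is determined by its action on \<open>D\<close>.\<close>
definition Phi0 ::
    "('b::cstar_algebra \<Rightarrow> compact_op \<Rightarrow> 'd::cstar_algebra) \<Rightarrow> (real \<Rightarrow> real) \<Rightarrow>
     (real \<Rightarrow> (real \<Rightarrow> 'a::cstar_algebra) \<Rightarrow> 'b) \<Rightarrow> 'a \<Rightarrow> 'd multiplier" where
  "Phi0 T \<beta> \<phi> a = (THE m. strict_has_sum (Phi0_summand T \<beta> \<phi> a) m)"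

definition Phi ::
    "('b::cstar_algebra \<Rightarrow> compact_op \<Rightarrow> 'd::cstar_algebra) \<Rightarrow> (real \<Rightarrow> real) \<Rightarrow>
     (real \<Rightarrow> (real \<Rightarrow> 'a::cstar_algebra) \<Rightarrow> 'b) \<Rightarrow> 'a \<Rightarrow> 'd corona" where
  "Phi T \<beta> \<phi> a = corona_map (Phi0 T \<beta> \<phi> a)"

end

theory Submission
  imports Defs
begin

text \<open>Write \<open>h\<^sub>k(t) = sqrt (\<beta>\<^sub>0(t) \<beta>\<^sub>0(t + k))\<close>. Since \<open>\<tau>\<^sub>i(\<alpha>\<^sub>i \<alpha>\<^sub>j) = h\<^sub>j\<^sub>-\<^sub>i\<close>, the multiplier \<open>\<Phi>\<^sub>0(a)\<close> is the
  tridiagonal matrix with entries \<open>\<phi>\<^sub>i(h\<^sub>j\<^sub>-\<^sub>i \<otimes> a)\<close>. A bounded matrix of finite bandwidth defines a multiplier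
  of \<open>B \<otimes> K\<close>, and this multiplier lies in \<open>B \<otimes> K\<close> as soon as its entries tend to \<open>0\<close> along each diagonal.
  So it suffices to compare matrix entries asymptotically. As \<open>i \<rightarrow> -\<infinity>\<close> all entries tend to \<open>0\<close>. As \<open>i \<rightarrow> \<infinity>\<close>,
  linearity is immediate, translation invariance replaces each \<open>\<phi>\<^sub>i\<^sub>+\<^sub>p(f)\<close> by \<open>\<phi>\<^sub>i(\<tau>\<^sub>-\<^sub>p f)\<close>, the adjoint
  corresponds to \<open>\<tau>\<^sub>k h\<^sub>k = h\<^sub>-\<^sub>k\<close>, and multiplicativity to
  \<open>\<Sum>p. h\<^sub>p(t) h\<^sub>r\<^sub>-\<^sub>p(t + p) = (\<Sum>p. \<beta>\<^sub>0(t + p)) h\<^sub>r(t) = h\<^sub>r(t)\<close>, with \<open>p\<close> in \<open>{r - 1, r, r + 1}\<close>.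

  The entries are bounded because \<open>t \<mapsto> \<phi>\<^sub>t(f)\<close> is: up to scaling, a self-adjoint \<open>f\<close> is the real part of some \<open>v\<close>
  with \<open>v\<^sup>* v = \<i> (v - v\<^sup>* )\<close>, whence \<open>norm (\<phi>\<^sub>t(v))\<^sup>2 \<le> 2 norm (\<phi>\<^sub>t(v))\<close> up to an arbitrarily small error.\<close>

section \<open>Functions vanishing at infinity\<close>

lemma bounded_linear_star: "bounded_linear (star :: 'a::cstar_algebra \<Rightarrow> 'a)"
  by (rule bounded_linear_intro[where K = 1]) (simp_all add: star_add norm_star scaleR_scaleC star_scaleC)

lemmas tendsto_star = bounded_linear.tendsto[OF bounded_linear_star]
lemmas tendsto_scaleC = bounded_linear.tendsto[OF bounded_linear_scaleC]
lemmas continuous_on_star = bounded_linear.continuous_on[OF bounded_linear_star]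
lemmas continuous_on_scaleC = bounded_linear.continuous_on[OF bounded_linear_scaleC]

lemma star_sum: "star (sum f S) = (\<Sum>i\<in>S. star (f i :: 'a::star_algebra))"
  by (induction S rule: infinite_finite_induct) (simp_all add: star_zero star_add)

lemma scaleC_sum_right: "c *\<^sub>C sum f S = (\<Sum>i\<in>S. c *\<^sub>C (f i :: 'a::complex_vector))"
  by (induction S rule: infinite_finite_induct) (simp_all add: scaleC_zero_right scaleC_add_right)

lemma clinear_map_sum:
  assumes "clinear_map f"
  shows "f (sum g S) = (\<Sum>i\<in>S. f (g i))"
proof -
  have "f 0 = 0"
    using assms scaleC_zero_left[of 0] scaleC_zero_left[of "f 0"] unfolding clinear_map_def by metis
  then show ?thesis
    using assms by (induction S rule: infinite_finite_induct) (simp_all add: clinear_map_def)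
qed

lemma C0_bounded:
  assumes "f \<in> C0"
  obtains K where "K > 0" "\<And>t. norm (f t) \<le> K"
proof -
  have "eventually (\<lambda>t. norm (f t) < 1) at_infinity"
    using assms tendstoD[of f 0 at_infinity 1] by (simp add: C0_def)
  then obtain b where b: "\<And>t. norm t \<ge> b \<Longrightarrow> norm (f t) < 1"
    unfolding eventually_at_infinity by blast
  have "continuous_on (cball 0 b) f"
    using assms continuous_on_subset[of UNIV f] by (simp add: C0_def)
  then have "bounded (f ` cball 0 b)"
    by (intro compact_imp_bounded compact_continuous_image) auto
  then obtain B where B: "\<And>t. t \<in> cball 0 b \<Longrightarrow> norm (f t) \<le> B"
    unfolding bounded_iff by blast
  have "norm (f t) \<le> \<bar>B\<bar> + 1" for t
  proof (cases "norm t \<ge> b")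
    case True
    then show ?thesis using b[of t] by linarith
  next
    case False
    then show ?thesis using B[of t] by (simp add: mem_cball_0)
  qed
  then show ?thesis by (intro that[of "\<bar>B\<bar> + 1"]) auto
qed

lemma C0_add: "f \<in> C0 \<Longrightarrow> g \<in> C0 \<Longrightarrow> (\<lambda>t. f t + g t) \<in> C0"
  using tendsto_add[of f 0 at_infinity g 0] by (auto simp: C0_def intro: continuous_on_add)

lemma C0_scaleC: "f \<in> C0 \<Longrightarrow> (\<lambda>t. c *\<^sub>C (f t :: 'a::complex_normed_vector)) \<in> C0"
  using tendsto_scaleC[of f 0 at_infinity c] by (auto simp: C0_def scaleC_zero_right intro: continuous_on_scaleC)

lemma C0_mult: "f \<in> C0 \<Longrightarrow> g \<in> C0 \<Longrightarrow> (\<lambda>t. f t * (g t :: 'a::real_normed_algebra)) \<in> C0"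
  using tendsto_mult[of f 0 at_infinity g 0] by (auto simp: C0_def intro: continuous_on_mult)

lemma C0_star: "f \<in> C0 \<Longrightarrow> (\<lambda>t. star (f t :: 'a::cstar_algebra)) \<in> C0"
  using tendsto_star[of f 0 at_infinity] by (auto simp: C0_def star_zero intro: continuous_on_star)

lemma C0_translate:
  assumes "f \<in> C0"
  shows "translate s f \<in> C0"
proof -
  have "filterlim (\<lambda>t. t - s) at_infinity (at_infinity :: real filter)"
    unfolding filterlim_at_infinity[OF order_refl]
  proof (intro allI impI)
    fix r :: real assume "r > 0"
    have "norm (t - s) \<ge> r" if "norm t \<ge> r + \<bar>s\<bar>" for t
      using that by (auto simp: abs_real_def split: if_splits)
    then show "eventually (\<lambda>t. r \<le> norm (t - s)) at_infinity"
      by (auto simp: eventually_at_infinity)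
  qed
  then show ?thesis
    using assms filterlim_compose[of f "nhds 0" at_infinity "\<lambda>t. t - s"]
    by (auto simp: C0_def translate_def o_def intro!: continuous_on_compose2[of UNIV f] continuous_intros)
qed

lemma C0_elem_tensor: "h \<in> C0 \<Longrightarrow> elem_tensor h a \<in> C0"
  using tendsto_scaleR[of h 0 at_infinity "\<lambda>_. a" a]
  by (auto simp: C0_def elem_tensor_def intro!: continuous_intros)

text \<open>With \<open>v = f - \<i> g\<close> for this \<open>g\<close>, the element \<open>v + \<i> = f + \<i> (1 - g)\<close> of the unitization is unitary.\<close>
lemma ex1_unitary_partner:
  fixes f :: "'a::cstar_algebra"
  assumes sa: "star f = f" and nf: "norm f \<le> 1/2"
  shows "\<exists>!g. (norm g \<le> 1/2 \<and> f * g = g * f \<and> star g = g) \<and> (1/2) *\<^sub>R (f * f + g * g) = g"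
proof -
  \<comment> \<open>The equation \<open>?P g = g\<close> says (1 - g)^2 = 1 - f^2, so g plays the
    role of 1 - sqrt(1 - f^2). On the ball of radius 1/2 the map \<open>?P\<close> is a contraction.
    It preserves commutation with f and self-adjointness, which are closed conditions, so building
    them into \<open>S\<close> passes them on to the fixed point.\<close>
  define S where "S = {g :: 'a. norm g \<le> 1/2 \<and> f * g = g * f \<and> star g = g}"
  let ?P = "\<lambda>g. (1/2) *\<^sub>R (f * f + g * g)"
  have sq: "norm (g * g) \<le> 1/4" if "norm g \<le> 1/2" for g :: 'a
    using norm_mult_ineq[of g g] mult_mono[OF that that] by simp
  have "\<exists>!g\<in>S. ?P g = g"
  proof (rule Banach_fix[where c = "1/2"])
    have "closed S"
      unfolding S_def
      by (intro closed_Collect_conj closed_Collect_le closed_Collect_eq continuous_intros continuous_on_star continuous_on_id)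
    then show "complete S" by (simp add: complete_eq_closed)
    show "S \<noteq> {}" by (auto simp: S_def star_zero intro!: exI[of _ 0])
    show "?P ` S \<subseteq> S"
    proof (rule image_subsetI)
      fix g assume g: "g \<in> S"
      have "norm (f * f + g * g) \<le> 1/4 + 1/4"
        using g sq[OF nf] sq[of g] by (intro norm_triangle_mono) (auto simp: S_def)
      moreover have "f * (g * g) = g * g * f"
        using g unfolding S_def by (metis (mono_tags, lifting) mem_Collect_eq mult.assoc)
      ultimately show "?P g \<in> S"
        using g by (auto simp: S_def sa star_add star_mult scaleR_scaleC star_scaleC
            mult_scaleC_left mult_scaleC_right distrib_left distrib_right mult.assoc norm_scaleC)
    qed
    fix x y assume xy: "x \<in> S" "y \<in> S"
    have "?P x - ?P y = (1/2) *\<^sub>R (x * (x - y) + (x - y) * y)"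
      by (simp add: algebra_simps)
    moreover have "norm (x * (x - y) + (x - y) * y) \<le> 1/2 * norm (x - y) + norm (x - y) * (1/2)"
      using xy by (intro norm_triangle_mono order_trans[OF norm_mult_ineq] mult_mono) (auto simp: S_def)
    ultimately show "dist (?P x) (?P y) \<le> 1/2 * dist x y"
      by (simp add: dist_norm)
  qed auto
  then show ?thesis by (simp add: S_def)
qed

text \<open>The pointwise solutions form a function in \<open>C0\<close> because the fixed point
  equation controls g by f^2: \<open>lip\<close> yields continuity and \<open>bd\<close> decay at
  infinity.\<close>

lemma C0_unitary_partner:
  fixes f :: "real \<Rightarrow> 'a::cstar_algebra"
  assumes f: "f \<in> C0" "\<And>t. star (f t) = f t" "\<And>t. norm (f t) \<le> 1/2"
  obtains g where "g \<in> C0" "\<And>t. f t * g t = g t * f t" "\<And>t. star (g t) = g t"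
    "\<And>t. f t * f t + g t * g t = 2 *\<^sub>R g t"
proof -
  obtain g where g: "\<And>t. norm (g t) \<le> 1/2" "\<And>t. f t * g t = g t * f t" "\<And>t. star (g t) = g t"
    "\<And>t. (1/2) *\<^sub>R (f t * f t + g t * g t) = g t"
    using ex1_unitary_partner[OF f(2,3)] by metis
  have eq: "f t * f t + g t * g t = 2 *\<^sub>R g t" for t
    by (subst (3) g(4)[symmetric]) simp
  have lip: "norm (g t - g s) \<le> norm (f t * f t - f s * f s)" for s t
  proof -
    have "2 *\<^sub>R (g t - g s) = (f t * f t - f s * f s) + (g t * (g t - g s) + (g t - g s) * g s)"
      using eq[of t] eq[of s] by (simp add: algebra_simps)
    moreover have "norm (g t * (g t - g s) + (g t - g s) * g s) \<le> 1/2 * norm (g t - g s) + norm (g t - g s) * (1/2)"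
      using norm_triangle_ineq[of "g t * (g t - g s)" "(g t - g s) * g s"]
        norm_mult_ineq[of "g t" "g t - g s"] norm_mult_ineq[of "g t - g s" "g s"]
        mult_right_mono[OF g(1)[of t], of "norm (g t - g s)"] mult_left_mono[OF g(1)[of s], of "norm (g t - g s)"] norm_ge_zero[of "g t - g s"]
      by linarith
    ultimately have "norm (2 *\<^sub>R (g t - g s)) \<le> norm (f t * f t - f s * f s) + (1/2 * norm (g t - g s) + norm (g t - g s) * (1/2))"
      using norm_triangle_mono[OF order_refl] by metis
    then show ?thesis by simp
  qed
  have bd: "norm (g t) \<le> norm (f t * f t)" for t
  proof -
    have "norm (f t * f t + g t * g t) \<le> norm (f t * f t) + norm (g t) * (1/2)"
      using norm_triangle_ineq[of "f t * f t" "g t * g t"] norm_mult_ineq[of "g t" "g t"]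
        mult_left_mono[OF g(1)[of t] norm_ge_zero[of "g t"]] by linarith
    then show ?thesis unfolding eq using norm_ge_zero[of "g t"] by (simp; linarith)
  qed
  have ff: "continuous_on UNIV (\<lambda>t. f t * f t)" "((\<lambda>t. f t * f t) \<longlongrightarrow> 0) at_infinity"
    using C0_mult[OF f(1) f(1)] by (auto simp: C0_def)
  have "isCont g s" for s
  proof -
    have "((\<lambda>t. f t * f t - f s * f s) \<longlongrightarrow> 0) (at s)"
      using ff(1) by (simp add: continuous_on_eq_continuous_at isCont_def LIM_zero)
    then have "((\<lambda>t. g t - g s) \<longlongrightarrow> 0) (at s)"
      by (rule Lim_transform_bound[rotated]) (simp add: lip)
    then show ?thesis by (simp add: isCont_def LIM_zero_iff)
  qed
  moreover have "(g \<longlongrightarrow> 0) at_infinity"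
    by (rule Lim_transform_bound[OF _ ff(2)]) (simp add: bd)
  ultimately have "g \<in> C0" by (simp add: C0_def continuous_at_imp_continuous_on)
  then show ?thesis using g(2,3) eq by (rule that)
qed

section \<open>Boundedness of asymptotic homomorphisms\<close>

lemma asymptotic_homD:
  assumes "asymptotic_hom \<psi>" and "f \<in> C0"
  shows asymptotic_hom_add: "g \<in> C0 \<Longrightarrow> ((\<lambda>t. \<psi> t (\<lambda>x. f x + g x) - (\<psi> t f + \<psi> t g)) \<longlongrightarrow> 0) at_top"
    and asymptotic_hom_scaleC: "((\<lambda>t. \<psi> t (\<lambda>x. c *\<^sub>C f x) - c *\<^sub>C \<psi> t f) \<longlongrightarrow> 0) at_top"
    and asymptotic_hom_mult: "g \<in> C0 \<Longrightarrow> ((\<lambda>t. \<psi> t (\<lambda>x. f x * g x) - \<psi> t f * \<psi> t g) \<longlongrightarrow> 0) at_top"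
    and asymptotic_hom_star: "((\<lambda>t. \<psi> t (\<lambda>x. star (f x)) - star (\<psi> t f)) \<longlongrightarrow> 0) at_top"
    and asymptotic_hom_at_bot: "((\<lambda>t. \<psi> t f) \<longlongrightarrow> 0) at_bot"
  using assms unfolding asymptotic_hom_def by blast+

lemma Bfun_add:
  fixes f g :: "'b \<Rightarrow> 'a::real_normed_vector"
  assumes "Bfun f F" "Bfun g F"
  shows "Bfun (\<lambda>x. f x + g x) F"
proof -
  obtain K L where "eventually (\<lambda>x. norm (f x) \<le> K) F" "eventually (\<lambda>x. norm (g x) \<le> L) F"
    using assms by (auto elim!: BfunE)
  then have "eventually (\<lambda>x. norm (f x + g x) \<le> K + L) F"
    by eventually_elim (rule norm_triangle_mono)
  then show ?thesis by (rule BfunI)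
qed

lemma Bfun_scaleC:
  fixes f :: "'b \<Rightarrow> 'a::complex_normed_vector"
  assumes "Bfun f F"
  shows "Bfun (\<lambda>x. c *\<^sub>C f x) F"
proof -
  obtain K where "eventually (\<lambda>x. norm (f x) \<le> K) F"
    using assms by (rule BfunE)
  then have "eventually (\<lambda>x. norm (c *\<^sub>C f x) \<le> cmod c * K) F"
    by eventually_elim (simp add: norm_scaleC mult_left_mono)
  then show ?thesis by (rule BfunI)
qed

lemma Bfun_tendsto_diff:
  fixes f g :: "'b \<Rightarrow> 'a::real_normed_vector"
  assumes "((\<lambda>x. g x - f x) \<longlongrightarrow> 0) F" "Bfun f F"
  shows "Bfun g F"
proof -
  have "eventually (\<lambda>x. norm (g x - f x) \<le> 1) F"
    using tendstoD[OF assms(1) zero_less_one] by eventually_elim simp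
  then have "Bfun (\<lambda>x. g x - f x) F" by (rule BfunI)
  from Bfun_add[OF this assms(2)] show ?thesis by simp
qed

text \<open>The hypothesis \<open>quasi\<close> says that v + \<i> is an isometry in the
  unitization. Under \<psi> the C*-identity turns it into an approximate bound of the square of
  \<open>norm (\<psi> t v)\<close> by twice that norm.\<close>

lemma asymptotic_hom_Bfun_quasi_unitary:
  fixes \<psi> :: "real \<Rightarrow> (real \<Rightarrow> 'a::cstar_algebra) \<Rightarrow> 'b::cstar_algebra"
  assumes hom: "asymptotic_hom \<psi>" and v: "v \<in> C0"
    and quasi: "\<And>x. star (v x) * v x = \<i> *\<^sub>C (v x + (-1) *\<^sub>C star (v x))"
  shows "Bfun (\<lambda>t. \<psi> t v) at_top"
proof -
  define v' where "v' = (\<lambda>x. star (v x))"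
  define u where "u = (\<lambda>x. (-1) *\<^sub>C v' x)"
  define w where "w = (\<lambda>x. v x + u x)"
  have C0: "v' \<in> C0" "u \<in> C0" "w \<in> C0"
    unfolding v'_def u_def w_def by (intro C0_star C0_scaleC C0_add v)+
  have mult_eq: "(\<lambda>x. v' x * v x) = (\<lambda>x. \<i> *\<^sub>C w x)"
    using quasi by (simp add: v'_def u_def w_def)
  have small: "eventually (\<lambda>t. norm (h t) < 1/2) at_top" if "(h \<longlongrightarrow> 0) at_top" for h :: "real \<Rightarrow> 'b"
    using tendstoD[OF that, of "1/2"] by simp
  \<comment> \<open>One error for each approximate law that is applied: product, adjoint, factor
    \<i>, sum and factor -1.\<close>
  note e1 = small[OF asymptotic_hom_mult[OF hom C0(1) v], unfolded mult_eq]
  note e2 = small[OF asymptotic_hom_star[OF hom v], folded v'_def]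
  note e3 = small[OF asymptotic_hom_scaleC[OF hom C0(3), of \<i>]]
  note e4 = small[OF asymptotic_hom_add[OF hom v C0(2)], folded w_def]
  note e5 = small[OF asymptotic_hom_scaleC[OF hom C0(1), of "-1"], folded u_def]
  have "eventually (\<lambda>t. norm (\<psi> t v) \<le> 4) at_top"
    using e1 e2 e3 e4 e5
  proof eventually_elim
    fix t
    let ?y = "\<psi> t v"
    define d1 where "d1 = \<psi> t (\<lambda>x. \<i> *\<^sub>C w x) - \<psi> t v' * ?y"
    define d2 where "d2 = \<psi> t v' - star ?y"
    define d3 where "d3 = \<psi> t (\<lambda>x. \<i> *\<^sub>C w x) - \<i> *\<^sub>C \<psi> t w"
    define d4 where "d4 = \<psi> t w - (?y + \<psi> t u)"
    define d5 where "d5 = \<psi> t u - (-1) *\<^sub>C \<psi> t v'"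
    assume "norm (\<psi> t (\<lambda>x. \<i> *\<^sub>C w x) - \<psi> t v' * ?y) < 1/2" "norm (\<psi> t v' - star ?y) < 1/2"
      "norm (\<psi> t (\<lambda>x. \<i> *\<^sub>C w x) - \<i> *\<^sub>C \<psi> t w) < 1/2" "norm (\<psi> t w - (?y + \<psi> t u)) < 1/2"
      "norm (\<psi> t u - (-1) *\<^sub>C \<psi> t v') < 1/2"
    then have small: "norm d1 < 1/2" "norm d2 < 1/2" "norm d3 < 1/2" "norm d4 < 1/2" "norm d5 < 1/2"
      by (simp_all add: d1_def d2_def d3_def d4_def d5_def)
    have w: "\<psi> t w = ?y + (-1) *\<^sub>C star ?y + ((-1) *\<^sub>C d2 + d4 + d5)"
      by (simp add: d2_def d4_def d5_def scaleC_diff_right scaleC_add_right)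
    have E: "star ?y * ?y = \<i> *\<^sub>C \<psi> t w + (d3 - d1 - d2 * ?y)"
      by (simp add: d1_def d2_def d3_def left_diff_distrib)
    have A: "norm (\<i> *\<^sub>C \<psi> t w) \<le> norm ?y + norm ?y + (1/2 + 1/2 + 1/2)"
      unfolding norm_scaleC w
      using small norm_triangle_ineq[of "?y + (-1) *\<^sub>C star ?y" "(-1) *\<^sub>C d2 + d4 + d5"]
        norm_triangle_ineq[of ?y "(-1) *\<^sub>C star ?y"] norm_triangle_ineq[of "(-1) *\<^sub>C d2 + d4" d5]
        norm_triangle_ineq[of "(-1) *\<^sub>C d2" d4]
      by (simp add: norm_scaleC norm_star)
    have B: "norm (d3 - d1 - d2 * ?y) \<le> 1/2 + 1/2 + 1/2 * norm ?y"
      using small norm_triangle_ineq4[of "d3 - d1" "d2 * ?y"] norm_triangle_ineq4[of d3 d1]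
        norm_mult_ineq[of d2 ?y] mult_right_mono[of "norm d2" "1/2" "norm ?y"] norm_ge_zero[of ?y]
      by linarith
    have "norm (star ?y * ?y) \<le> (norm ?y + norm ?y + (1/2 + 1/2 + 1/2)) + (1/2 + 1/2 + 1/2 * norm ?y)"
      unfolding E by (rule norm_triangle_mono[OF A B])
    \<comment> \<open>The extra half of \<open>norm ?y\<close> stems from \<open>d2 * ?y\<close>,
      the adjoint error multiplied by \<open>?y\<close>; the other errors add up to 5/2.\<close>
    then have sq: "(norm ?y)\<^sup>2 \<le> 5/2 * norm ?y + 5/2"
      by (simp add: cstar_identity)
    show "norm ?y \<le> 4"
    proof (rule ccontr)
      assume "\<not> norm ?y \<le> 4"
      then have "4 * norm ?y \<le> (norm ?y)\<^sup>2" "norm ?y > 4"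
        by (simp_all add: power2_eq_square mult_right_mono)
      then show False using sq by linarith
    qed
  qed
  then show ?thesis by (rule BfunI)
qed

lemma asymptotic_hom_Bfun_add:
  assumes "asymptotic_hom \<psi>" "f \<in> C0" "g \<in> C0" "Bfun (\<lambda>t. \<psi> t f) at_top" "Bfun (\<lambda>t. \<psi> t g) at_top"
  shows "Bfun (\<lambda>t. \<psi> t (\<lambda>x. f x + g x)) at_top"
  by (rule Bfun_tendsto_diff[OF asymptotic_hom_add[OF assms(1-3)] Bfun_add[OF assms(4,5)]])

lemma asymptotic_hom_Bfun_scaleC:
  assumes "asymptotic_hom \<psi>" "f \<in> C0" "Bfun (\<lambda>t. \<psi> t f) at_top"
  shows "Bfun (\<lambda>t. \<psi> t (\<lambda>x. c *\<^sub>C f x)) at_top"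
  by (rule Bfun_tendsto_diff[OF asymptotic_hom_scaleC[OF assms(1,2)] Bfun_scaleC[OF assms(3)]])

lemma asymptotic_hom_Bfun_star:
  fixes \<psi> :: "real \<Rightarrow> (real \<Rightarrow> 'a::cstar_algebra) \<Rightarrow> 'b::cstar_algebra"
  assumes "asymptotic_hom \<psi>" "f \<in> C0" "Bfun (\<lambda>t. \<psi> t f) at_top"
  shows "Bfun (\<lambda>t. \<psi> t (\<lambda>x. star (f x))) at_top"
proof (rule Bfun_tendsto_diff[OF asymptotic_hom_star])
  show "Bfun (\<lambda>t. star (\<psi> t f)) at_top"
    using assms(3) by (simp add: Bfun_def norm_star)
qed fact+

lemma asymptotic_hom_Bfun_selfadjoint:
  fixes \<psi> :: "real \<Rightarrow> (real \<Rightarrow> 'a::cstar_algebra) \<Rightarrow> 'b::cstar_algebra"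
  assumes hom: "asymptotic_hom \<psi>" and f: "f \<in> C0" "\<And>x. star (f x) = f x"
  shows "Bfun (\<lambda>t. \<psi> t f) at_top"
proof -
  obtain K where K: "K > 0" "\<And>t. norm (f t) \<le> K"
    using C0_bounded[OF f(1)] by blast
  \<comment> \<open>This scaling brings the norm down to 1/2, as \<open>C0_unitary_partner\<close>
    requires.\<close>
  define r where "r = 1 / (2 * K)"
  define f' where "f' = (\<lambda>x. complex_of_real r *\<^sub>C f x)"
  have f': "f' \<in> C0" "\<And>x. star (f' x) = f' x" "\<And>x. norm (f' x) \<le> 1/2"
    using K f by (simp_all add: f'_def C0_scaleC star_scaleC norm_scaleC r_def norm_divide norm_mult field_simps)
  obtain g where g: "g \<in> C0" "\<And>x. f' x * g x = g x * f' x" "\<And>x. star (g x) = g x"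
    "\<And>x. f' x * f' x + g x * g x = 2 *\<^sub>R g x"
    using C0_unitary_partner[OF f'] by blast
  define v where "v = (\<lambda>x. f' x + (- \<i>) *\<^sub>C g x)"
  have sv: "star (v x) = f' x + \<i> *\<^sub>C g x" for x
    by (simp add: v_def star_add star_scaleC f' g)
  have v: "v \<in> C0" unfolding v_def by (intro C0_add C0_scaleC f' g)
  have "star (v x) * v x = \<i> *\<^sub>C (v x + (-1) *\<^sub>C star (v x))" for x
  proof -
    have "star (v x) * v x = f' x * f' x + g x * g x"
      unfolding sv unfolding v_def
      by (simp add: distrib_left distrib_right mult_scaleC_left mult_scaleC_right scaleC_scaleC
          scaleC_one scaleC_zero_left scaleC_add_right g(2) flip: scaleC_add_left add.assoc)
    also have "\<dots> = (\<i> + - \<i>) *\<^sub>C f' x + (1 + 1) *\<^sub>C g x"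
      by (simp add: g(4) scaleR_scaleC scaleC_zero_left)
    also have "\<dots> = \<i> *\<^sub>C (v x + (-1) *\<^sub>C star (v x))"
      unfolding sv unfolding v_def scaleC_add_left by (simp add: scaleC_add_right scaleC_scaleC)
    finally show ?thesis .
  qed
  note bv = asymptotic_hom_Bfun_quasi_unitary[OF hom v this]
  note sum = asymptotic_hom_Bfun_add[OF hom v C0_star[OF v] bv asymptotic_hom_Bfun_star[OF hom v bv]]
  \<comment> \<open>Here \<open>v x + star (v x)\<close> is 2 f', and 2 K r = 1 recovers f.\<close>
  have "Bfun (\<lambda>t. \<psi> t (\<lambda>x. complex_of_real K *\<^sub>C (v x + star (v x)))) at_top"
    by (rule asymptotic_hom_Bfun_scaleC[OF hom C0_add[OF v C0_star[OF v]] sum])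
  also have "(\<lambda>x. complex_of_real K *\<^sub>C (v x + star (v x))) = f"
  proof
    fix x
    have "complex_of_real K *\<^sub>C (v x + star (v x)) =
        (1/2 + 1/2) *\<^sub>C f x + (- (complex_of_real K * \<i>) + complex_of_real K * \<i>) *\<^sub>C g x"
      unfolding sv unfolding v_def f'_def r_def scaleC_add_left
      using K by (simp add: scaleC_add_right scaleC_scaleC)
    then show "complex_of_real K *\<^sub>C (v x + star (v x)) = f x"
      by (simp add: scaleC_one scaleC_zero_left)
  qed
  finally show ?thesis .
qed

text \<open>The real part \<open>f1\<close> and the imaginary part \<open>f2\<close> are
  self-adjoint, and boundedness survives sums and scalar multiples because the errors tend to
  0.\<close>

lemma asymptotic_hom_Bfun:
  fixes \<psi> :: "real \<Rightarrow> (real \<Rightarrow> 'a::cstar_algebra) \<Rightarrow> 'b::cstar_algebra"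
  assumes hom: "asymptotic_hom \<psi>" and f: "f \<in> C0"
  shows "Bfun (\<lambda>t. \<psi> t f) at_top"
proof -
  define f1 where "f1 = (\<lambda>x. (1/2) *\<^sub>C (f x + star (f x)))"
  define f2 where "f2 = (\<lambda>x. (\<i>/2) *\<^sub>C (star (f x) + (-1) *\<^sub>C f x))"
  have C0: "f1 \<in> C0" "f2 \<in> C0"
    unfolding f1_def f2_def by (intro C0_scaleC C0_add C0_star f)+
  have sa: "star (f1 x) = f1 x" "star (f2 x) = f2 x" for x
    by (simp_all add: f1_def f2_def star_add star_scaleC star_star scaleC_add_right scaleC_scaleC add.commute)
  have "Bfun (\<lambda>t. \<psi> t (\<lambda>x. f1 x + \<i> *\<^sub>C f2 x)) at_top"
    using asymptotic_hom_Bfun_selfadjoint[OF hom C0(1) sa(1)] asymptotic_hom_Bfun_selfadjoint[OF hom C0(2) sa(2)]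
    by (intro asymptotic_hom_Bfun_add[OF hom C0(1)] asymptotic_hom_Bfun_scaleC[OF hom C0(2)] C0_scaleC C0)
  also have "(\<lambda>x. f1 x + \<i> *\<^sub>C f2 x) = f"
  proof
    fix x
    have "f1 x + \<i> *\<^sub>C f2 x = (1/2 + 1/2) *\<^sub>C f x + (1/2 + -1/2) *\<^sub>C star (f x)"
      unfolding f1_def f2_def scaleC_add_left by (simp add: scaleC_add_right scaleC_scaleC)
    then show "f1 x + \<i> *\<^sub>C f2 x = f x" by (simp add: scaleC_one scaleC_zero_left)
  qed
  finally show ?thesis .
qed

section \<open>Density of the matrix units\<close>

interpretation cv: vector_space "scaleC :: complex \<Rightarrow> 'a \<Rightarrow> 'a::complex_vector"
  by (rule vector_space_scaleC)

lemma matrix_unit_apply: "blinfun_apply (op_of (matrix_unit i j)) x = l2_coord x j *\<^sub>C l2_basis i"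
  by (simp add: matrix_unit.rep_eq bounded_linear_Blinfun_apply bounded_linear_matrix_unit)

lemma matrix_unit_mult: "matrix_unit i j * matrix_unit k l = (if j = k then matrix_unit i l else 0)"
  by (rule compact_op_eqI) (auto simp: op_of_apply matrix_unit_apply intro: l2Z_eqI)

lemma cinner_basis_left: "cinner (l2_basis i) y = cnj (l2_coord y i)"
  by (subst cinner_commute) (simp add: cinner_basis_right)

lemma star_matrix_unit: "star (matrix_unit i j) = matrix_unit j i"
  by (rule star_compact_op_unique)
    (simp add: matrix_unit_apply cinner_scaleC_left cinner_scaleC_right cinner_basis_left
      cinner_basis_right flip: op_of_star(1))

lemma norm_matrix_unit_le: "norm (matrix_unit i j) \<le> 1"
proof -
  have diag: "norm (matrix_unit j j) \<le> 1" for j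
    using cstar_identity[of "matrix_unit j j"]
    by (cases "norm (matrix_unit j j) = 0") (auto simp: star_matrix_unit matrix_unit_mult power2_eq_square)
  have "(norm (matrix_unit i j))\<^sup>2 = norm (matrix_unit j j)"
    using cstar_identity[of "matrix_unit i j"] by (simp add: star_matrix_unit matrix_unit_mult)
  then have "(norm (matrix_unit i j))\<^sup>2 \<le> 1\<^sup>2" using diag[of j] by simp
  then show ?thesis by (rule power2_le_imp_le) simp
qed

lemma l2_coord_tail:
  "finite F \<Longrightarrow> l2_coord (x - (\<Sum>i\<in>F. l2_coord x i *\<^sub>C l2_basis i)) k = (if k \<in> F then 0 else l2_coord x k)"
  by (simp add: l2_coord_sum if_distrib[of "\<lambda>t. _ * t"] sum.delta' cong: if_cong)

lemma l2_tail_mono: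
  assumes "F \<subseteq> G" "finite G"
  shows "norm (x - (\<Sum>i\<in>G. l2_coord x i *\<^sub>C l2_basis i)) \<le> norm (x - (\<Sum>i\<in>F. l2_coord x i *\<^sub>C l2_basis i))"
proof (rule power2_le_imp_le)
  have "finite F" using assms finite_subset by blast
  then show "(norm (x - (\<Sum>i\<in>G. l2_coord x i *\<^sub>C l2_basis i)))\<^sup>2 \<le> (norm (x - (\<Sum>i\<in>F. l2_coord x i *\<^sub>C l2_basis i)))\<^sup>2"
    unfolding norm_l2Z_square
    by (intro infsum_mono l2_summable) (use assms in \<open>auto simp: l2_coord_tail simp del: l2_coord_simps\<close>)
qed simp

lemma op_of_sum: "blinfun_apply (op_of (sum f F)) x = (\<Sum>i\<in>F. blinfun_apply (op_of (f i)) x)"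
  by (induction F rule: infinite_finite_induct) (simp_all add: op_of_apply)

text \<open>The image of the unit ball is totally bounded. A single finite G truncates all centers
  of a finite cover well, and since cutting off coordinates is contractive, this extends to the
  whole image.\<close>

lemma compact_op_diagonal_approx:
  assumes "e > 0"
  obtains F where "finite F" "norm (S - (\<Sum>i\<in>F. matrix_unit i i) * S) < e"
proof -
  let ?tail = "\<lambda>F x. x - (\<Sum>i\<in>F. l2_coord x i *\<^sub>C l2_basis i)"
  obtain k where k: "finite k" "blinfun_apply (op_of S) ` cball 0 1 \<subseteq> (\<Union>x\<in>k. ball x (e/4))"
    using op_of[of S] assms unfolding is_compact_op_def mem_Collect_eq compact_closure_iff_totally_bounded
    by (elim conjE allE[of _ "e/4"]) auto
  have "\<forall>x. \<exists>F. finite F \<and> norm (?tail F x) < e/4"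
    using assms by (intro allI l2Z_dense) simp
  then obtain F where F: "\<And>x. finite (F x)" "\<And>x. norm (?tail (F x) x) < e/4"
    by metis
  define G where "G = (\<Union>x\<in>k. F x)"
  have G: "finite G" using k F by (simp add: G_def)
  have ball: "norm (?tail G (blinfun_apply (op_of S) y)) \<le> e/2" if y: "norm y \<le> 1" for y
  proof -
    obtain x where x: "x \<in> k" "dist x (blinfun_apply (op_of S) y) < e/4"
      using subsetD[OF k(2) imageI, of y] y by auto
    let ?z = "blinfun_apply (op_of S) y - x"
    have E: "?tail G (blinfun_apply (op_of S) y) = ?tail G x + ?tail G ?z"
      by (simp add: scaleC_add_left cv.scale_left_diff_distrib sum_subtractf)
    have "norm (?tail G x) \<le> e/4"
    proof (rule order_trans)
      show "norm (?tail G x) \<le> norm (?tail (F x) x)"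
        using x(1) by (intro l2_tail_mono G) (auto simp: G_def)
    qed (use F(2)[of x] in simp)
    \<comment> \<open>Comparison with the empty index set says that removing coordinates does not
      increase the norm.\<close>
    moreover have "norm (?tail G ?z) \<le> e/4"
      using l2_tail_mono[of "{}" G ?z] G x(2) by (simp add: dist_norm norm_minus_commute)
    ultimately show ?thesis
      unfolding E using norm_triangle_ineq[of "?tail G x" "?tail G ?z"] by linarith
  qed
  have "norm (blinfun_apply (op_of (S - (\<Sum>i\<in>G. matrix_unit i i) * S)) y) \<le> e/2 * norm y" for y
  proof (cases "y = 0")
    case False
    have eq: "blinfun_apply (op_of (S - (\<Sum>i\<in>G. matrix_unit i i) * S)) y = ?tail G (blinfun_apply (op_of S) y)" for y
      by (simp add: op_of_apply op_of_sum matrix_unit_apply)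
    have "norm (blinfun_apply (op_of (S - (\<Sum>i\<in>G. matrix_unit i i) * S)) (y /\<^sub>R norm y)) \<le> e/2"
      unfolding eq using False by (intro ball) simp
    then show ?thesis using False by (simp add: blinfun.scaleR_right field_simps)
  qed simp
  then have "norm (S - (\<Sum>i\<in>G. matrix_unit i i) * S) \<le> e/2"
    unfolding norm_compact_op.rep_eq using assms by (intro norm_blinfun_bound) auto
  then show ?thesis using G assms by (intro that[of G]) auto
qed

lemma matrix_unit_compress:
  "matrix_unit i i * S * matrix_unit j j = l2_coord (blinfun_apply (op_of S) (l2_basis j)) i *\<^sub>C matrix_unit i j"
  by (rule compact_op_eqI)
    (auto simp: op_of_apply matrix_unit_apply op_of_linear scaleC_scaleC mult.commute)

text \<open>Truncation by finite diagonal projections, first on the left and then on the right,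
  reduces S to the corners \<open>matrix_unit i i * S * matrix_unit j j\<close>, which are scalar
  multiples of matrix units.\<close>

lemma closed_subspace_matrix_units:
  assumes V: "closed V" "cv.subspace V" and unit: "\<And>i j. matrix_unit i j \<in> V"
  shows "S \<in> V"
proof -
  have left: "S \<in> V" if "\<And>i. matrix_unit i i * S \<in> V" for S
    unfolding closed_approachable[OF V(1), symmetric]
  proof (intro allI impI)
    fix e :: real assume "e > 0"
    then obtain F where F: "norm (S - (\<Sum>i\<in>F. matrix_unit i i) * S) < e"
      using compact_op_diagonal_approx by blast
    moreover have "(\<Sum>i\<in>F. matrix_unit i i) * S \<in> V"
      unfolding sum_distrib_right by (intro cv.subspace_sum V that)
    ultimately show "\<exists>y\<in>V. dist y S < e"
      by (auto simp: dist_norm norm_minus_commute)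
  qed
  have right: "S \<in> V" if "\<And>i. S * matrix_unit i i \<in> V" for S
    unfolding closed_approachable[OF V(1), symmetric]
  proof (intro allI impI)
    fix e :: real assume "e > 0"
    \<comment> \<open>The left approximation is applied to \<open>star S\<close>, since taking
      adjoints makes it a right approximation of S.\<close>
    then obtain F where "norm (star S - (\<Sum>i\<in>F. matrix_unit i i) * star S) < e"
      using compact_op_diagonal_approx by blast
    also have "star S - (\<Sum>i\<in>F. matrix_unit i i) * star S = star (S - S * (\<Sum>i\<in>F. matrix_unit i i))"
      by (simp add: star_diff star_mult star_sum star_matrix_unit)
    finally have "norm (S - S * (\<Sum>i\<in>F. matrix_unit i i)) < e"
      by (simp add: norm_star)
    moreover have "S * (\<Sum>i\<in>F. matrix_unit i i) \<in> V"
      unfolding sum_distrib_left by (intro cv.subspace_sum V that)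
    ultimately show "\<exists>y\<in>V. dist y S < e"
      by (auto simp: dist_norm norm_minus_commute)
  qed
  show ?thesis
    by (rule left, rule right) (simp add: matrix_unit_compress cv.subspace_scale V unit)
qed

section \<open>Strict limits and entries\<close>

lemma bounded_linear_of_clinear:
  assumes "clinear_map f" "\<And>x. norm (f x) \<le> norm x * K"
  shows "bounded_linear f"
  using assms by (intro bounded_linear_intro[where K = K]) (auto simp: clinear_map_def scaleR_scaleC)

lemma clinear_map_diff:
  assumes "clinear_map f"
  shows "f (x - y) = f x - f y"
proof -
  have "f (x - y + y) = f (x - y) + f y"
    using assms unfolding clinear_map_def by blast
  then show ?thesis by simp
qed

lemma of_algebra_sum: "of_algebra (sum f F) = (\<Sum>x\<in>F. of_algebra (f x))"
  by (induction F rule: infinite_finite_induct) (simp_all add: of_algebra_simps)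

lemma bounded_linear_mult_L: "bounded_linear (mult_L m)"
  by transfer auto

lemma clinear_map_mult_L: "clinear_map (mult_L m)"
  by (simp add: clinear_map_def mult_LR_linear)

text \<open>The left action determines the right one: moving the multipliers across the product in
  \<open>?z * star ?z\<close> leaves the difference of the left actions, so the C*-identity gives
  \<open>?z\<close> = 0.\<close>

lemma multiplier_eqI_left:
  fixes m n :: "'d::cstar_algebra multiplier"
  assumes L: "\<And>x. mult_L m x = mult_L n x"
  shows "m = n"
proof (rule multiplier_eqI[OF L])
  fix x
  let ?z = "mult_R m x - mult_R n x"
  have "?z * star ?z = 0"
    by (simp add: left_diff_distrib L flip: mult_LR_linear(7))
  then show "mult_R m x = mult_R n x"
    using cstar_identity[of "star ?z"] by (simp add: star_star norm_star)
qed

lemma strict_tendsto_unique: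
  assumes "strict_tendsto f m F" "strict_tendsto f n F" "F \<noteq> bot"
  shows "m = n"
proof (rule multiplier_eqI_left)
  show "mult_L m x = mult_L n x" for x
    using assms unfolding strict_tendsto_def by (blast intro: tendsto_unique)
qed

lemma strict_has_sum_unique:
  "strict_has_sum f m \<Longrightarrow> strict_has_sum f n \<Longrightarrow> m = n"
  unfolding strict_has_sum_def by (rule strict_tendsto_unique[OF _ _ finite_subsets_at_top_neq_bot])

text \<open>In a complete target, convergence at x is a Cauchy condition, and the uniform bound
  carries it to limits of points by an e/3 argument. Convergence of partial sums thus only has to be
  checked on matrix entries.\<close>

lemma closed_convergent:
  fixes f :: "'i \<Rightarrow> 'a::real_normed_vector \<Rightarrow> 'b::banach"
  assumes f: "\<And>i. bounded_linear (f i)" and C: "\<And>i x. norm (f i x) \<le> C * norm x"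
  shows "closed {x. \<exists>l. ((\<lambda>i. f i x) \<longlongrightarrow> l) F}"
proof -
  have conv: "(\<exists>l. ((\<lambda>i. f i x) \<longlongrightarrow> l) F) \<longleftrightarrow>
      (\<forall>e>0. \<exists>P. eventually P F \<and> (\<forall>i j. P i \<and> P j \<longrightarrow> dist (f i x) (f j x) < e))" for x
    unfolding filterlim_def cauchy_filter_metric_filtermap[symmetric] convergent_filter_iff_cauchy[symmetric]
    by (simp add: convergent_filter.simps)
  show ?thesis
    unfolding closed_limpt islimpt_approachable conv
  proof (intro allI impI CollectI)
    fix x and e :: real
    assume x: "\<forall>e>0. \<exists>y\<in>{x. \<forall>e>0. \<exists>P. eventually P F \<and> (\<forall>i j. P i \<and> P j \<longrightarrow> dist (f i x) (f j x) < e)}. y \<noteq> x \<and> dist y x < e"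
      and e: "e > 0"
    \<comment> \<open>The hypothesis does not make C positive, and d is defined by a
      division.\<close>
    define K where "K = \<bar>C\<bar> + 1"
    define d where "d = e / (3 * K)"
    have K: "K > 0" "C \<le> K" by (auto simp: K_def)
    then have "d > 0" using e by (simp add: d_def)
    then obtain y where y: "\<forall>e>0. \<exists>P. eventually P F \<and> (\<forall>i j. P i \<and> P j \<longrightarrow> dist (f i y) (f j y) < e)"
      and yx: "dist y x < d"
      using x[rule_format, of d] by blast
    obtain P where P: "eventually P F" "\<And>i j. P i \<Longrightarrow> P j \<Longrightarrow> dist (f i y) (f j y) < e/3"
      using y[rule_format, of "e/3"] e by auto
    have close: "dist (f i x) (f i y) \<le> e/3" for i
    proof -
      have "dist (f i x) (f i y) = norm (f i (x - y))"
        by (simp add: dist_norm linear_diff[OF bounded_linear.linear[OF f]])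
      also have "\<dots> \<le> C * norm (x - y)" by (rule C)
      also have "\<dots> \<le> K * d"
        using yx K by (intro mult_mono) (auto simp: dist_norm norm_minus_commute)
      also have "\<dots> = e/3" using K(1) by (simp add: d_def)
      finally show ?thesis .
    qed
    have "dist (f i x) (f j x) < e" if "P i" "P j" for i j
      using close[of i] close[of j] P(2)[OF that] dist_triangle[of "f i x" "f j x" "f i y"]
        dist_triangle[of "f i y" "f j x" "f j y"] by (simp add: dist_commute)
    then show "\<exists>P. eventually P F \<and> (\<forall>i j. P i \<and> P j \<longrightarrow> dist (f i x) (f j x) < e)"
      using P(1) by blast
  qed
qed

lemma subspace_convergent:
  fixes f :: "'i \<Rightarrow> 'a::complex_vector \<Rightarrow> 'b::complex_normed_vector"
  assumes "\<And>i. clinear_map (f i)"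
  shows "cv.subspace {x. \<exists>l. ((\<lambda>i. f i x) \<longlongrightarrow> l) F}"
proof (rule cv.subspaceI)
  have "f i 0 = 0" for i
    using clinear_map_diff[OF assms, of i 0 0] by simp
  then show "0 \<in> {x. \<exists>l. ((\<lambda>i. f i x) \<longlongrightarrow> l) F}"
    by (auto intro!: exI[of _ 0])
  have add: "f i (x + y) = f i x + f i y" "f i (c *\<^sub>C x) = c *\<^sub>C f i x" for i x y c
    using assms by (simp_all add: clinear_map_def)
  show "x + y \<in> {x. \<exists>l. ((\<lambda>i. f i x) \<longlongrightarrow> l) F}"
    if "x \<in> {x. \<exists>l. ((\<lambda>i. f i x) \<longlongrightarrow> l) F}" "y \<in> {x. \<exists>l. ((\<lambda>i. f i x) \<longlongrightarrow> l) F}" for x y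
    using that tendsto_add[of "\<lambda>i. f i x" _ F "\<lambda>i. f i y"] unfolding mem_Collect_eq add by blast
  show "c *\<^sub>C x \<in> {x. \<exists>l. ((\<lambda>i. f i x) \<longlongrightarrow> l) F}"
    if "x \<in> {x. \<exists>l. ((\<lambda>i. f i x) \<longlongrightarrow> l) F}" for x c
    using that tendsto_scaleC[of "\<lambda>i. f i x" _ F] unfolding mem_Collect_eq add by blast
qed

text \<open>The pointwise limits of left and right multiplication form a double centralizer: each
  required identity holds before the limit, and the bound C passes to the limit.\<close>

lemma strict_limit_exists:
  fixes m :: "'i \<Rightarrow> 'd::cstar_algebra"
  assumes F: "F \<noteq> bot" and C: "\<And>i. norm (m i) \<le> C"
    and left: "\<And>x. \<exists>l. ((\<lambda>i. m i * x) \<longlongrightarrow> l) F" and right: "\<And>x. \<exists>r. ((\<lambda>i. x * m i) \<longlongrightarrow> r) F"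
  shows "\<exists>M. strict_tendsto (\<lambda>i. of_algebra (m i)) M F"
proof -
  obtain L R where L: "\<And>x. ((\<lambda>i. m i * x) \<longlongrightarrow> L x) F" and R: "\<And>x. ((\<lambda>i. x * m i) \<longlongrightarrow> R x) F"
    using left right by metis
  note uniq = tendsto_unique[OF F]
  have linL: "clinear_map L"
    unfolding clinear_map_def
  proof (intro conjI allI)
    fix x y c
    show "L (x + y) = L x + L y"
      using tendsto_add[OF L[of x] L[of y]] by (intro uniq[OF L]) (simp add: distrib_left)
    show "L (c *\<^sub>C x) = c *\<^sub>C L x"
      using tendsto_scaleC[OF L[of x], of c] by (intro uniq[OF L]) (simp add: mult_scaleC_right)
  qed
  have linR: "clinear_map R"
    unfolding clinear_map_def
  proof (intro conjI allI)
    fix x y c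
    show "R (x + y) = R x + R y"
      using tendsto_add[OF R[of x] R[of y]] by (intro uniq[OF R]) (simp add: distrib_right)
    show "R (c *\<^sub>C x) = c *\<^sub>C R x"
      using tendsto_scaleC[OF R[of x], of c] by (intro uniq[OF R]) (simp add: mult_scaleC_left)
  qed
  have "norm (L x) \<le> norm x * C" for x
  proof (rule tendsto_upperbound[OF tendsto_norm[OF L] always_eventually F], rule allI)
    show "norm (m i * x) \<le> norm x * C" for i
      using norm_mult_ineq[of "m i" x] mult_right_mono[OF C[of i] norm_ge_zero[of x]]
      by (simp add: mult.commute)
  qed
  then have bL: "bounded_linear L" by (rule bounded_linear_of_clinear[OF linL])
  have "norm (R x) \<le> norm x * C" for x
  proof (rule tendsto_upperbound[OF tendsto_norm[OF R] always_eventually F], rule allI)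
    show "norm (x * m i) \<le> norm x * C" for i
      using norm_mult_ineq[of x "m i"] mult_left_mono[OF C[of i] norm_ge_zero[of x]] by simp
  qed
  then have bR: "bounded_linear R" by (rule bounded_linear_of_clinear[OF linR])
  have "L (x * y) = L x * y" for x y
    using tendsto_mult_right[OF L[of x], of y] by (intro uniq[OF L]) (simp add: mult.assoc)
  moreover have "R (x * y) = x * R y" for x y
    using tendsto_mult_left[OF R[of y], of x] by (intro uniq[OF R]) (simp add: mult.assoc)
  \<comment> \<open>Both sides are limits of \<open>x * m i * y\<close>.\<close>
  moreover have "x * L y = R x * y" for x y
    using tendsto_mult_left[OF L[of y], of x] tendsto_mult_right[OF R[of x], of y]
    by (intro uniq[of "\<lambda>i. x * m i * y"]) (simp_all add: mult.assoc)
  ultimately have "Rep_multiplier (Abs_multiplier (L, R)) = (L, R)"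
    using linL linR bL bR by (intro Abs_multiplier_inverse) auto
  then have "mult_L (Abs_multiplier (L, R)) = L" "mult_R (Abs_multiplier (L, R)) = R"
    by (simp_all add: mult_L.rep_eq mult_R.rep_eq)
  then have "strict_tendsto (\<lambda>i. of_algebra (m i)) (Abs_multiplier (L, R)) F"
    using L R by (simp add: strict_tendsto_def mult_LR_of_algebra)
  then show ?thesis by blast
qed

section \<open>Matrix entries in a tensor product with the compact operators\<close>

locale compact_tensor =
  fixes T :: "'b::cstar_algebra \<Rightarrow> compact_op \<Rightarrow> 'd::cstar_algebra"
  assumes tensor: "cstar_tensor_product T"
begin

lemma clinear_T: "clinear_map (\<lambda>b. T b k)" "clinear_map (T b)"
  and T_mult: "T a k * T b l = T (a * b) (k * l)"
  and star_T: "star (T b k) = T (star b) (star k)"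
  and norm_T: "norm (T b k) = norm b * norm k"
  and closure_span_T: "closure (cv.span {T b k | b k. True}) = UNIV"
  using tensor unfolding cstar_tensor_product_def by auto

lemma bounded_linear_T: "bounded_linear (T b)"
  by (rule bounded_linear_of_clinear[OF clinear_T(2), where K = "norm b"]) (simp add: norm_T mult.commute)

definition entry :: "'b \<Rightarrow> int \<Rightarrow> int \<Rightarrow> 'd" where
  "entry b i j = T b (matrix_unit i j)"

lemma clinear_entry: "clinear_map (\<lambda>b. entry b i j)"
  unfolding entry_def by (rule clinear_T)

lemma entry_simps:
  "entry 0 i j = 0" "entry (a + b) i j = entry a i j + entry b i j"
  "entry (a - b) i j = entry a i j - entry b i j" "entry (c *\<^sub>C b) i j = c *\<^sub>C entry b i j"
proof -
  show diff: "entry (a - b) i j = entry a i j - entry b i j" for a b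
    by (rule clinear_map_diff[OF clinear_entry])
  show "entry 0 i j = 0" using diff[of 0 0] by simp
qed (use clinear_entry in \<open>auto simp: clinear_map_def\<close>)

lemma entry_sum: "entry (sum f F) i j = (\<Sum>x\<in>F. entry (f x) i j)"
  by (rule clinear_map_sum[OF clinear_entry])

lemma T_zero_right: "T b 0 = 0"
  using clinear_map_diff[OF clinear_T(2), of b 0 0] by simp

lemma entry_mult: "entry a i j * entry b k l = (if j = k then entry (a * b) i l else 0)"
  by (simp add: entry_def T_mult matrix_unit_mult T_zero_right)

lemma star_entry: "star (entry b i j) = entry (star b) j i"
  by (simp add: entry_def star_T star_matrix_unit)

lemma norm_entry_le: "norm (entry b i j) \<le> norm b"
  by (simp add: entry_def norm_T mult_left_le norm_matrix_unit_le)

text \<open>For fixed b, the operators k with \<open>T b k \<in> V\<close> form a closed subspace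
  containing the matrix units, hence all compact operators; the elementary tensors in turn have
  dense span.\<close>

lemma closed_subspace_entries:
  assumes V: "closed V" "cv.subspace V" and entry: "\<And>b i j. entry b i j \<in> V"
  shows "x \<in> V"
proof -
  have "T b k \<in> V" for b k
  proof -
    have "k \<in> {k. T b k \<in> V}"
    proof (rule closed_subspace_matrix_units)
      have "closed (T b -` V)"
        by (rule continuous_closed_vimage[OF V(1)])
          (simp add: linear_continuous_at bounded_linear_T)
      then show "closed {k. T b k \<in> V}" by (simp add: vimage_def)
      show "cv.subspace {k. T b k \<in> V}"
        using V(2) clinear_T(2)[of b] by (simp add: cv.subspace_def clinear_map_def T_zero_right)
      show "matrix_unit i j \<in> {k. T b k \<in> V}" for i j
        using entry[of b i j] by (simp add: entry_def)
    qed
    then show ?thesis by simp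
  qed
  then have "cv.span {T b k | b k. True} \<subseteq> V"
    by (intro cv.span_minimal V) auto
  then have "closure (cv.span {T b k | b k. True}) \<subseteq> V"
    by (intro closure_minimal V)
  then show ?thesis unfolding closure_span_T by blast
qed

lemma multiplier_eqI_entries:
  fixes m n :: "'d multiplier"
  assumes "\<And>b i j. mult_L m (entry b i j) = mult_L n (entry b i j)"
  shows "m = n"
proof (rule multiplier_eqI_left)
  fix x
  have "x \<in> {x. mult_L m x = mult_L n x}"
  proof (rule closed_subspace_entries)
    show "closed {x. mult_L m x = mult_L n x}"
      by (intro closed_Collect_eq linear_continuous_on bounded_linear_mult_L)
    show "cv.subspace {x. mult_L m x = mult_L n x}"
      using mult_LR_linear(3)[of m 0] mult_LR_linear(3)[of n 0]
      by (auto simp: cv.subspace_def mult_LR_linear)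
  qed (simp add: assms)
  then show "mult_L m x = mult_L n x" by simp
qed

text \<open>Repeated squaring makes the factor \<open>card I\<close> of the triangle inequality irrelevant in the limit.\<close>
lemma norm_selfadjoint_diagonal_power:
  assumes "finite I" "\<And>i. i \<in> I \<Longrightarrow> star (y i) = y i" "\<And>i. i \<in> I \<Longrightarrow> norm (y i) \<le> M"
  shows "norm (\<Sum>i\<in>I. entry (y i) i i) ^ (2 ^ n) \<le> real (card I) * M ^ (2 ^ n)"
  using assms(2,3)
proof (induction n arbitrary: y M)
  case 0
  have "norm (\<Sum>i\<in>I. entry (y i) i i) \<le> (\<Sum>i\<in>I. M)"
    using 0 by (intro order_trans[OF norm_sum] sum_mono order_trans[OF norm_entry_le])
  then show ?case by simp
next
  case (Suc n)
  let ?Y = "\<Sum>i\<in>I. entry (y i) i i"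
  have sa: "star ?Y = ?Y"
    using Suc.prems by (simp add: star_sum star_entry)
  have "?Y * ?Y = (\<Sum>i\<in>I. \<Sum>j\<in>I. if i = j then entry (y i * y i) i i else 0)"
    by (auto simp: sum_product entry_mult intro!: sum.cong)
  also have "\<dots> = (\<Sum>i\<in>I. entry (y i * y i) i i)"
    using assms(1) by (intro sum.cong) simp_all
  finally have sq: "?Y * ?Y = (\<Sum>i\<in>I. entry (y i * y i) i i)" .
  \<comment> \<open>By the C*-identity, the claim for \<open>Suc n\<close> is the claim for n with
    entries \<open>y i * y i\<close> and bound \<open>M\<^sup>2\<close>.\<close>
  have "(norm ?Y)\<^sup>2 = norm (\<Sum>i\<in>I. entry (y i * y i) i i)"
    using cstar_identity[of ?Y] by (simp add: sa sq)
  moreover have "norm (\<Sum>i\<in>I. entry (y i * y i) i i) ^ (2 ^ n) \<le> real (card I) * (M\<^sup>2) ^ (2 ^ n)"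
  proof (rule Suc.IH)
    fix i assume i: "i \<in> I"
    show "star (y i * y i) = y i * y i" using Suc.prems(1)[OF i] by (simp add: star_mult)
    show "norm (y i * y i) \<le> M\<^sup>2"
      using norm_mult_ineq[of "y i" "y i"] mult_mono[OF Suc.prems(2)[OF i] Suc.prems(2)[OF i]]
        order_trans[OF norm_ge_zero Suc.prems(2)[OF i]]
      by (simp add: power2_eq_square)
  qed
  ultimately show ?case by (simp add: power_mult)
qed

text \<open>If the norm exceeded M + e, its ratio r > 1 to M + e would satisfy
  \<open>r ^ (2 ^ n) \<le> real (card I)\<close> for every n. The slack e keeps the denominator
  positive when M = 0.\<close>

lemma norm_selfadjoint_diagonal:
  assumes "finite I" "\<And>i. i \<in> I \<Longrightarrow> star (y i) = y i" "\<And>i. i \<in> I \<Longrightarrow> norm (y i) \<le> M" "M \<ge> 0"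
  shows "norm (\<Sum>i\<in>I. entry (y i) i i) \<le> M"
proof (rule field_le_epsilon, rule ccontr)
  fix e :: real
  let ?Y = "norm (\<Sum>i\<in>I. entry (y i) i i)"
  assume "e > 0" and less: "\<not> ?Y \<le> M + e"
  have pos: "M + e > 0" using \<open>e > 0\<close> assms(4) by simp
  define r where "r = ?Y / (M + e)"
  have r: "r > 1" using less pos by (simp add: r_def)
  obtain n where n: "real (card I) < r ^ n" using real_arch_pow[OF r] by blast
  have "?Y ^ (2 ^ n) \<le> real (card I) * (M + e) ^ (2 ^ n)"
  proof (rule norm_selfadjoint_diagonal_power)
    show "norm (y i) \<le> M + e" if "i \<in> I" for i
      using assms(3)[OF that] \<open>e > 0\<close> by simp
  qed (use assms in auto)
  then have "r ^ (2 ^ n) \<le> real (card I)"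
    using pos by (simp add: r_def power_divide pos_divide_le_eq)
  moreover have "r ^ n \<le> r ^ (2 ^ n)"
    using r less_exp[of n] by (intro power_increasing) simp_all
  ultimately show False using n by linarith
qed

text \<open>\<open>?X * star ?X\<close> is supported on the main diagonal with self-adjoint entries
  \<open>b i * star (b i)\<close>. Because the bound does not grow with I, partial sums of banded
  matrices stay uniformly bounded.\<close>

lemma norm_diagonal:
  assumes "finite I" "\<And>i. i \<in> I \<Longrightarrow> norm (b i) \<le> M" "M \<ge> 0"
  shows "norm (\<Sum>i\<in>I. entry (b i) i (i + k)) \<le> M"
proof (rule power2_le_imp_le)
  let ?X = "\<Sum>i\<in>I. entry (b i) i (i + k)"
  have "?X * star ?X = (\<Sum>i\<in>I. \<Sum>j\<in>I. if i = j then entry (b i * star (b i)) i i else 0)"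
    by (auto simp: sum_product star_sum star_entry entry_mult intro!: sum.cong)
  also have "\<dots> = (\<Sum>i\<in>I. entry (b i * star (b i)) i i)"
    using assms(1) by (intro sum.cong) simp_all
  finally have "(norm ?X)\<^sup>2 = norm (\<Sum>i\<in>I. entry (b i * star (b i)) i i)"
    using cstar_identity[of "star ?X"] by (simp add: star_star norm_star)
  also have "\<dots> \<le> M\<^sup>2"
  proof (rule norm_selfadjoint_diagonal)
    fix i assume i: "i \<in> I"
    show "star (b i * star (b i)) = b i * star (b i)" by (simp add: star_mult star_star)
    show "norm (b i * star (b i)) \<le> M\<^sup>2"
      using norm_mult_ineq[of "b i" "star (b i)"] mult_mono[OF assms(2)[OF i] assms(2)[OF i] assms(3)]
      by (simp add: power2_eq_square norm_star)
  qed (use assms in auto)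
  finally show "(norm ?X)\<^sup>2 \<le> M\<^sup>2" .
qed fact

end

section \<open>Banded matrices as multipliers\<close>

text \<open>Boundedness is part of the notion, since a band shape alone does not give a
  multiplier.\<close>

definition banded :: "int \<Rightarrow> (int \<times> int \<Rightarrow> 'b::real_normed_vector) \<Rightarrow> bool" where
  "banded N c \<longleftrightarrow> (\<forall>i j. N < \<bar>i - j\<bar> \<longrightarrow> c (i, j) = 0) \<and> (\<exists>C. \<forall>p. norm (c p) \<le> C)"

lemma bandedD: "banded N c \<Longrightarrow> N < \<bar>i - j\<bar> \<Longrightarrow> c (i, j) = 0"
  by (simp add: banded_def)

lemma bandedE:
  assumes "banded N c"
  obtains C where "C \<ge> 0" "\<And>p. norm (c p) \<le> C"
  using assms unfolding banded_def by (metis norm_ge_zero order_trans)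

lemma banded_mono: "banded N c \<Longrightarrow> N \<le> N' \<Longrightarrow> banded N' c"
  unfolding banded_def by force

lemma banded_add:
  assumes "banded N c" "banded N c'"
  shows "banded N (\<lambda>p. c p + c' p)"
proof -
  obtain C C' where "\<And>p. norm (c p) \<le> C" "\<And>p. norm (c' p) \<le> C'"
    using bandedE[OF assms(1)] bandedE[OF assms(2)] by metis
  then have "\<forall>p. norm (c p + c' p) \<le> C + C'"
    by (intro allI norm_triangle_mono)
  then show ?thesis using assms by (auto simp: banded_def)
qed

lemma banded_scaleC:
  fixes c :: "int \<times> int \<Rightarrow> 'b::complex_normed_vector"
  assumes "banded N c"
  shows "banded N (\<lambda>p. z *\<^sub>C c p)"
proof -
  obtain C where "\<And>p. norm (c p) \<le> C" using bandedE[OF assms] by metis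
  then have "\<forall>p. norm (z *\<^sub>C c p) \<le> cmod z * C"
    by (simp add: norm_scaleC mult_left_mono)
  then show ?thesis using assms by (auto simp: banded_def scaleC_zero_right)
qed

lemma banded_diff:
  assumes "banded N c" "banded N c'"
  shows "banded N (\<lambda>p. c p - c' p)"
proof -
  obtain C C' where "\<And>p. norm (c p) \<le> C" "\<And>p. norm (c' p) \<le> C'"
    using bandedE[OF assms(1)] bandedE[OF assms(2)] by metis
  then have "norm (c p - c' p) \<le> C + C'" for p
    using norm_triangle_ineq4[of "c p" "c' p"] by (meson add_mono order_trans)
  then show ?thesis using assms by (auto simp: banded_def)
qed

lemma banded_star:
  fixes c :: "int \<times> int \<Rightarrow> 'b::cstar_algebra"
  assumes "banded N c"
  shows "banded N (\<lambda>(i, j). star (c (j, i)))"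
proof -
  obtain C where "\<And>p. norm (c p) \<le> C" using bandedE[OF assms] by metis
  then have "\<forall>p. norm (case p of (i, j) \<Rightarrow> star (c (j, i))) \<le> C"
    by (simp add: norm_star split: prod.split)
  then show ?thesis using assms by (auto simp: banded_def star_zero abs_minus_commute)
qed

text \<open>The sum over the window around j is the full matrix product, as \<open>c' (k, j)\<close>
  vanishes outside it. Two steps of length at most N reach no further than 2 N.\<close>

lemma banded_mult:
  fixes c c' :: "int \<times> int \<Rightarrow> 'b::real_normed_algebra"
  assumes c: "banded N c" and c': "banded N c'"
  shows "banded (2 * N) (\<lambda>(i, j). \<Sum>k=j-N..j+N. c (i, k) * c' (k, j))"
  unfolding banded_def
proof (intro conjI allI impI)
  fix i j :: int
  assume far: "2 * N < \<bar>i - j\<bar>"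
  have "c (i, k) = 0" if "k \<in> {j-N..j+N}" for k
    using that far by (intro bandedD[OF c]) auto
  then show "(case (i, j) of (i, j) \<Rightarrow> \<Sum>k=j-N..j+N. c (i, k) * c' (k, j)) = 0"
    by simp
next
  obtain C where C: "C \<ge> 0" "\<And>p. norm (c p) \<le> C" using bandedE[OF c] by metis
  obtain C' where C': "C' \<ge> 0" "\<And>p. norm (c' p) \<le> C'" using bandedE[OF c'] by metis
  have "norm (\<Sum>k=j-N..j+N. c (i, k) * c' (k, j)) \<le> of_nat (nat (2 * N + 1)) * (C * C')" for i j
  proof -
    have "norm (c (i, k) * c' (k, j)) \<le> C * C'" for k
      by (rule order_trans[OF norm_mult_ineq]) (intro mult_mono C C' norm_ge_zero)
    then have "norm (\<Sum>k=j-N..j+N. c (i, k) * c' (k, j)) \<le> of_nat (card {j-N..j+N}) * (C * C')"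
      by (intro order_trans[OF norm_sum] sum_bounded_above)
    moreover have "card {j-N..j+N} = nat (2 * N + 1)" by simp
    ultimately show ?thesis by (simp only:)
  qed
  then show "\<exists>K. \<forall>p. norm (case p of (i, j) \<Rightarrow> \<Sum>k=j-N..j+N. c (i, k) * c' (k, j)) \<le> K"
    by (auto intro!: exI[of _ "of_nat (nat (2 * N + 1)) * (C * C')"])
qed

context compact_tensor
begin

definition matrix_term :: "(int \<times> int \<Rightarrow> 'b) \<Rightarrow> int \<times> int \<Rightarrow> 'd" where
  "matrix_term c = (\<lambda>(i, j). entry (c (i, j)) i j)"

text \<open>Sorting F by the diagonals j - i leaves 2 N + 1 sums, each bounded through
  \<open>norm_diagonal\<close> whatever the size of F. The bound M is asked for on F only, so that
  it can be taken small away from the large entries.\<close>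

lemma norm_sum_matrix_term:
  assumes "finite F" and band: "banded N c" and "N \<ge> 0" and M: "\<And>p. p \<in> F \<Longrightarrow> norm (c p) \<le> M" "M \<ge> 0"
  shows "norm (sum (matrix_term c) F) \<le> of_int (2 * N + 1) * M"
proof -
  define F' where "F' = {p \<in> F. snd p - fst p \<in> {-N..N}}"
  have fin: "finite F'" using assms(1) by (simp add: F'_def)
  have diag: "norm (sum (matrix_term c) {p \<in> F'. snd p - fst p = k}) \<le> M" for k
  proof -
    define I where "I = fst ` {p \<in> F'. snd p - fst p = k}"
    have "sum (matrix_term c) {p \<in> F'. snd p - fst p = k} = (\<Sum>i\<in>I. entry (c (i, i + k)) i (i + k))"
      unfolding I_def
      by (rule sum.reindex_bij_witness[of _ "\<lambda>i. (i, i + k)" fst]) (auto simp: matrix_term_def)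
    also have "norm \<dots> \<le> M"
    proof (rule norm_diagonal)
      show "norm (c (i, i + k)) \<le> M" if "i \<in> I" for i
        using that by (auto simp: I_def F'_def intro!: M)
    qed (use fin M in \<open>auto simp: I_def\<close>)
    finally show ?thesis .
  qed
  have "sum (matrix_term c) F = sum (matrix_term c) F'"
  proof (rule sum.mono_neutral_right[OF assms(1)])
    show "F' \<subseteq> F" by (auto simp: F'_def)
    show "\<forall>p\<in>F - F'. matrix_term c p = 0"
    proof
      fix p assume "p \<in> F - F'"
      then have "c (fst p, snd p) = 0" by (intro bandedD[OF band]) (auto simp: F'_def)
      then show "matrix_term c p = 0" by (simp add: matrix_term_def case_prod_beta entry_simps)
    qed
  qed
  also have "\<dots> = (\<Sum>k\<in>{-N..N}. sum (matrix_term c) {p \<in> F'. snd p - fst p = k})"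
    by (rule sum.group[symmetric, OF fin]) (auto simp: F'_def)
  also have "norm \<dots> \<le> of_nat (card {-N..N}) * M"
    by (intro order_trans[OF norm_sum] sum_bounded_above diag)
  also have "of_nat (card {-N..N}) = (of_int (2 * N + 1) :: real)"
    using \<open>N \<ge> 0\<close> by simp
  finally show ?thesis .
qed

text \<open>Multiplication by \<open>entry b p q\<close> picks out column p, whose nonzero entries
  lie in the window around p; once F contains that window, the product no longer changes.\<close>

lemma sum_matrix_term_times_entry:
  assumes "finite F" "(\<lambda>i. (i, p)) ` {p-N..p+N} \<subseteq> F" "banded N c"
  shows "sum (matrix_term c) F * entry b p q = (\<Sum>i=p-N..p+N. entry (c (i, p) * b) i q)"
proof -
  have "sum (matrix_term c) F * entry b p q = (\<Sum>x\<in>F. matrix_term c x * entry b p q)"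
    by (rule sum_distrib_right)
  also have "\<dots> = (\<Sum>x\<in>(\<lambda>i. (i, p)) ` {p-N..p+N}. matrix_term c x * entry b p q)"
  proof (intro sum.mono_neutral_right ballI assms)
    fix x assume x: "x \<in> F - (\<lambda>i. (i, p)) ` {p-N..p+N}"
    obtain i j where ij: "x = (i, j)" by (cases x)
    show "matrix_term c x * entry b p q = 0"
    proof (cases "j = p")
      case True
      then have "N < \<bar>i - j\<bar>" using x ij by (force simp: image_iff)
      then show ?thesis by (simp add: ij matrix_term_def bandedD[OF assms(3)] entry_simps)
    qed (simp add: ij matrix_term_def entry_mult)
  qed
  also have "\<dots> = (\<Sum>i=p-N..p+N. entry (c (i, p) * b) i q)"
    by (subst sum.reindex) (auto simp: inj_on_def matrix_term_def entry_mult)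
  finally show ?thesis .
qed

lemma entry_times_sum_matrix_term:
  assumes "finite F" "(\<lambda>j. (q, j)) ` {q-N..q+N} \<subseteq> F" "banded N c"
  shows "entry b p q * sum (matrix_term c) F = (\<Sum>j=q-N..q+N. entry (b * c (q, j)) p j)"
proof -
  have "entry b p q * sum (matrix_term c) F = (\<Sum>x\<in>F. entry b p q * matrix_term c x)"
    by (rule sum_distrib_left)
  also have "\<dots> = (\<Sum>x\<in>(\<lambda>j. (q, j)) ` {q-N..q+N}. entry b p q * matrix_term c x)"
  proof (intro sum.mono_neutral_right ballI assms)
    fix x assume x: "x \<in> F - (\<lambda>j. (q, j)) ` {q-N..q+N}"
    obtain i j where ij: "x = (i, j)" by (cases x)
    show "entry b p q * matrix_term c x = 0"
    proof (cases "i = q")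
      case True
      then have "N < \<bar>i - j\<bar>" using x ij by (force simp: image_iff)
      then show ?thesis by (simp add: ij matrix_term_def bandedD[OF assms(3)] entry_simps)
    qed (simp add: ij matrix_term_def entry_mult)
  qed
  also have "\<dots> = (\<Sum>j=q-N..q+N. entry (b * c (q, j)) p j)"
    by (subst sum.reindex) (auto simp: inj_on_def matrix_term_def entry_mult)
  finally show ?thesis .
qed

lemma sum_matrix_term_tendsto:
  assumes "banded N c"
  shows "((\<lambda>F. sum (matrix_term c) F * entry b p q) \<longlongrightarrow> (\<Sum>i=p-N..p+N. entry (c (i, p) * b) i q)) (finite_subsets_at_top UNIV)"
    and "((\<lambda>F. entry b p q * sum (matrix_term c) F) \<longlongrightarrow> (\<Sum>j=q-N..q+N. entry (b * c (q, j)) p j)) (finite_subsets_at_top UNIV)"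
proof -
  have "\<forall>\<^sub>F F in finite_subsets_at_top UNIV. sum (matrix_term c) F * entry b p q = (\<Sum>i=p-N..p+N. entry (c (i, p) * b) i q)"
    unfolding eventually_finite_subsets_at_top
    by (rule exI[of _ "(\<lambda>i. (i, p)) ` {p-N..p+N}"]) (auto intro!: sum_matrix_term_times_entry assms)
  then show "((\<lambda>F. sum (matrix_term c) F * entry b p q) \<longlongrightarrow> (\<Sum>i=p-N..p+N. entry (c (i, p) * b) i q)) (finite_subsets_at_top UNIV)"
    by (rule tendsto_eventually)
  have "\<forall>\<^sub>F F in finite_subsets_at_top UNIV. entry b p q * sum (matrix_term c) F = (\<Sum>j=q-N..q+N. entry (b * c (q, j)) p j)"
    unfolding eventually_finite_subsets_at_top
    by (rule exI[of _ "(\<lambda>j. (q, j)) ` {q-N..q+N}"]) (auto intro!: entry_times_sum_matrix_term assms)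
  then show "((\<lambda>F. entry b p q * sum (matrix_term c) F) \<longlongrightarrow> (\<Sum>j=q-N..q+N. entry (b * c (q, j)) p j)) (finite_subsets_at_top UNIV)"
    by (rule tendsto_eventually)
qed

text \<open>On an entry the partial sums are eventually constant, and their uniform bound lets
  \<open>closed_convergent\<close> spread the convergence to all x.\<close>

lemma strict_has_sum_matrix_term_exists:
  assumes band: "banded N c"
  shows "\<exists>m. strict_has_sum (\<lambda>p. of_algebra (matrix_term c p)) m"
proof -
  \<comment> \<open>The norm estimate counts 2 N + 1 diagonals and therefore wants a nonnegative
    width.\<close>
  define N' where "N' = max 0 N"
  have band': "banded N' c" and N': "N' \<ge> 0"
    using banded_mono[OF band, of N'] by (simp_all add: N'_def)
  obtain C where C: "C \<ge> 0" "\<And>p. norm (c p) \<le> C" using bandedE[OF band] by metis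
  define K where "K = of_int (2 * N' + 1) * C"
  have bound: "norm (sum (matrix_term c) F) \<le> K" for F
  \<comment> \<open>\<open>strict_limit_exists\<close> wants the bound at every index F; over an
    infinite F the sum is 0 by convention.\<close>
  proof (cases "finite F")
    case True
    then show ?thesis unfolding K_def by (rule norm_sum_matrix_term[OF _ band' N' C(2) C(1)])
  qed (use C N' in \<open>simp add: K_def\<close>)
  let ?F = "finite_subsets_at_top (UNIV :: (int \<times> int) set)"
  have left: "\<exists>l. ((\<lambda>F. sum (matrix_term c) F * x) \<longlongrightarrow> l) ?F" for x
  proof -
    have "x \<in> {x. \<exists>l. ((\<lambda>F. sum (matrix_term c) F * x) \<longlongrightarrow> l) ?F}"
    proof (rule closed_subspace_entries)
      show "closed {x. \<exists>l. ((\<lambda>F. sum (matrix_term c) F * x) \<longlongrightarrow> l) ?F}"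
      proof (rule closed_convergent[OF bounded_linear_mult_right])
        show "norm (sum (matrix_term c) F * x) \<le> K * norm x" for F x
          using norm_mult_ineq[of "sum (matrix_term c) F" x] mult_right_mono[OF bound[of F] norm_ge_zero[of x]]
          by linarith
      qed
      show "cv.subspace {x. \<exists>l. ((\<lambda>F. sum (matrix_term c) F * x) \<longlongrightarrow> l) ?F}"
        by (rule subspace_convergent) (simp add: clinear_map_def distrib_left mult_scaleC_right)
    qed (use sum_matrix_term_tendsto(1)[OF band] in blast)
    then show ?thesis by simp
  qed
  have right: "\<exists>l. ((\<lambda>F. x * sum (matrix_term c) F) \<longlongrightarrow> l) ?F" for x
  proof -
    have "x \<in> {x. \<exists>l. ((\<lambda>F. x * sum (matrix_term c) F) \<longlongrightarrow> l) ?F}"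
    proof (rule closed_subspace_entries)
      show "closed {x. \<exists>l. ((\<lambda>F. x * sum (matrix_term c) F) \<longlongrightarrow> l) ?F}"
      proof (rule closed_convergent[OF bounded_linear_mult_left])
        show "norm (x * sum (matrix_term c) F) \<le> K * norm x" for F x
          using norm_mult_ineq[of x "sum (matrix_term c) F"] mult_left_mono[OF bound[of F] norm_ge_zero[of x]]
          by (simp add: mult.commute)
      qed
      show "cv.subspace {x. \<exists>l. ((\<lambda>F. x * sum (matrix_term c) F) \<longlongrightarrow> l) ?F}"
        by (rule subspace_convergent) (simp add: clinear_map_def distrib_right mult_scaleC_left)
    qed (use sum_matrix_term_tendsto(2)[OF band] in blast)
    then show ?thesis by simp
  qed
  obtain m where "strict_tendsto (\<lambda>F. of_algebra (sum (matrix_term c) F)) m ?F"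
    using strict_limit_exists[OF _ bound left right] by auto
  then show ?thesis
    unfolding strict_has_sum_def of_algebra_sum by blast
qed

text \<open>The same description as in \<open>Phi0_def\<close>, so that \<open>Phi0\<close> becomes
  the case of \<open>coeff a\<close> by rewriting the summands.\<close>

definition matrix_multiplier :: "(int \<times> int \<Rightarrow> 'b) \<Rightarrow> 'd multiplier" where
  "matrix_multiplier c = (THE m. strict_has_sum (\<lambda>p. of_algebra (matrix_term c p)) m)"

lemma strict_has_sum_matrix_multiplier:
  assumes "banded N c"
  shows "strict_has_sum (\<lambda>p. of_algebra (matrix_term c p)) (matrix_multiplier c)"
proof -
  obtain m where m: "strict_has_sum (\<lambda>p. of_algebra (matrix_term c p)) m"
    using strict_has_sum_matrix_term_exists[OF assms] by blast
  then have "matrix_multiplier c = m"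
    unfolding matrix_multiplier_def by (rule the_equality) (rule strict_has_sum_unique[OF _ m])
  with m show ?thesis by simp
qed

lemma strict_matrix_multiplier:
  assumes "banded N c"
  shows "((\<lambda>F. sum (matrix_term c) F * x) \<longlongrightarrow> mult_L (matrix_multiplier c) x) (finite_subsets_at_top UNIV)"
    and "((\<lambda>F. x * sum (matrix_term c) F) \<longlongrightarrow> mult_R (matrix_multiplier c) x) (finite_subsets_at_top UNIV)"
  using strict_has_sum_matrix_multiplier[OF assms]
  unfolding strict_has_sum_def strict_tendsto_def of_algebra_sum[symmetric] mult_LR_of_algebra by blast+

lemma matrix_multiplier_entry:
  assumes "banded N c"
  shows "mult_L (matrix_multiplier c) (entry b p q) = (\<Sum>i=p-N..p+N. entry (c (i, p) * b) i q)"
    and "mult_R (matrix_multiplier c) (entry b p q) = (\<Sum>j=q-N..q+N. entry (b * c (q, j)) p j)"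
  using tendsto_unique[OF _ strict_matrix_multiplier(1)[OF assms] sum_matrix_term_tendsto(1)[OF assms]]
    tendsto_unique[OF _ strict_matrix_multiplier(2)[OF assms] sum_matrix_term_tendsto(2)[OF assms]]
  by simp_all

lemma matrix_multiplier_add:
  assumes "banded N c" "banded N c'"
  shows "matrix_multiplier c + matrix_multiplier c' = matrix_multiplier (\<lambda>p. c p + c' p)"
  by (rule multiplier_eqI_entries)
    (simp add: mult_LR_simps matrix_multiplier_entry[OF assms(1)] matrix_multiplier_entry[OF assms(2)] matrix_multiplier_entry[OF banded_add[OF assms]]
      distrib_right entry_simps sum.distrib)

lemma matrix_multiplier_diff:
  assumes "banded N c" "banded N c'"
  shows "matrix_multiplier c - matrix_multiplier c' = matrix_multiplier (\<lambda>p. c p - c' p)"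
  by (rule multiplier_eqI_entries)
    (simp add: mult_LR_simps matrix_multiplier_entry[OF assms(1)] matrix_multiplier_entry[OF assms(2)] matrix_multiplier_entry[OF banded_diff[OF assms]]
      left_diff_distrib entry_simps sum_subtractf)

lemma matrix_multiplier_scaleC:
  assumes "banded N c"
  shows "z *\<^sub>C matrix_multiplier c = matrix_multiplier (\<lambda>p. z *\<^sub>C c p)"
  by (rule multiplier_eqI_entries)
    (simp add: mult_LR_simps matrix_multiplier_entry[OF assms] matrix_multiplier_entry[OF banded_scaleC[OF assms]]
      mult_scaleC_left entry_simps scaleC_sum_right)

lemma matrix_multiplier_star:
  assumes "banded N c"
  shows "star (matrix_multiplier c) = matrix_multiplier (\<lambda>(i, j). star (c (j, i)))"
  by (rule multiplier_eqI_entries)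
    (simp add: mult_LR_simps star_entry matrix_multiplier_entry[OF assms] matrix_multiplier_entry[OF banded_star[OF assms]]
      star_sum star_mult star_star)

lemma matrix_multiplier_mult:
  assumes c: "banded N c" and c': "banded N c'"
  shows "matrix_multiplier c * matrix_multiplier c' = matrix_multiplier (\<lambda>(i, j). \<Sum>k=j-N..j+N. c (i, k) * c' (k, j))"
proof (rule multiplier_eqI_entries)
  fix b p q
  \<comment> \<open>The range of i is enlarged to one independent of k, so that the two sums can be
    exchanged; the added terms lie outside the band of c.\<close>
  have ext: "(\<Sum>i=k-N..k+N. entry (c (i, k) * (c' (k, p) * b)) i q) =
      (\<Sum>i=p-2*N..p+2*N. entry (c (i, k) * (c' (k, p) * b)) i q)" if k: "k \<in> {p-N..p+N}" for k
  proof (intro sum.mono_neutral_left ballI)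
    fix i assume "i \<in> {p-2*N..p+2*N} - {k-N..k+N}"
    then have "c (i, k) = 0" by (intro bandedD[OF c]) auto
    then show "entry (c (i, k) * (c' (k, p) * b)) i q = 0" by (simp add: entry_simps)
  qed (use k in auto)
  have "mult_L (matrix_multiplier c * matrix_multiplier c') (entry b p q) =
      (\<Sum>k=p-N..p+N. \<Sum>i=k-N..k+N. entry (c (i, k) * (c' (k, p) * b)) i q)"
    by (simp add: mult_LR_simps matrix_multiplier_entry[OF c'] clinear_map_sum[OF clinear_map_mult_L] matrix_multiplier_entry[OF c])
  also have "\<dots> = (\<Sum>k=p-N..p+N. \<Sum>i=p-2*N..p+2*N. entry (c (i, k) * (c' (k, p) * b)) i q)"
    by (rule sum.cong[OF refl ext])
  also have "\<dots> = (\<Sum>i=p-2*N..p+2*N. \<Sum>k=p-N..p+N. entry (c (i, k) * (c' (k, p) * b)) i q)"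
    by (rule sum.swap)
  also have "\<dots> = mult_L (matrix_multiplier (\<lambda>(i, j). \<Sum>k=j-N..j+N. c (i, k) * c' (k, j))) (entry b p q)"
    by (simp add: matrix_multiplier_entry[OF banded_mult[OF c c']] sum_distrib_right entry_sum mult.assoc)
  finally show "mult_L (matrix_multiplier c * matrix_multiplier c') (entry b p q) =
      mult_L (matrix_multiplier (\<lambda>(i, j). \<Sum>k=j-N..j+N. c (i, k) * c' (k, j))) (entry b p q)" .
qed

text \<open>Off a finite set the entries are small, so by \<open>norm_sum_matrix_term\<close> the
  partial sums are Cauchy in norm. Their norm limit is also a strict limit, and strict limits are
  unique.\<close>

lemma matrix_multiplier_in_algebra:
  assumes band: "banded N c" and null: "\<And>e. e > 0 \<Longrightarrow> finite {p. e \<le> norm (c p)}"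
  shows "matrix_multiplier c \<in> range of_algebra"
proof -
  define N' where "N' = max 0 N"
  have band': "banded N' c" and N': "N' \<ge> 0"
    using banded_mono[OF band, of N'] by (simp_all add: N'_def)
  let ?F = "finite_subsets_at_top (UNIV :: (int \<times> int) set)"
  have "cauchy_filter (filtermap (sum (matrix_term c)) ?F)"
    unfolding cauchy_filter_metric_filtermap
  proof (intro allI impI)
    fix e :: real assume e: "e > 0"
    define K where "K = real_of_int (2 * N' + 1)"
    define d where "d = e / (3 * K)"
    have K: "K > 0" using N' by (simp add: K_def)
    have d: "d > 0" using e K by (simp add: d_def)
    define S where "S = {p. d \<le> norm (c p)}"
    have S: "finite S" unfolding S_def by (rule null[OF d])
    \<comment> \<open>\<open>X - Y\<close> avoids S, so its entries are below d, and
      \<open>K * d\<close> = e/3.\<close>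
    have half: "norm (sum (matrix_term c) (X - Y)) \<le> e/3" if "finite X" "S \<subseteq> Y" for X Y
    proof -
      have "norm (sum (matrix_term c) (X - Y)) \<le> K * d"
        unfolding K_def using that d
        by (intro norm_sum_matrix_term[OF _ band' N']) (auto simp: S_def intro: less_imp_le linorder_le_less_linear[THEN disjE])
      then show ?thesis using K by (simp add: d_def)
    qed
    have "dist (sum (matrix_term c) X) (sum (matrix_term c) Y) < e"
      if X: "finite X" "S \<subseteq> X" and Y: "finite Y" "S \<subseteq> Y" for X Y
    proof -
      have "sum (matrix_term c) X = sum (matrix_term c) (X - Y) + sum (matrix_term c) (X \<inter> Y)"
        "sum (matrix_term c) Y = sum (matrix_term c) (Y - X) + sum (matrix_term c) (X \<inter> Y)"
        using X(1) Y(1) sum.Int_Diff[of X "matrix_term c" Y] sum.Int_Diff[of Y "matrix_term c" X]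
        by (simp_all add: add.commute Int_commute)
      then have "dist (sum (matrix_term c) X) (sum (matrix_term c) Y) = norm (sum (matrix_term c) (X - Y) - sum (matrix_term c) (Y - X))"
        by (simp add: dist_norm)
      then show ?thesis
        using norm_triangle_ineq4[of "sum (matrix_term c) (X - Y)" "sum (matrix_term c) (Y - X)"]
          half[OF X(1) Y(2)] half[OF Y(1) X(2)] e by linarith
    qed
    moreover have "\<forall>\<^sub>F X in ?F. finite X \<and> S \<subseteq> X"
      unfolding eventually_finite_subsets_at_top using S by blast
    ultimately show "\<exists>P. eventually P ?F \<and> (\<forall>X Y. P X \<and> P Y \<longrightarrow> dist (sum (matrix_term c) X) (sum (matrix_term c) Y) < e)"
      by (intro exI[of _ "\<lambda>X. finite X \<and> S \<subseteq> X"]) blast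
  qed
  then obtain d where d: "(sum (matrix_term c) \<longlongrightarrow> d) ?F"
    unfolding filterlim_def convergent_filter_iff_cauchy[symmetric] convergent_filter.simps by blast
  have "strict_has_sum (\<lambda>p. of_algebra (matrix_term c p)) (of_algebra d)"
    unfolding strict_has_sum_def strict_tendsto_def of_algebra_sum[symmetric] mult_LR_of_algebra
    by (intro allI conjI tendsto_mult d tendsto_const)
  then have "matrix_multiplier c = of_algebra d"
    by (rule strict_has_sum_unique[OF strict_has_sum_matrix_multiplier[OF band]])
  then show ?thesis by simp
qed

end

section \<open>The extension\<close>

lemma filterlim_int_shift_at_top: "filterlim (\<lambda>i. real_of_int (i + k)) at_top at_top"
  unfolding filterlim_at_top
proof
  fix C :: real
  show "\<forall>\<^sub>F i in at_top. C \<le> real_of_int (i + k)"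
    using eventually_ge_at_top[of "\<lceil>C\<rceil> - k"] by eventually_elim linarith
qed

lemma filterlim_int_shift_at_bot: "filterlim (\<lambda>i. real_of_int (i + k)) at_bot at_bot"
  unfolding filterlim_at_bot
proof
  fix C :: real
  show "\<forall>\<^sub>F i in at_bot. real_of_int (i + k) \<le> C"
    using eventually_le_at_bot[of "\<lfloor>C\<rfloor> - k"] by eventually_elim linarith
qed

text \<open>Between the two ends g may be unbounded as a function of a real variable, but only
  finitely many integers lie there, and S adds up their norms.\<close>

lemma bounded_on_ints:
  fixes g :: "real \<Rightarrow> 'a::real_normed_vector"
  assumes "Bfun g at_top" "(g \<longlongrightarrow> 0) at_bot"
  obtains C where "\<And>i :: int. norm (g (of_int i)) \<le> C"
proof -
  obtain K where "eventually (\<lambda>t. norm (g t) \<le> K) at_top"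
    using assms(1) by (rule BfunE)
  then obtain t0 where t0: "\<And>t. t \<ge> t0 \<Longrightarrow> norm (g t) \<le> K"
    unfolding eventually_at_top_linorder by blast
  have "eventually (\<lambda>t. norm (g t) < 1) at_bot"
    using tendstoD[OF assms(2) zero_less_one] by simp
  then obtain t1 where t1: "\<And>t. t \<le> t1 \<Longrightarrow> norm (g t) < 1"
    unfolding eventually_at_bot_linorder by blast
  define I where "I = {\<lfloor>t1\<rfloor>..\<lceil>t0\<rceil>}"
  define S where "S = (\<Sum>j\<in>I. norm (g (of_int j)))"
  have S: "S \<ge> 0" unfolding S_def by (intro sum_nonneg) simp
  have "norm (g (of_int i)) \<le> \<bar>K\<bar> + 1 + S" for i :: int
  proof -
    consider "of_int i \<ge> t0" | "of_int i \<le> t1" | "i \<in> I"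
      unfolding I_def atLeastAtMost_iff by linarith
    then show ?thesis
    proof cases
      case 1
      show ?thesis using t0[OF 1] S by linarith
    next
      case 2
      show ?thesis using t1[OF 2] S by linarith
    next
      case 3
      have "norm (g (of_int i)) \<le> S"
        unfolding S_def using 3 by (intro member_le_sum) (auto simp: I_def)
      then show ?thesis by linarith
    qed
  qed
  then show ?thesis by (rule that)
qed

lemma C0_zero: "(\<lambda>_. 0) \<in> C0"
  by (simp add: C0_def)

lemma C0_sum: "(\<And>p. p \<in> S \<Longrightarrow> f p \<in> C0) \<Longrightarrow> (\<lambda>x. \<Sum>p\<in>S. f p x) \<in> C0"
  by (induction S rule: infinite_finite_induct) (simp_all add: C0_zero C0_add)

lemma asymptotic_hom_sum:
  fixes \<psi> :: "real \<Rightarrow> (real \<Rightarrow> 'a::cstar_algebra) \<Rightarrow> 'b::cstar_algebra"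
  assumes hom: "asymptotic_hom \<psi>" and "finite S" and "\<And>p. p \<in> S \<Longrightarrow> f p \<in> C0"
  shows "((\<lambda>t. (\<Sum>p\<in>S. \<psi> t (f p)) - \<psi> t (\<lambda>x. \<Sum>p\<in>S. f p x)) \<longlongrightarrow> 0) at_top"
  using assms(2,3)
proof (induction S rule: finite_induct)
  case empty
  \<comment> \<open>The empty sum requires \<psi> at the zero function to tend to 0, which is
    asymptotic homogeneity for the scalar 0.\<close>
  show ?case
    using tendsto_minus[OF asymptotic_hom_scaleC[OF hom C0_zero, of 0]] by (simp add: scaleC_zero_left)
next
  case (insert p S)
  have f: "f p \<in> C0" "\<And>p. p \<in> S \<Longrightarrow> f p \<in> C0" using insert.prems by auto
  have "((\<lambda>t. ((\<Sum>p\<in>S. \<psi> t (f p)) - \<psi> t (\<lambda>x. \<Sum>p\<in>S. f p x)) -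
      (\<psi> t (\<lambda>x. f p x + (\<Sum>p\<in>S. f p x)) - (\<psi> t (f p) + \<psi> t (\<lambda>x. \<Sum>p\<in>S. f p x)))) \<longlongrightarrow> 0 - 0) at_top"
    by (intro tendsto_diff insert.IH f asymptotic_hom_add[OF hom f(1) C0_sum])
  then show ?case
    using insert.hyps by (simp add: algebra_simps)
qed

lemma corona_map_eqI: "m - n \<in> range of_algebra \<Longrightarrow> corona_map m = corona_map n"
  by (simp add: corona_map_def corona.abs_eq_iff corona_rel_def)

lemma corona_map_simps:
  "corona_map m + corona_map n = corona_map (m + n)" "corona_map m * corona_map n = corona_map (m * n)"
  "z *\<^sub>C corona_map m = corona_map (z *\<^sub>C m)" "star (corona_map m) = corona_map (star m)"
  by (simp_all add: corona_map_def plus_corona.abs_eq times_corona.abs_eq scaleC_corona.abs_eq star_corona.abs_eq)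

text \<open>A band consists of finitely many diagonals, and a diagonal tending to 0 at both ends has
  only finitely many entries of norm at least e.\<close>

lemma (in compact_tensor) matrix_multiplier_in_algebraI:
  assumes band: "banded N c"
    and top: "\<And>k. ((\<lambda>i. c (i, i + k)) \<longlongrightarrow> 0) at_top" and bot: "\<And>k. ((\<lambda>i. c (i, i + k)) \<longlongrightarrow> 0) at_bot"
  shows "matrix_multiplier c \<in> range of_algebra"
proof (rule matrix_multiplier_in_algebra[OF band])
  fix e :: real assume e: "e > 0"
  have "finite {i. e \<le> norm (c (i, i + k))}" for k
  proof -
    have "\<forall>\<^sub>F i in at_top. norm (c (i, i + k)) < e" "\<forall>\<^sub>F i in at_bot. norm (c (i, i + k)) < e"
      using tendstoD[OF top e] tendstoD[OF bot e] by simp_all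
    then obtain u v where uv: "\<And>i. i \<ge> u \<Longrightarrow> norm (c (i, i + k)) < e" "\<And>i. i \<le> v \<Longrightarrow> norm (c (i, i + k)) < e"
      unfolding eventually_at_top_linorder eventually_at_bot_linorder by blast
    have "{i. e \<le> norm (c (i, i + k))} \<subseteq> {v..u}"
    proof
      fix i assume "i \<in> {i. e \<le> norm (c (i, i + k))}"
      then show "i \<in> {v..u}" using uv(1)[of i] uv(2)[of i]
        by (cases "u \<le> i"; cases "i \<le> v") auto
    qed
    then show ?thesis by (rule finite_subset) simp
  qed
  then have "finite (\<Union>k\<in>{-N..N}. (\<lambda>i. (i, i + k)) ` {i. e \<le> norm (c (i, i + k))})"
    by simp
  moreover have "{p. e \<le> norm (c p)} \<subseteq> (\<Union>k\<in>{-N..N}. (\<lambda>i. (i, i + k)) ` {i. e \<le> norm (c (i, i + k))})"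
  proof
    fix p assume p: "p \<in> {p. e \<le> norm (c p)}"
    obtain i j where ij: "p = (i, j)" by (cases p)
    have "\<not> N < \<bar>i - j\<bar>" using p e bandedD[OF band, of i j] by (auto simp: ij)
    then have "j - i \<in> {-N..N}" by auto
    moreover have "p \<in> (\<lambda>i'. (i', i' + (j - i))) ` {i'. e \<le> norm (c (i', i' + (j - i)))}"
      using p by (intro image_eqI[of _ _ i]) (auto simp: ij)
    ultimately show "p \<in> (\<Union>k\<in>{-N..N}. (\<lambda>i. (i, i + k)) ` {i. e \<le> norm (c (i, i + k))})"
      by (rule UN_I)
  qed
  ultimately show "finite {p. e \<le> norm (c p)}" by (rule finite_subset[rotated])
qed

section \<open>The partition of unity\<close>

lemma partition_generator_props:
  assumes "partition_generator \<beta>"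
  shows partition_generator_C0: "\<beta> \<in> C0"
    and partition_generator_nonneg: "\<beta> t \<ge> 0"
    and partition_generator_far: "\<bar>s - t\<bar> \<ge> 3 \<Longrightarrow> \<beta> s * \<beta> t = 0"
    and partition_generator_two: "\<beta> t * \<beta> (t + 2) = 0"
    and partition_generator_sum: "(\<beta> (t - 1) + \<beta> t + \<beta> (t + 1)) * \<beta> t = \<beta> t"
proof -
  have \<beta>: "\<beta> \<in> C0" "\<And>t. t \<notin> {-1..1} \<Longrightarrow> \<beta> t = 0" "\<And>t. t \<in> {-1<..<1} \<Longrightarrow> \<beta> t > 0"
    "\<And>t. \<beta> (t - 1) * \<beta> (t + 1) = 0"
    "\<And>t. \<beta> (t + 1) * \<beta> t + (\<beta> t)\<^sup>2 + \<beta> (t - 1) * \<beta> t = \<beta> t"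
    using assms by (auto simp: partition_generator_def translate_def)
  show "\<beta> \<in> C0" by fact
  \<comment> \<open>At 1 and -1 the first conditions prescribe no sign, so nonnegativity there comes
    by continuity from neighbouring points.\<close>
  show "\<beta> t \<ge> 0"
  proof (rule tendsto_lowerbound)
    show "(\<beta> \<longlongrightarrow> \<beta> t) (at t)"
      using \<beta>(1) by (simp add: C0_def continuous_on_eq_continuous_at isCont_def)
    have "\<forall>\<^sub>F x in at t. x \<noteq> 1" "\<forall>\<^sub>F x in at t. x \<noteq> -1"
      by (rule eventually_neq_at_within)+
    then show "\<forall>\<^sub>F x in at t. 0 \<le> \<beta> x"
    proof eventually_elim
      fix x :: real assume "x \<noteq> 1" "x \<noteq> -1"
      then show "0 \<le> \<beta> x"
        using \<beta>(2)[of x] \<beta>(3)[of x] by (cases "x \<in> {-1..1}") auto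
    qed
  qed simp
  show "\<beta> s * \<beta> t = 0" if "\<bar>s - t\<bar> \<ge> 3"
  proof -
    have "s \<notin> {-1..1} \<or> t \<notin> {-1..1}" using that unfolding atLeastAtMost_iff by linarith
    then show ?thesis using \<beta>(2) by auto
  qed
  show "\<beta> t * \<beta> (t + 2) = 0" using \<beta>(4)[of "t + 1"] by (simp add: add.assoc)
  show "(\<beta> (t - 1) + \<beta> t + \<beta> (t + 1)) * \<beta> t = \<beta> t"
    using \<beta>(5)[of t] by (simp add: algebra_simps power2_eq_square)
qed

section \<open>The coefficient matrix of \<open>Phi0\<close>\<close>

locale translation_invariant_extension = compact_tensor T
  for T :: "'b::cstar_algebra \<Rightarrow> compact_op \<Rightarrow> 'd::cstar_algebra" +
  fixes \<phi> :: "real \<Rightarrow> (real \<Rightarrow> 'a::cstar_algebra) \<Rightarrow> 'b" and \<beta> :: "real \<Rightarrow> real"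
  assumes hom: "asymptotic_hom \<phi>" and invariant: "asymptotically_translation_invariant \<phi>"
    and \<phi>_zero: "\<phi> t (\<lambda>_. 0) = 0" and generator: "partition_generator \<beta>"
begin

text \<open>This is \<open>h\<^sub>k\<close>, the product of the functions \<open>alpha\<close> with
  indices i and i + k after translation by i, which depends on k alone.\<close>

definition overlap :: "int \<Rightarrow> real \<Rightarrow> real" where
  "overlap k t = sqrt (\<beta> t * \<beta> (t + of_int k))"

definition coeff :: "'a \<Rightarrow> int \<times> int \<Rightarrow> 'b" where
  "coeff a = (\<lambda>(i, j). \<phi> (of_int i) (elem_tensor (overlap (j - i)) a))"

lemmas \<beta>_nonneg = partition_generator_nonneg[OF generator]

lemma translate_alpha:
  "translate (of_int i) (\<lambda>t. alpha \<beta> i t * alpha \<beta> j t) = overlap (j - i)"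
  by (simp add: fun_eq_iff translate_def alpha_def overlap_def real_sqrt_mult algebra_simps)

lemma translate_overlap: "translate (of_int k) (overlap k) = overlap (- k)"
  by (simp add: fun_eq_iff translate_def overlap_def mult.commute)

lemma overlap_C0: "overlap k \<in> C0"
proof -
  have "(\<lambda>t. \<beta> t * translate (- of_int k) \<beta> t) \<in> C0"
    by (intro C0_mult C0_translate partition_generator_C0 generator)
  then show ?thesis
    unfolding C0_def overlap_def translate_def
    using tendsto_real_sqrt[of "\<lambda>t. \<beta> t * \<beta> (t + of_int k)" 0]
    by (auto intro!: continuous_on_real_sqrt)
qed

text \<open>At distance 2 the closed supports still touch, and the orthogonality condition on
  \<beta> applies; from distance 3 on they are disjoint.\<close>

lemma overlap_far:
  assumes "1 < \<bar>k\<bar>"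
  shows "overlap k = (\<lambda>_. 0)"
proof
  fix t
  consider "k = 2" | "k = -2" | "\<bar>k\<bar> \<ge> 3" using assms by linarith
  then have "\<beta> t * \<beta> (t + of_int k) = 0"
  proof cases
    case 1
    then show ?thesis using partition_generator_two[OF generator, of t] by simp
  next
    case 2
    then show ?thesis using partition_generator_two[OF generator, of "t - 2"] by (simp add: disj_commute)
  next
    case 3
    then show ?thesis by (intro partition_generator_far[OF generator]) simp
  qed
  then show "overlap k t = 0" by (simp add: overlap_def)
qed

text \<open>Each summand is \<open>\<beta> (t + of_int p)\<close> times \<open>overlap r t\<close>.
  Over the window around r these values of \<beta> add up to 1 where
  \<open>\<beta> (t + of_int r)\<close> is nonzero, and elsewhere \<open>overlap r t\<close> is 0.
  The window is centered at r to match the product formula, which sums around the column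
  index.\<close>

lemma overlap_convolution:
  "(\<Sum>p=r-1..r+1. overlap p t * overlap (r - p) (t + of_int p)) = overlap r t"
proof -
  have "overlap p t * overlap (r - p) (t + of_int p) = \<beta> (t + of_int p) * overlap r t" for p
  proof -
    have "overlap p t * overlap (r - p) (t + of_int p) =
        sqrt ((\<beta> (t + of_int p))\<^sup>2 * (\<beta> t * \<beta> (t + of_int r)))"
      by (simp add: overlap_def flip: real_sqrt_mult) (simp add: power2_eq_square ac_simps)
    then show ?thesis by (simp add: overlap_def real_sqrt_mult \<beta>_nonneg)
  qed
  then have "(\<Sum>p=r-1..r+1. overlap p t * overlap (r - p) (t + of_int p)) =
      (\<Sum>p=r-1..r+1. \<beta> (t + of_int p)) * overlap r t"
    by (simp add: sum_distrib_right)
  also have "(\<Sum>p=r-1..r+1. \<beta> (t + of_int p)) =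
      \<beta> (t + of_int r - 1) + \<beta> (t + of_int r) + \<beta> (t + of_int r + 1)"
  proof -
    have "{r-1..r+1} = {r-1, r, r+1}" by auto
    then show ?thesis by (simp add: algebra_simps)
  qed
  also have "\<dots> * overlap r t = overlap r t"
  proof (cases "\<beta> (t + of_int r) = 0")
    case False
    then show ?thesis using partition_generator_sum[OF generator, of "t + of_int r"] by simp
  qed (simp add: overlap_def)
  finally show ?thesis .
qed

lemma \<phi>_ints_at_bot: "f \<in> C0 \<Longrightarrow> ((\<lambda>i. \<phi> (of_int (i + k)) f) \<longlongrightarrow> 0) at_bot"
  by (rule filterlim_compose[OF asymptotic_hom_at_bot[OF hom] filterlim_int_shift_at_bot])

lemma C0_overlap_tensor: "elem_tensor (overlap k) a \<in> C0"
  by (intro C0_elem_tensor overlap_C0)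

lemma coeff_diag: "coeff a (i, i + k) = \<phi> (of_int i) (elem_tensor (overlap k) a)"
  by (simp add: coeff_def)

lemma coeff_at_bot: "((\<lambda>i. coeff a (i + k, i + l)) \<longlongrightarrow> 0) at_bot"
  using \<phi>_ints_at_bot[OF C0_overlap_tensor, of k "l - k" a] by (simp add: coeff_def)

text \<open>Off the three central diagonals \<open>overlap\<close> is the zero function, and
  \<open>\<phi>_zero\<close> makes these entries exactly 0. On each of the three,
  \<open>asymptotic_hom_Bfun\<close> and the limit at -\<infinity> bound the entries.\<close>

lemma banded_coeff: "banded 1 (coeff a)"
proof -
  have "\<exists>C. \<forall>i::int. norm (\<phi> (of_int i) (elem_tensor (overlap k) a)) \<le> C" for k
    using bounded_on_ints[OF asymptotic_hom_Bfun[OF hom C0_overlap_tensor] asymptotic_hom_at_bot[OF hom C0_overlap_tensor]]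
    by metis
  then obtain C where C: "\<And>k i. norm (\<phi> (of_int i) (elem_tensor (overlap k) a)) \<le> C k"
    by metis
  have C0: "C k \<ge> 0" for k using C[of 0 k] norm_ge_zero order_trans by blast
  have far: "coeff a (i, j) = 0" if "1 < \<bar>i - j\<bar>" for i j
    using that overlap_far[of "j - i"] by (simp add: coeff_def elem_tensor_def \<phi>_zero abs_minus_commute)
  have "norm (coeff a (i, j)) \<le> C (-1) + C 0 + C 1" for i j
  proof (cases "1 < \<bar>i - j\<bar>")
    case True
    then show ?thesis using far C0[of "-1"] C0[of 0] C0[of 1] by simp
  next
    case False
    then have "j - i = -1 \<or> j - i = 0 \<or> j - i = 1" by linarith
    then show ?thesis
      using C[of i "j - i"] C0[of "-1"] C0[of 0] C0[of 1] by (auto simp: coeff_def)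
  qed
  then show ?thesis using far by (auto simp: banded_def)
qed

lemma Phi0_summand_eq: "Phi0_summand T \<beta> \<phi> a = (\<lambda>p. of_algebra (matrix_term (coeff a) p))"
  by (auto simp: Phi0_summand_def fun_eq_iff matrix_term_def coeff_def entry_def translate_alpha)

lemma Phi0_eq: "Phi0 T \<beta> \<phi> a = matrix_multiplier (coeff a)"
  by (simp add: Phi0_def matrix_multiplier_def Phi0_summand_eq)

lemma Phi0_strict_sum: "strict_has_sum (Phi0_summand T \<beta> \<phi> a) (Phi0 T \<beta> \<phi> a)"
  unfolding Phi0_summand_eq Phi0_eq by (rule strict_has_sum_matrix_multiplier[OF banded_coeff])

section \<open>Sums, scalar multiples, adjoints and products in the corona algebra\<close>

lemma tendsto_int_at_top: "(g \<longlongrightarrow> 0) at_top \<Longrightarrow> ((\<lambda>i. g (real_of_int (i + k))) \<longlongrightarrow> 0) at_top"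
  by (rule filterlim_compose[OF _ filterlim_int_shift_at_top])

lemma Phi_add: "Phi T \<beta> \<phi> (a + b) = Phi T \<beta> \<phi> a + Phi T \<beta> \<phi> b"
proof -
  have "matrix_multiplier (\<lambda>p. coeff (a + b) p - (coeff a p + coeff b p)) \<in> range of_algebra"
  proof (rule matrix_multiplier_in_algebraI[OF banded_diff[OF banded_coeff banded_add[OF banded_coeff banded_coeff]]])
    fix k
    have "elem_tensor (overlap k) (a + b) = (\<lambda>x. elem_tensor (overlap k) a x + elem_tensor (overlap k) b x)"
      by (simp add: elem_tensor_def scaleR_add_right)
    then show "((\<lambda>i. coeff (a + b) (i, i + k) - (coeff a (i, i + k) + coeff b (i, i + k))) \<longlongrightarrow> 0) at_top"
      using tendsto_int_at_top[OF asymptotic_hom_add[OF hom C0_overlap_tensor[of k a] C0_overlap_tensor[of k b]], of 0]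
      by (simp add: coeff_diag)
    show "((\<lambda>i. coeff (a + b) (i, i + k) - (coeff a (i, i + k) + coeff b (i, i + k))) \<longlongrightarrow> 0) at_bot"
      using tendsto_diff[OF coeff_at_bot[of "a + b" 0 k] tendsto_add[OF coeff_at_bot[of a 0 k] coeff_at_bot[of b 0 k]]]
      by simp
  qed
  then show ?thesis
    by (simp add: Phi_def Phi0_eq corona_map_simps matrix_multiplier_add[OF banded_coeff banded_coeff]
        matrix_multiplier_diff[OF banded_coeff banded_add[OF banded_coeff banded_coeff]] corona_map_eqI)
qed

lemma Phi_scaleC: "Phi T \<beta> \<phi> (z *\<^sub>C a) = z *\<^sub>C Phi T \<beta> \<phi> a"
proof -
  have "matrix_multiplier (\<lambda>p. coeff (z *\<^sub>C a) p - z *\<^sub>C coeff a p) \<in> range of_algebra"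
  proof (rule matrix_multiplier_in_algebraI[OF banded_diff[OF banded_coeff banded_scaleC[OF banded_coeff]]])
    fix k
    have "elem_tensor (overlap k) (z *\<^sub>C a) = (\<lambda>x. z *\<^sub>C elem_tensor (overlap k) a x)"
      by (simp add: elem_tensor_def scaleR_scaleC scaleC_scaleC mult.commute)
    then show "((\<lambda>i. coeff (z *\<^sub>C a) (i, i + k) - z *\<^sub>C coeff a (i, i + k)) \<longlongrightarrow> 0) at_top"
      using tendsto_int_at_top[OF asymptotic_hom_scaleC[OF hom C0_overlap_tensor[of k a], of z], of 0]
      by (simp add: coeff_diag)
    show "((\<lambda>i. coeff (z *\<^sub>C a) (i, i + k) - z *\<^sub>C coeff a (i, i + k)) \<longlongrightarrow> 0) at_bot"
      using tendsto_diff[OF coeff_at_bot[of "z *\<^sub>C a" 0 k] tendsto_scaleC[OF coeff_at_bot[of a 0 k]]]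
      by (simp add: scaleC_zero_right)
  qed
  then show ?thesis
    by (simp add: Phi_def Phi0_eq corona_map_simps matrix_multiplier_scaleC[OF banded_coeff]
        matrix_multiplier_diff[OF banded_coeff banded_scaleC[OF banded_coeff]] corona_map_eqI)
qed

lemma invariant_tensor:
  "((\<lambda>t. \<phi> (t - s) (elem_tensor h a) - \<phi> t (elem_tensor (translate s h) a)) \<longlongrightarrow> 0) at_top" if "h \<in> C0"
proof -
  have "translate s (elem_tensor h a) = elem_tensor (translate s h) a"
    by (simp add: translate_def elem_tensor_def)
  then show ?thesis
    using invariant C0_elem_tensor[OF that, of a] unfolding asymptotically_translation_invariant_def by metis
qed

lemma Phi_star: "Phi T \<beta> \<phi> (star a) = star (Phi T \<beta> \<phi> a)"
proof -
  have "matrix_multiplier (\<lambda>p. coeff (star a) p - (case p of (i, j) \<Rightarrow> star (coeff a (j, i)))) \<in> range of_algebra"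
  proof (rule matrix_multiplier_in_algebraI[OF banded_diff[OF banded_coeff banded_star[OF banded_coeff]]])
    fix k
    have star_tensor: "elem_tensor (overlap (- k)) (star a) = (\<lambda>x. star (elem_tensor (overlap (- k)) a x))"
      by (simp add: elem_tensor_def scaleR_scaleC star_scaleC)
    \<comment> \<open>The parameter t is the column index, since the adjoint matrix has the star of
      a row-t entry in column t. The inserted middle term separates the translation error from the
      adjoint error.\<close>
    have "((\<lambda>t. (\<phi> (t - of_int k) (elem_tensor (overlap k) (star a)) - \<phi> t (elem_tensor (overlap (- k)) (star a))) +
        (\<phi> t (elem_tensor (overlap (- k)) (star a)) - star (\<phi> t (elem_tensor (overlap (- k)) a)))) \<longlongrightarrow> 0 + 0) at_top"
      using invariant_tensor[OF overlap_C0, of "of_int k" k "star a"]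
        asymptotic_hom_star[OF hom C0_overlap_tensor, of "- k" a]
      unfolding translate_overlap star_tensor by (rule tendsto_add)
    then have "((\<lambda>t. \<phi> (t - of_int k) (elem_tensor (overlap k) (star a)) - star (\<phi> t (elem_tensor (overlap (- k)) a))) \<longlongrightarrow> 0) at_top"
      by simp
    \<comment> \<open>Putting t = i + k makes t - k the row index i.\<close>
    from tendsto_int_at_top[OF this, of k]
    show "((\<lambda>i. coeff (star a) (i, i + k) - (case (i, i + k) of (i, j) \<Rightarrow> star (coeff a (j, i)))) \<longlongrightarrow> 0) at_top"
      by (simp add: coeff_def)
    show "((\<lambda>i. coeff (star a) (i, i + k) - (case (i, i + k) of (i, j) \<Rightarrow> star (coeff a (j, i)))) \<longlongrightarrow> 0) at_bot"
      using tendsto_diff[OF coeff_at_bot[of "star a" 0 k] tendsto_star[OF coeff_at_bot[of a k 0]]]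
      by (simp add: star_zero)
  qed
  then show ?thesis
    by (simp add: Phi_def Phi0_eq corona_map_simps matrix_multiplier_star[OF banded_coeff]
        matrix_multiplier_diff[OF banded_coeff banded_star[OF banded_coeff]] corona_map_eqI)
qed

lemma Phi_mult: "Phi T \<beta> \<phi> (a * b) = Phi T \<beta> \<phi> a * Phi T \<beta> \<phi> b"
proof -
  let ?prod = "\<lambda>(i, j). \<Sum>k=j-1..j+1. coeff a (i, k) * coeff b (k, j)"
  have prod_diag: "?prod (i, i + r) = (\<Sum>p=r-1..r+1. coeff a (i, i + p) * coeff b (i + p, i + r))" for i r
    by (simp, rule sum.reindex_bij_witness[of _ "\<lambda>p. i + p" "\<lambda>k. k - i"]) auto
  \<comment> \<open>The width 1 of \<open>coeff (a * b)\<close> is relaxed to the width 2 of the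
    product, so that the difference is banded.\<close>
  have band: "banded 2 (coeff (a * b))" "banded 2 ?prod"
    using banded_mono[OF banded_coeff, of 2] banded_mult[OF banded_coeff banded_coeff, of a b] by simp_all
  have "matrix_multiplier (\<lambda>p. coeff (a * b) p - ?prod p) \<in> range of_algebra"
  proof (rule matrix_multiplier_in_algebraI[OF banded_diff[OF band]])
    fix r
    \<comment> \<open>With t = i, \<open>f p\<close> and \<open>g p\<close> are the arguments behind
      the factors at (i, i + p) and (i + p, i + r). Translating \<open>g p\<close> to
      \<open>g' p\<close> allows both factors to be evaluated at the same parameter t.\<close>
    define f where "f p = elem_tensor (overlap p) a" for p
    define g where "g p = elem_tensor (overlap (r - p)) b" for p
    define g' where "g' p = elem_tensor (translate (- of_int p) (overlap (r - p))) b" for p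
    have C0: "f p \<in> C0" "g p \<in> C0" "g' p \<in> C0" for p
      unfolding f_def g_def g'_def by (intro C0_elem_tensor C0_translate overlap_C0)+
    have shift: "((\<lambda>t. \<phi> (t + of_int p) (g p) - \<phi> t (g' p)) \<longlongrightarrow> 0) at_top" for p
      using invariant_tensor[OF overlap_C0, of "- of_int p" "r - p" b] by (simp add: g_def g'_def)
    have prod: "((\<lambda>t. \<phi> t (f p) * \<phi> (t + of_int p) (g p) - \<phi> t (\<lambda>x. f p x * g' p x)) \<longlongrightarrow> 0) at_top" for p
    proof -
      \<comment> \<open>Boundedness of \<phi> at \<open>f p\<close> makes the translation error
        negligible after multiplication.\<close>
      have "((\<lambda>t. \<phi> t (f p) * (\<phi> (t + of_int p) (g p) - \<phi> t (g' p))) \<longlongrightarrow> 0) at_top"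
        using bounded_bilinear.Bfun_prod_Zfun[OF bounded_bilinear_mult asymptotic_hom_Bfun[OF hom C0(1)[of p]],
            of "\<lambda>t. \<phi> (t + of_int p) (g p) - \<phi> t (g' p)"] shift[of p]
        by (simp add: tendsto_Zfun_iff)
      from tendsto_diff[OF this asymptotic_hom_mult[OF hom C0(1)[of p] C0(3)[of p]]]
      show ?thesis by (simp add: algebra_simps)
    qed
    have "f p x * g' p x = (overlap p x * overlap (r - p) (x + of_int p)) *\<^sub>R (a * b)" for p x
      by (simp add: f_def g'_def elem_tensor_def translate_def mult.commute)
    then have fg: "(\<lambda>x. \<Sum>p=r-1..r+1. f p x * g' p x) = elem_tensor (overlap r) (a * b)"
      by (simp only: elem_tensor_def overlap_convolution flip: scaleR_sum_left)
    \<comment> \<open>The first sum collects the multiplicativity errors, the second bracket is the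
      additivity error over the three values of p.\<close>
    have "((\<lambda>t. (\<Sum>p=r-1..r+1. \<phi> t (f p) * \<phi> (t + of_int p) (g p) - \<phi> t (\<lambda>x. f p x * g' p x)) +
        ((\<Sum>p=r-1..r+1. \<phi> t (\<lambda>x. f p x * g' p x)) - \<phi> t (\<lambda>x. \<Sum>p=r-1..r+1. f p x * g' p x))) \<longlongrightarrow>
        (\<Sum>p=r-1..r+1. 0) + 0) at_top"
      by (intro tendsto_add tendsto_sum prod asymptotic_hom_sum[OF hom] C0_mult C0 finite_atLeastAtMost_int)
    then have "((\<lambda>t. (\<Sum>p=r-1..r+1. \<phi> t (f p) * \<phi> (t + of_int p) (g p)) - \<phi> t (elem_tensor (overlap r) (a * b))) \<longlongrightarrow> 0) at_top"
      by (simp add: sum_subtractf fg)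
    from tendsto_int_at_top[OF tendsto_minus[OF this, simplified], of 0]
    show "((\<lambda>i. coeff (a * b) (i, i + r) - ?prod (i, i + r)) \<longlongrightarrow> 0) at_top"
      unfolding prod_diag by (simp add: coeff_def f_def g_def)
    \<comment> \<open>At -\<infinity> every factor tends to 0 by itself. Writing
      \<open>i + 0\<close> gives the row index the shape expected by
      \<open>coeff_at_bot\<close>.\<close>
    have "((\<lambda>i. coeff (a * b) (i + 0, i + r) - (\<Sum>p=r-1..r+1. coeff a (i + 0, i + p) * coeff b (i + p, i + r))) \<longlongrightarrow>
        0 - (\<Sum>p=r-1..r+1. 0 * 0)) at_bot"
      by (intro tendsto_diff tendsto_sum tendsto_mult coeff_at_bot)
    then show "((\<lambda>i. coeff (a * b) (i, i + r) - ?prod (i, i + r)) \<longlongrightarrow> 0) at_bot"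
      unfolding prod_diag by simp
  qed
  then show ?thesis
    by (simp add: Phi_def Phi0_eq corona_map_simps matrix_multiplier_mult[OF banded_coeff banded_coeff]
        matrix_multiplier_diff[OF band] corona_map_eqI)
qed

lemma star_hom_Phi: "star_hom (Phi T \<beta> \<phi>)"
  unfolding star_hom_def clinear_map_def by (simp add: Phi_add Phi_scaleC Phi_mult Phi_star)

end

theorem lemma4p1:
  fixes \<phi> :: "real \<Rightarrow> (real \<Rightarrow> 'a::cstar_algebra) \<Rightarrow> 'b::cstar_algebra"
    and T :: "'b \<Rightarrow> compact_op \<Rightarrow> 'd::cstar_algebra"
    and \<beta>\<^sub>0 :: "real \<Rightarrow> real"
  assumes "separable_space (euclidean :: 'a topology)"
    and "sigma_unital TYPE('b)"
    and "cstar_tensor_product T"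
    and "asymptotic_hom \<phi>"
    and "asymptotically_translation_invariant \<phi>"
    and "\<forall>t. \<phi> t (\<lambda>_. 0) = 0"
    and "partition_generator \<beta>\<^sub>0"
  shows "(\<forall>a. strict_has_sum (Phi0_summand T \<beta>\<^sub>0 \<phi> a) (Phi0 T \<beta>\<^sub>0 \<phi> a)) \<and>
    star_hom (Phi T \<beta>\<^sub>0 \<phi>)"
proof -
  interpret translation_invariant_extension T \<phi> \<beta>\<^sub>0
    by unfold_locales (use assms in auto)
  show ?thesis using Phi0_strict_sum star_hom_Phi by blast
qed

end
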